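(* Let $0<\alpha<n$ and $1<p\le q<\infty$, and suppose $$\frac{p'}{q'}\Big(1-\frac{\alpha}{n}\Big)\ge 1.$$ Let $\delta>0$ and $\Phi(t)=t^q\big(\log(e+t)\big)^{q-1+\delta}$. Then for every pair of weights $(u,\sigma)$ that satisfies $$\sup_Q|Q|^{\frac{\alpha}{n}+\frac1q-\frac1p}\,\|u^{\frac1q}\|_{\Phi,Q}\,\|\sigma^{\frac1{p'}}\|_{p',Q}<\infty,$$ there is a constant $C<\infty$ such that for all $f\in L^p(\sigma)$, $$\|I_\alpha(f\sigma)\|_{L^{q,\infty}(u)}\le C\,\|f\|_{L^p(\sigma)}.$$
   Context: All functions are on $\mathbb{R}^n$; the supremum is over all cubes $Q\subset\mathbb{R}^n$ with sides parallel to the axes. A weight is a non-negative locally integrable function. For $1<r<\infty$, $r'=r/(r-1)$. Riesz potential: $I_\alpha f(x)=\int_{\mathbb{R}^n}\frac{f(y)}{|x-y|^{n-\alpha}}\,dy$. Localized Luxemburg norm: $\|f\|_{\Phi,Q}=\inf\{\lambda>0:\frac1{|Q|}\int_Q\Phi(|f(x)|/\lambda)\,dx\le1\}$; for $1<r<\infty$, $\|f\|_{r,Q}=\big(\frac1{|Q|}\int_Q|f|^r\,dx\big)^{1/r}$. $\|f\|_{L^p(\sigma)}=(\int|f|^p\sigma\,dx)^{1/p}$ and $\|g\|_{L^{q,\infty}(u)}=\sup_{t>0}t\,u(\{x:|g(x)|>t\})^{1/q}$, where $u(E)=\int_E u\,dx$. *)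

theory Defs
  imports "HOL-Analysis.Analysis"
begin

text \<open>
  Powers of extended nonnegative numbers; only used with exponent \<open>r > 0\<close>,
  so that \<open>\<infinity> ^ r = \<infinity>\<close> and \<open>0 ^ r = 0\<close>.
\<close>
definition enn_powr :: "ennreal \<Rightarrow> real \<Rightarrow> ennreal" where
  "enn_powr x r = (if x = \<infinity> then \<infinity> else ennreal (enn2real x powr r))"

definition conj_exp :: "real \<Rightarrow> real" where
  "conj_exp r = r / (r - 1)"

definition cubes :: "(real ^ 'n) set set" where
  "cubes = {cbox a (\<chi> i. a $ i + l) | a l. l > 0}"

definition weight :: "(real ^ 'n \<Rightarrow> real) \<Rightarrow> bool" where
  "weight w \<longleftrightarrow> (\<forall>x. 0 \<le> w x) \<and> (\<forall>K. compact K \<longrightarrow> w absolutely_integrable_on K)"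

definition wmeasure :: "(real ^ 'n \<Rightarrow> real) \<Rightarrow> (real ^ 'n) set \<Rightarrow> ennreal" where
  "wmeasure u E = (\<integral>\<^sup>+x\<in>E. ennreal (u x) \<partial>lebesgue)"

definition average :: "(real ^ 'n) set \<Rightarrow> (real ^ 'n \<Rightarrow> real) \<Rightarrow> ennreal" where
  "average Q g = (\<integral>\<^sup>+x\<in>Q. ennreal (g x) \<partial>lebesgue) / emeasure lebesgue Q"

text \<open>The infimum is taken in \<open>[0, \<infinity>]\<close>, so it is \<open>\<infinity>\<close> if no \<open>\<lambda>\<close> is admissible.\<close>
definition luxemburg_norm ::
    "(real \<Rightarrow> real) \<Rightarrow> (real ^ 'n) set \<Rightarrow> (real ^ 'n \<Rightarrow> real) \<Rightarrow> ennreal" where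
  "luxemburg_norm \<Phi> Q f =
     Inf {ennreal l | l. l > 0 \<and> average Q (\<lambda>x. \<Phi> (\<bar>f x\<bar> / l)) \<le> 1}"

definition local_norm :: "real \<Rightarrow> (real ^ 'n) set \<Rightarrow> (real ^ 'n \<Rightarrow> real) \<Rightarrow> ennreal" where
  "local_norm r Q f = enn_powr (average Q (\<lambda>x. \<bar>f x\<bar> powr r)) (1 / r)"

definition Lp_norm :: "real \<Rightarrow> (real ^ 'n \<Rightarrow> real) \<Rightarrow> (real ^ 'n \<Rightarrow> real) \<Rightarrow> ennreal" where
  "Lp_norm p \<sigma> f = enn_powr (\<integral>\<^sup>+x. ennreal (\<bar>f x\<bar> powr p * \<sigma> x) \<partial>lebesgue) (1 / p)"

definition Lp_space :: "real \<Rightarrow> (real ^ 'n \<Rightarrow> real) \<Rightarrow> (real ^ 'n \<Rightarrow> real) set" where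
  "Lp_space p \<sigma> = {f \<in> borel_measurable lebesgue. Lp_norm p \<sigma> f < \<infinity>}"

definition weak_Lq_norm :: "real \<Rightarrow> (real ^ 'n \<Rightarrow> real) \<Rightarrow> (real ^ 'n \<Rightarrow> real) \<Rightarrow> ennreal" where
  "weak_Lq_norm q u g =
     (SUP t\<in>{0<..}. ennreal t * enn_powr (wmeasure u {x. \<bar>g x\<bar> > t}) (1 / q))"

text \<open>
  The Bochner integral is \<open>0\<close> where the integral does not converge absolutely,
  so convergence is recorded by a separate predicate.  At \<open>y = x\<close> the integrand
  has the value \<open>0\<close>, which is irrelevant because a single point is a null set.
\<close>
definition riesz_kernel :: "real \<Rightarrow> real ^ 'n \<Rightarrow> real ^ 'n \<Rightarrow> real" where
  "riesz_kernel \<alpha> x y = 1 / norm (x - y) powr (real CARD('n) - \<alpha>)"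

definition riesz_converges :: "real \<Rightarrow> (real ^ 'n \<Rightarrow> real) \<Rightarrow> real ^ 'n \<Rightarrow> bool" where
  "riesz_converges \<alpha> f x \<longleftrightarrow> integrable lebesgue (\<lambda>y. f y * riesz_kernel \<alpha> x y)"

definition riesz_potential :: "real \<Rightarrow> (real ^ 'n \<Rightarrow> real) \<Rightarrow> real ^ 'n \<Rightarrow> real" where
  "riesz_potential \<alpha> f x = (LINT y|lebesgue. f y * riesz_kernel \<alpha> x y)"

definition log_bump :: "real \<Rightarrow> real \<Rightarrow> real \<Rightarrow> real" where
  "log_bump q \<delta> t = t powr q * (ln (exp 1 + t)) powr (q - 1 + \<delta>)"

end

theory Submission
  imports Defs
begin

text \<open>
  By duality it suffices to bound \<open>\<integral>\<^sub>E I\<^sub>\<alpha>(f \<sigma>) u\<close> by \<open>\<parallel>f\<parallel> u(E) powr (1 / q')\<close> for bounded \<open>E\<close>, and the kernel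
  is dominated by finitely many dyadic sums
  \<open>\<Sum>Q. |Q| powr (\<alpha>/n - 1) \<cdot> v(Q) \<cdot> \<integral>\<^sub>Q f \<sigma>\<close> with \<open>v = u 1\<^sub>E\<close>.  As \<open>\<alpha> > 0\<close>, such a sum is
  controlled by the cubes at which \<open>|Q| powr \<beta>\<close> times the \<open>v\<close>-average of \<open>Q\<close> (for some \<open>\<beta> < \<alpha>/n\<close>) sets a record
  among the ancestors of \<open>Q\<close>; along nested records this quantity grows geometrically.
  Sort the records by the size of the two-weight product on \<open>Q\<close> (about \<open>2 powr - i\<close>) and by the
  ratio of the \<open>q\<close>-th power of the bumped norm to the average (about \<open>2 powr r\<close>).  Inside one class the masses
  \<open>\<sigma>(Q)\<close> decay geometrically along nested cubes, which together with \<open>p < q\<close>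
  (forced by the exponent condition) gives a Carleson embedding for the averages of \<open>f\<close>, while the
  logarithmic bump makes the \<open>v(Q)\<close> sum to at most a multiple of \<open>2 powr (r/\<theta>) \<cdot> v(E)\<close> with \<open>\<theta> = q - 1 + \<delta>\<close>.  Hoelder's inequality leaves a series that is geometric in
  \<open>i\<close> and \<open>r\<close> because \<open>\<theta> > q - 1\<close>.
\<close>

section \<open>Sums over families indexed by integer levels\<close>

text \<open>Neither weight is doubling, so \<sigma>(Q) need not decay along nested cubes. The decay
  is extracted from the two-weight product: solved for \<sigma>(Q), it makes
  \<open>\<sigma>(Q) powr (1 - 1/p)\<close> within one class comparable to
  \<open>|Q| powr (1 - 1/q - a + \<beta>/q)\<close> times the power -1/q of the record quantity,
  where a = \<alpha>/n. Along descending records the second factor shrinks geometrically, and the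
  first does not grow once its exponent is nonnegative. This asks for a large \<beta>, whereas
  collapsing all cubes below a record into it takes a geometric series with exponent a - \<beta>,
  hence \<beta> < a. For a > 1 - 1/q plain averages (\<beta> = 0) would violate the first demand,
  which is why records carry a fractional power of the volume. The rate
  \<open>2 powr (r/\<theta>)\<close> is the logarithm of the window of heights of v that matter in a
  class. Hoelder raises it to the power 1 - 1/q and sets it against a gain
  \<open>2 powr (- r/q)\<close>; the two balance at \<theta> = q - 1.\<close>

lemma nn_integral_count_space_le:
  fixes f :: "'a \<Rightarrow> ennreal"
  assumes "countable A" and le: "\<And>F. finite F \<Longrightarrow> F \<subseteq> A \<Longrightarrow> sum f F \<le> B"
  shows "(\<integral>\<^sup>+x. f x \<partial>count_space A) \<le> B"
proof (cases "finite A")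
  case True
  then show ?thesis using le[of A] by (simp add: nn_integral_count_space_finite)
next
  case False
  note bij = bij_betw_from_nat_into[OF \<open>countable A\<close> False]
  have "(\<integral>\<^sup>+x. f x \<partial>count_space A) = (\<Sum>n. f (from_nat_into A n))"
    by (simp add: nn_integral_bij_count_space[symmetric, OF bij] nn_integral_count_space_nat)
  also have "\<dots> = (SUP n. \<Sum>i<n. f (from_nat_into A i))"
    by (rule suminf_eq_SUP)
  also have "\<dots> \<le> B"
  proof (rule SUP_least)
    fix n :: nat
    have "inj_on (from_nat_into A) {..<n}"
      using bij by (auto simp: bij_betw_def inj_on_def)
    then have "(\<Sum>i<n. f (from_nat_into A i)) = sum f (from_nat_into A ` {..<n})"
      by (simp add: sum.reindex)
    also have "\<dots> \<le> B"
      using bij by (intro le) (auto simp: bij_betw_def)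
    finally show "(\<Sum>i<n. f (from_nat_into A i)) \<le> B" .
  qed
  finally show ?thesis .
qed

text \<open>Young's inequality for \<open>f / X powr (1/r)\<close> and
  \<open>g / Y powr (1/s)\<close>, summed. Positive bounds X and Y in place of the norms avoid
  dividing by a norm that is zero or infinite.\<close>

lemma nn_integral_count_space_Hoelder:
  fixes f g :: "'a \<Rightarrow> real"
  assumes r: "1 < r" "1 < s" "1 / r + 1 / s = 1"
    and pos: "\<And>x. x \<in> A \<Longrightarrow> 0 \<le> f x" "\<And>x. x \<in> A \<Longrightarrow> 0 \<le> g x"
    and X: "0 < X" "(\<integral>\<^sup>+x. ennreal (f x powr r) \<partial>count_space A) \<le> ennreal X"
    and Y: "0 < Y" "(\<integral>\<^sup>+x. ennreal (g x powr s) \<partial>count_space A) \<le> ennreal Y"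
  shows "(\<integral>\<^sup>+x. ennreal (f x * g x) \<partial>count_space A) \<le> ennreal (X powr (1 / r) * Y powr (1 / s))"
proof -
  define Z where "Z = X powr (1 / r) * Y powr (1 / s)"
  have Z: "0 < Z" using X Y by (simp add: Z_def)
  have "ennreal (f x * g x) \<le> ennreal (Z / (r * X)) * ennreal (f x powr r)
      + ennreal (Z / (s * Y)) * ennreal (g x powr s)" if x: "x \<in> A" for x
  proof -
    have "f x / X powr (1 / r) * (g x / Y powr (1 / s))
        \<le> (f x / X powr (1 / r)) powr r / r + (g x / Y powr (1 / s)) powr s / s"
      using r pos[OF x] by (intro Youngs_inequality) auto
    also have "\<dots> = f x powr r / (r * X) + g x powr s / (s * Y)"
      using X Y r pos[OF x] by (simp add: powr_divide powr_powr mult.commute)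
    finally have "f x * g x \<le> Z * (f x powr r / (r * X) + g x powr s / (s * Y))"
      using X Y by (simp add: Z_def field_simps)
    also have "\<dots> = Z / (r * X) * f x powr r + Z / (s * Y) * g x powr s"
      by (simp add: distrib_left)
    finally show ?thesis
      using Z X Y r by (simp add: ennreal_mult[symmetric] ennreal_plus[symmetric] del: ennreal_plus)
  qed
  then have "(\<integral>\<^sup>+x. ennreal (f x * g x) \<partial>count_space A)
     \<le> (\<integral>\<^sup>+x. ennreal (Z / (r * X)) * ennreal (f x powr r)
        + ennreal (Z / (s * Y)) * ennreal (g x powr s) \<partial>count_space A)"
    by (intro nn_integral_mono) simp
  also have "\<dots> \<le> ennreal (Z / (r * X)) * ennreal X + ennreal (Z / (s * Y)) * ennreal Y"
    by (simp add: nn_integral_add nn_integral_cmult) (intro add_mono mult_left_mono X Y; simp)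
  also have "\<dots> = ennreal (Z / (r * X) * X + Z / (s * Y) * Y)"
    using Z X Y r by (simp add: ennreal_mult[symmetric] ennreal_plus[symmetric] del: ennreal_plus)
  also have "Z / (r * X) * X + Z / (s * Y) * Y = Z * (1 / r + 1 / s)"
    using X Y by (simp add: distrib_left)
  finally show ?thesis using r by (simp add: Z_def)
qed

lemma sum_exp_int_le:
  fixes l :: "'a \<Rightarrow> int"
  assumes F: "finite F" and inj: "inj_on l F" and l: "\<And>Q. Q \<in> F \<Longrightarrow> l0 \<le> l Q" and "0 < \<mu>"
  shows "(\<Sum>Q\<in>F. exp (- \<mu> * real_of_int (l Q - l0))) \<le> 1 / (1 - exp (- \<mu>))"
proof -
  let ?g = "\<lambda>Q. nat (l Q - l0)"
  have inj': "inj_on ?g F"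
    using inj l by (auto simp: inj_on_def eq_nat_nat_iff)
  have "(\<Sum>Q\<in>F. exp (- \<mu> * real_of_int (l Q - l0))) = (\<Sum>Q\<in>F. exp (- \<mu>) ^ ?g Q)"
    using l by (intro sum.cong) (auto simp: exp_of_nat_mult[symmetric] mult.commute)
  also have "\<dots> = (\<Sum>j\<in>?g ` F. exp (- \<mu>) ^ j)"
    using inj' by (simp add: sum.reindex)
  also have "\<dots> \<le> (\<Sum>j. exp (- \<mu>) ^ j)"
    using F \<open>0 < \<mu>\<close> by (intro sum_le_suminf summable_geometric) auto
  also have "\<dots> = 1 / (1 - exp (- \<mu>))"
    using \<open>0 < \<mu>\<close> by (intro suminf_geometric) auto
  finally show ?thesis .
qed

text \<open>Among the indices with \<open>y \<le> t Q\<close>, the one of lowest level already has a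
  value of at least y, and growth with the level makes the series geometric from there on. Hence the
  bound involves y alone and not the number of indices. The factor c admits growth that is geometric
  only up to a constant.\<close>

lemma geometric_level_sum_above:
  fixes l :: "'a \<Rightarrow> int" and t :: "'a \<Rightarrow> real"
  assumes T: "countable T" and inj: "inj_on l T" and pos: "\<And>Q. Q \<in> T \<Longrightarrow> 0 < t Q"
    and c: "0 < c" "0 < \<kappa>" "0 < r" "0 < y"
    and growth: "\<And>Q P. Q \<in> T \<Longrightarrow> P \<in> T \<Longrightarrow> l Q \<le> l P
        \<Longrightarrow> c * exp (\<kappa> * real_of_int (l P - l Q)) * t Q \<le> t P"
  shows "(\<integral>\<^sup>+Q. ennreal (if y \<le> t Q then t Q powr - r else 0) \<partial>count_space T)
      \<le> ennreal (c powr - r / (1 - exp (- r * \<kappa>)) * y powr - r)"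
proof (rule nn_integral_count_space_le[OF T])
  fix F assume F: "finite F" "F \<subseteq> T"
  define F' where "F' = {Q\<in>F. y \<le> t Q}"
  have F': "finite F'" "F' \<subseteq> T" using F by (auto simp: F'_def)
  have "(\<Sum>Q\<in>F. ennreal (if y \<le> t Q then t Q powr - r else 0)) = ennreal (\<Sum>Q\<in>F'. t Q powr - r)"
    using F by (simp add: sum_ennreal F'_def sum.inter_filter)
  also have "(\<Sum>Q\<in>F'. t Q powr - r) \<le> c powr - r / (1 - exp (- r * \<kappa>)) * y powr - r"
  proof (cases "F' = {}")
    case True
    then show ?thesis using c by (simp add: mult_nonneg_nonneg)
  next
    case False
    have "Min (l ` F') \<in> l ` F'"
      using False F' by (intro Min_in) auto
    then obtain Q0 where "Q0 \<in> F'" "Min (l ` F') = l Q0" by blast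
    then have Q0: "Q0 \<in> F'" "\<And>Q. Q \<in> F' \<Longrightarrow> l Q0 \<le> l Q"
      using F' by (auto simp del: Min_le) (metis Min_le finite_imageI imageI)
    have "t Q powr - r \<le> c powr - r * y powr - r * exp (- (r * \<kappa>) * real_of_int (l Q - l Q0))"
      if Q: "Q \<in> F'" for Q
    proof -
      have "c * exp (\<kappa> * real_of_int (l Q - l Q0)) * y \<le> c * exp (\<kappa> * real_of_int (l Q - l Q0)) * t Q0"
        using Q0(1) c by (simp add: F'_def)
      also have "\<dots> \<le> t Q" using growth Q0 Q F' by blast
      finally have "t Q powr - r \<le> (c * exp (\<kappa> * real_of_int (l Q - l Q0)) * y) powr - r"
        using c by (intro powr_mono2') auto
      also have "\<dots> = c powr - r * y powr - r * exp (- (r * \<kappa>) * real_of_int (l Q - l Q0))"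
        using c by (simp add: powr_mult) (simp add: powr_def algebra_simps)
      finally show ?thesis .
    qed
    then have "(\<Sum>Q\<in>F'. t Q powr - r)
        \<le> (\<Sum>Q\<in>F'. c powr - r * y powr - r * exp (- (r * \<kappa>) * real_of_int (l Q - l Q0)))"
      by (rule sum_mono)
    also have "\<dots> = c powr - r * y powr - r * (\<Sum>Q\<in>F'. exp (- (r * \<kappa>) * real_of_int (l Q - l Q0)))"
      by (simp add: sum_distrib_left)
    also have "\<dots> \<le> c powr - r * y powr - r * (1 / (1 - exp (- (r * \<kappa>))))"
      using F' Q0 c inj by (intro mult_left_mono sum_exp_int_le) (auto intro: inj_on_subset)
    finally show ?thesis by simp
  qed
  finally show "(\<Sum>Q\<in>F. ennreal (if y \<le> t Q then t Q powr - r else 0))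
      \<le> ennreal (c powr - r / (1 - exp (- r * \<kappa>)) * y powr - r)"
    by (simp add: ennreal_leI)
qed

text \<open>The previous bound for \<open>1 / t\<close> with the levels negated.\<close>

lemma geometric_level_sum_below:
  fixes l :: "'a \<Rightarrow> int" and t :: "'a \<Rightarrow> real"
  assumes T: "countable T" and inj: "inj_on l T" and pos: "\<And>Q. Q \<in> T \<Longrightarrow> 0 < t Q"
    and c: "0 < c" "0 < \<kappa>" "0 < r" "0 < y"
    and growth: "\<And>Q P. Q \<in> T \<Longrightarrow> P \<in> T \<Longrightarrow> l Q \<le> l P
        \<Longrightarrow> c * exp (\<kappa> * real_of_int (l P - l Q)) * t Q \<le> t P"
  shows "(\<integral>\<^sup>+Q. ennreal (if t Q \<le> y then t Q powr r else 0) \<partial>count_space T)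
      \<le> ennreal (c powr - r / (1 - exp (- r * \<kappa>)) * y powr r)"
proof -
  have "(\<integral>\<^sup>+Q. ennreal (if t Q \<le> y then t Q powr r else 0) \<partial>count_space T)
      = (\<integral>\<^sup>+Q. ennreal (if 1 / y \<le> 1 / t Q then (1 / t Q) powr - r else 0) \<partial>count_space T)"
    using pos c by (intro nn_integral_cong)
      (auto simp: powr_minus powr_divide divide_simps less_imp_le dest!: pos)
  also have "\<dots> \<le> ennreal (c powr - r / (1 - exp (- r * \<kappa>)) * (1 / y) powr - r)"
  proof (rule geometric_level_sum_above[where l="\<lambda>Q. - l Q"])
    fix Q P assume QP: "Q \<in> T" "P \<in> T" "- l Q \<le> - l P"
    then have "c * exp (\<kappa> * real_of_int (l Q - l P)) * t P \<le> t Q"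
      using growth by simp
    then show "c * exp (\<kappa> * real_of_int (- l P - - l Q)) * (1 / t Q) \<le> 1 / t P"
      using pos[OF QP(1)] pos[OF QP(2)] by (simp add: field_simps)
  qed (use assms in \<open>auto simp: inj_on_def\<close>)
  also have "(1 / y) powr - r = y powr r"
    using c by (simp add: powr_minus powr_divide)
  finally show ?thesis .
qed

lemma card_level_le:
  fixes l :: "'a \<Rightarrow> int"
  assumes "countable T" and inj: "inj_on l T" and N: "0 \<le> N"
    and diff: "\<And>Q P. Q \<in> T \<Longrightarrow> P \<in> T \<Longrightarrow> l Q \<le> l P \<Longrightarrow> real_of_int (l P - l Q) \<le> N"
  shows "(\<integral>\<^sup>+Q. 1 \<partial>count_space T) \<le> ennreal (N + 1)"
proof (rule nn_integral_count_space_le)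
  fix F assume F: "finite F" "F \<subseteq> T"
  show "(\<Sum>Q\<in>F. 1) \<le> ennreal (N + 1)"
  proof (cases "F = {}")
    case False
    have "Min (l ` F) \<in> l ` F"
      using False F by (intro Min_in) auto
    then obtain Q0 where "Q0 \<in> F" "Min (l ` F) = l Q0" by blast
    then have Q0: "Q0 \<in> F" "\<And>Q. Q \<in> F \<Longrightarrow> l Q0 \<le> l Q"
      using F by (auto simp del: Min_le) (metis Min_le finite_imageI imageI)
    have "l ` F \<subseteq> {l Q0..l Q0 + \<lfloor>N\<rfloor>}"
      proof
      fix k assume "k \<in> l ` F"
      then obtain Q where Q: "Q \<in> F" "k = l Q" by blast
      then have "real_of_int (l Q - l Q0) \<le> N" using Q0 diff F by blast
      then show "k \<in> {l Q0..l Q0 + \<lfloor>N\<rfloor>}" using Q Q0(2)[OF Q(1)] by simp linarith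
    qed
    from card_mono[OF _ this] have "card F \<le> nat (\<lfloor>N\<rfloor> + 1)"
      using inj F by (simp add: card_image inj_on_subset)
    then have "real (card F) \<le> N + 1" using N by linarith
    then show ?thesis by (simp flip: ennreal_of_nat_eq_real_of_nat add: ennreal_leI)
  qed simp
qed (rule assms)

section \<open>Nested grids and record cubes\<close>

lemma nn_integral_count_space_swap:
  fixes g :: "'a set \<Rightarrow> 'a \<Rightarrow> ennreal"
  assumes "countable D" and sets: "\<And>Q. Q \<in> D \<Longrightarrow> Q \<in> sets M"
    and meas: "\<And>Q. Q \<in> D \<Longrightarrow> g Q \<in> borel_measurable M"
  shows "(\<integral>\<^sup>+Q. (\<integral>\<^sup>+x\<in>Q. g Q x \<partial>M) \<partial>count_space D)
       = (\<integral>\<^sup>+x. (\<integral>\<^sup>+Q. g Q x \<partial>count_space {Q\<in>D. x \<in> Q}) \<partial>M)"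
proof -
  have "(\<integral>\<^sup>+Q. (\<integral>\<^sup>+x\<in>Q. g Q x \<partial>M) \<partial>count_space D)
      = (\<integral>\<^sup>+x. (\<integral>\<^sup>+Q. g Q x * indicator Q x \<partial>count_space D) \<partial>M)"
    using assms by (intro nn_integral_count_space_nn_integral[symmetric]) auto
  also have "\<dots> = (\<integral>\<^sup>+x. (\<integral>\<^sup>+Q. g Q x \<partial>count_space {Q\<in>D. x \<in> Q}) \<partial>M)"
  proof (rule nn_integral_cong)
    fix x
    have "(\<integral>\<^sup>+Q. g Q x * indicator Q x \<partial>count_space D)
        = (\<integral>\<^sup>+Q. g Q x * indicator Q x \<partial>count_space {Q\<in>D. x \<in> Q})"
      by (intro nn_integral_count_space_eq) auto
    also have "\<dots> = (\<integral>\<^sup>+Q. g Q x \<partial>count_space {Q\<in>D. x \<in> Q})"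
      by (intro nn_integral_cong) auto
    finally show "(\<integral>\<^sup>+Q. g Q x * indicator Q x \<partial>count_space D)
        = (\<integral>\<^sup>+Q. g Q x \<partial>count_space {Q\<in>D. x \<in> Q})" .
  qed
  finally show ?thesis .
qed

text \<open>An infinite integral is sent to 0 by \<open>enn2real\<close>, so the value is meaningful
  only next to a finiteness fact, as in \<open>ennreal_mass\<close>.\<close>

definition mass :: "'a measure \<Rightarrow> ('a \<Rightarrow> real) \<Rightarrow> 'a set \<Rightarrow> real" where
  "mass M g Q = enn2real (\<integral>\<^sup>+x\<in>Q. ennreal (g x) \<partial>M)"

lemma mass_nonneg [simp]: "0 \<le> mass M g Q"
  by (simp add: mass_def)

lemma ennreal_mass: "(\<integral>\<^sup>+x\<in>Q. ennreal (g x) \<partial>M) < \<infinity> \<Longrightarrow> ennreal (mass M g Q) = (\<integral>\<^sup>+x\<in>Q. ennreal (g x) \<partial>M)"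
  by (simp add: mass_def)

section \<open>Abstract nested grids with geometric sizes\<close>

locale nested_grid =
  fixes M :: "'a measure" and D :: "'a set set" and gen :: "'a set \<Rightarrow> int" and b c :: real
  assumes countable_D: "countable D"
    and sets_D: "Q \<in> D \<Longrightarrow> Q \<in> sets M"
    and emeasure_D: "Q \<in> D \<Longrightarrow> emeasure M Q = ennreal (c * b powr real_of_int (gen Q))"
    and c_pos: "0 < c" and b_gt_1: "1 < b"
    and nested: "Q \<in> D \<Longrightarrow> P \<in> D \<Longrightarrow> Q \<inter> P \<noteq> {} \<Longrightarrow> gen Q \<le> gen P \<Longrightarrow> Q \<subseteq> P"
begin

lemma measure_D: "Q \<in> D \<Longrightarrow> measure M Q = c * b powr real_of_int (gen Q)"
  using c_pos by (simp add: measure_def emeasure_D)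

lemma measure_D_pos: "Q \<in> D \<Longrightarrow> 0 < measure M Q"
  using c_pos b_gt_1 by (simp add: measure_D)

lemma emeasure_D_eq: "Q \<in> D \<Longrightarrow> emeasure M Q = ennreal (measure M Q)"
  by (simp add: measure_D emeasure_D)

lemma nonempty_D: "Q \<in> D \<Longrightarrow> Q \<noteq> {}"
  using measure_D_pos[of Q] by auto

lemma measure_le_iff: "Q \<in> D \<Longrightarrow> P \<in> D \<Longrightarrow> measure M Q \<le> measure M P \<longleftrightarrow> gen Q \<le> gen P"
  using c_pos b_gt_1 by (simp add: measure_D)

lemma measure_mono_D: "Q \<in> D \<Longrightarrow> P \<in> D \<Longrightarrow> Q \<subseteq> P \<Longrightarrow> measure M Q \<le> measure M P"
  using emeasure_mono[of Q P M] sets_D[of P] measure_D_pos[of P] by (simp add: emeasure_D_eq)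

lemma gen_mono: "Q \<in> D \<Longrightarrow> P \<in> D \<Longrightarrow> Q \<subseteq> P \<Longrightarrow> gen Q \<le> gen P"
  using measure_mono_D measure_le_iff by blast

lemma gen_strict_mono: "Q \<in> D \<Longrightarrow> P \<in> D \<Longrightarrow> Q \<subset> P \<Longrightarrow> gen Q < gen P"
  using gen_mono[of Q P] nested[of P Q] nonempty_D[of Q] by fastforce

lemma nested_cases:
  assumes "Q \<in> D" "P \<in> D" "x \<in> Q" "x \<in> P"
  obtains "Q \<subset> P" "gen Q < gen P" | "Q = P" | "P \<subset> Q" "gen P < gen Q"
  using nested[of Q P] nested[of P Q] gen_strict_mono[of Q P] gen_strict_mono[of P Q] assms
  by (metis disjoint_iff linorder_le_cases psubsetI)

lemma inj_on_gen: "inj_on gen {Q\<in>D. x \<in> Q}"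
proof (rule inj_onI)
  fix Q P assume "Q \<in> {Q\<in>D. x \<in> Q}" "P \<in> {Q\<in>D. x \<in> Q}" "gen Q = gen P"
  then show "Q = P" by (auto intro: nested_cases[of Q P x])
qed

text \<open>The cubes through x inside P have distinct generations, so this is dominated by a
  geometric series of ratio \<open>b powr - \<eta>\<close> that starts at P.\<close>

lemma descendant_sum:
  assumes P: "P \<in> D" and \<eta>: "0 < \<eta>"
  shows "(\<integral>\<^sup>+Q. ennreal (measure M Q powr \<eta>) \<partial>count_space {Q\<in>{Q\<in>D. Q \<subseteq> P}. x \<in> Q})
      \<le> ennreal (1 / (1 - exp (- \<eta> * ln b)) * measure M P powr \<eta>)"
proof -
  let ?T = "{Q\<in>{Q\<in>D. Q \<subseteq> P}. x \<in> Q}"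
  have "(\<integral>\<^sup>+Q. ennreal (measure M Q powr \<eta>) \<partial>count_space ?T)
     = (\<integral>\<^sup>+Q. ennreal (if measure M Q \<le> measure M P then measure M Q powr \<eta> else 0) \<partial>count_space ?T)"
    using P by (intro nn_integral_cong) (auto simp: measure_mono_D)
  also have "\<dots> \<le> ennreal (1 powr - \<eta> / (1 - exp (- \<eta> * ln b)) * measure M P powr \<eta>)"
  proof (rule geometric_level_sum_below[where l=gen])
    show "countable ?T" using countable_D by (auto intro: countable_subset)
    show "inj_on gen ?T" using inj_on_gen[of x] by (rule inj_on_subset) auto
    fix Q R assume "Q \<in> ?T" "R \<in> ?T"
    then show "1 * exp (ln b * real_of_int (gen R - gen Q)) * measure M Q \<le> measure M R"
      using b_gt_1 by (simp add: measure_D powr_def mult_exp_exp algebra_simps)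
  qed (use measure_D_pos P b_gt_1 \<eta> in auto)
  finally show ?thesis by simp
qed

end

section \<open>Record cubes of a fractional average\<close>

locale mass_grid = nested_grid +
  fixes v :: "'a \<Rightarrow> real" and V \<beta> :: real
  assumes v_meas [measurable]: "v \<in> borel_measurable M"
    and v_nonneg: "0 \<le> v x"
    and v_total: "(\<integral>\<^sup>+x. ennreal (v x) \<partial>M) = ennreal V" and V_pos: "0 < V"
    and \<beta>: "0 \<le> \<beta>" "\<beta> < 1"
begin

lemma nn_integral_v_le: "(\<integral>\<^sup>+x\<in>Q. ennreal (v x) \<partial>M) \<le> ennreal V"
  unfolding v_total[symmetric] by (intro nn_integral_mono) (auto split: split_indicator)

lemma ennreal_mass_v: "ennreal (mass M v Q) = (\<integral>\<^sup>+x\<in>Q. ennreal (v x) \<partial>M)"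
  using nn_integral_v_le[of Q] by (intro ennreal_mass) (auto intro: le_less_trans)

lemma mass_v_le: "mass M v Q \<le> V"
  using nn_integral_v_le[of Q] V_pos by (simp flip: ennreal_mass_v)

lemma mass_v_mono: "Q \<subseteq> P \<Longrightarrow> mass M v Q \<le> mass M v P"
proof -
  assume "Q \<subseteq> P"
  then have "ennreal (mass M v Q) \<le> ennreal (mass M v P)"
    unfolding ennreal_mass_v by (intro nn_integral_mono) (auto split: split_indicator)
  then show ?thesis by simp
qed

text \<open>The logarithm of \<open>measure M Q powr \<beta>\<close> times the average of v over Q.
  Rounding to integers costs a factor \<open>exp 1\<close> and lets the levels along a chain of
  records index a geometric series; for this \<open>records\<close> demands a strict drop at every
  ancestor.\<close>

definition lev :: "'a set \<Rightarrow> int" where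
  "lev Q = \<lfloor>ln (measure M Q powr (\<beta> - 1) * mass M v Q)\<rfloor>"

definition records :: "'a set set" where
  "records = {Q\<in>D. 0 < mass M v Q \<and> (\<forall>P\<in>D. Q \<subset> P \<longrightarrow> lev P < lev Q)}"

lemma lev_bounds:
  assumes "Q \<in> D" "0 < mass M v Q"
  shows "exp (real_of_int (lev Q)) \<le> measure M Q powr (\<beta> - 1) * mass M v Q"
    and "measure M Q powr (\<beta> - 1) * mass M v Q < exp (real_of_int (lev Q) + 1)"
proof -
  let ?y = "measure M Q powr (\<beta> - 1) * mass M v Q"
  have y: "0 < ?y" using assms measure_D_pos[of Q] by simp
  have "real_of_int (lev Q) \<le> ln ?y" "ln ?y < real_of_int (lev Q) + 1"
    by (simp_all add: lev_def)
  then show "exp (real_of_int (lev Q)) \<le> ?y" "?y < exp (real_of_int (lev Q) + 1)"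
    using y by (metis exp_le_cancel_iff exp_ln, metis exp_less_cancel_iff exp_ln)
qed

lemma records_D: "Q \<in> records \<Longrightarrow> Q \<in> D" and records_pos: "Q \<in> records \<Longrightarrow> 0 < mass M v Q"
  by (auto simp: records_def)

lemma countable_records: "countable records"
  using countable_D by (rule countable_subset[rotated]) (auto simp: records_def)

text \<open>
  Since \<open>\<beta> < 1\<close> and \<open>v\<close> has finite mass, levels tend to \<open>-\<infinity>\<close> along growing cubes,
  so there is a largest ancestor whose level is at least that of \<open>Q\<close>.
\<close>
lemma record_above:
  assumes Q: "Q \<in> D" "0 < mass M v Q"
  obtains P where "P \<in> records" "Q \<subseteq> P" "lev Q \<le> lev P"
proof -
  define A where "A = {P\<in>D. Q \<subseteq> P \<and> lev Q \<le> lev P}"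
  \<comment> \<open>The bound for the measure of P that results from
    \<open>exp (lev Q) \<le> measure M P powr (\<beta> - 1) * V\<close>.\<close>
  define X where "X = (V / exp (real_of_int (lev Q))) powr (1 / (1 - \<beta>))"
  have bound: "real_of_int (gen P) \<le> log b (X / c)" if "P \<in> A" for P
  proof -
    have P: "P \<in> D" "Q \<subseteq> P" "lev Q \<le> lev P" using that by (auto simp: A_def)
    have mP: "0 < mass M v P" "0 < measure M P"
      using mass_v_mono[OF P(2)] Q measure_D_pos P by auto
    have "exp (real_of_int (lev Q)) \<le> exp (real_of_int (lev P))" using P by simp
    also have "\<dots> \<le> measure M P powr (\<beta> - 1) * mass M v P"
      using lev_bounds P mP by blast
    also have "\<dots> \<le> measure M P powr (\<beta> - 1) * V"
      by (intro mult_left_mono mass_v_le) auto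
    finally have "measure M P powr (1 - \<beta>) \<le> V / exp (real_of_int (lev Q))"
      using mP by (simp add: powr_diff powr_minus field_simps)
    then have "(measure M P powr (1 - \<beta>)) powr (1 / (1 - \<beta>)) \<le> X"
      unfolding X_def using \<beta> by (intro powr_mono2) auto
    then have "b powr real_of_int (gen P) \<le> X / c"
      using \<beta> mP c_pos by (simp add: powr_powr measure_D P field_simps)
    moreover from this have "0 < X / c"
      using b_gt_1 by (intro less_le_trans[OF powr_gt_zero[THEN iffD2]]) auto
    ultimately show ?thesis
      using b_gt_1 by (simp add: le_log_iff)
  qed
  have QA: "Q \<in> A" using Q by (auto simp: A_def)
  have "gen ` A \<subseteq> {gen Q..\<lfloor>log b (X / c)\<rfloor>}"
  proof
    fix k assume "k \<in> gen ` A"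
    then obtain P where P: "P \<in> A" "k = gen P" by blast
    then show "k \<in> {gen Q..\<lfloor>log b (X / c)\<rfloor>}"
      using bound[OF P(1)] gen_mono[of Q P] Q by (auto simp: A_def le_floor_iff)
  qed
  then have fin: "finite (gen ` A)" by (rule finite_subset) simp
  then have "Max (gen ` A) \<in> gen ` A" using QA by (intro Max_in) auto
  then obtain P where P: "P \<in> A" "Max (gen ` A) = gen P" by blast
  have max: "gen R \<le> gen P" if "R \<in> A" for R
    using Max_ge[OF fin] P that by auto
  have PD: "P \<in> D" "Q \<subseteq> P" "lev Q \<le> lev P" using P by (auto simp: A_def)
  have "lev R < lev P" if "R \<in> D" "P \<subset> R" for R
  proof -
    have "R \<notin> A" using max[of R] gen_strict_mono[of P R] that PD by force
    then show ?thesis using that PD by (auto simp: A_def)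
  qed
  then have "P \<in> records"
    using PD mass_v_mono[OF PD(2)] Q by (auto simp: records_def)
  then show ?thesis using that PD by blast
qed

text \<open>Charge Q to a record P above it whose level is at least as high. This costs
  \<open>exp 1\<close> on \<open>measure M Q powr (\<beta> - 1) * mass M v Q\<close>; what remains,
  \<open>measure M Q powr \<eta>\<close> times the integral over Q, sums over all Q inside P to a
  multiple of \<open>measure M P powr \<eta>\<close> times the integral over P.\<close>

lemma sum_le_records:
  fixes g :: "'a \<Rightarrow> ennreal"
  assumes \<eta>: "0 < \<eta>" and [measurable]: "g \<in> borel_measurable M"
  shows "(\<integral>\<^sup>+Q. ennreal (measure M Q powr (\<beta> + \<eta> - 1) * mass M v Q) * (\<integral>\<^sup>+x\<in>Q. g x \<partial>M) \<partial>count_space D)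
     \<le> ennreal (exp 1 / (1 - exp (- \<eta> * ln b))) *
       (\<integral>\<^sup>+Q. ennreal (measure M Q powr (\<beta> + \<eta> - 1) * mass M v Q) * (\<integral>\<^sup>+x\<in>Q. g x \<partial>M) \<partial>count_space records)"
proof -
  define G where "G Q = (\<integral>\<^sup>+x\<in>Q. g x \<partial>M)" for Q
  define R where "R Q = ennreal (measure M Q powr (\<beta> + \<eta> - 1) * mass M v Q)" for Q
  define E where "E P = ennreal (exp 1 * (measure M P powr (\<beta> - 1) * mass M v P))" for P
  \<comment> \<open>Instead of choosing P, the right-hand side sums over all records that contain Q;
    the one found by \<open>record_above\<close> is a single term of it.\<close>
  have up: "R Q * G Q \<le> (\<integral>\<^sup>+P. E P * (ennreal (measure M Q powr \<eta>) * G Q * of_bool (Q \<subseteq> P)) \<partial>count_space records)"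
    if Q: "Q \<in> D" for Q
  proof (cases "0 < mass M v Q")
    case True
    obtain P where P: "P \<in> records" "Q \<subseteq> P" "lev Q \<le> lev P" using record_above Q True by blast
    have "measure M Q powr (\<beta> - 1) * mass M v Q \<le> exp (real_of_int (lev Q) + 1)"
      using lev_bounds[OF Q True] by simp
    also have "\<dots> \<le> exp 1 * exp (real_of_int (lev P))" using P by (simp add: mult_exp_exp)
    also have "\<dots> \<le> exp 1 * (measure M P powr (\<beta> - 1) * mass M v P)"
      using lev_bounds records_D records_pos P by simp
    finally have "measure M Q powr (\<beta> - 1) * mass M v Q * measure M Q powr \<eta>
        \<le> exp 1 * (measure M P powr (\<beta> - 1) * mass M v P) * measure M Q powr \<eta>"
      by (rule mult_right_mono) simp
    moreover have "measure M Q powr (\<beta> - 1) * mass M v Q * measure M Q powr \<eta>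
      = measure M Q powr (\<beta> + \<eta> - 1) * mass M v Q"
      by (simp add: powr_add[symmetric] mult.commute mult.left_commute algebra_simps)
    ultimately have "R Q \<le> E P * ennreal (measure M Q powr \<eta>)"
      unfolding R_def E_def by (simp add: ennreal_mult[symmetric] ennreal_leI)
    then have "R Q * G Q \<le> E P * ennreal (measure M Q powr \<eta>) * G Q"
      by (rule mult_right_mono) simp
    also have "\<dots> = E P * (ennreal (measure M Q powr \<eta>) * G Q * of_bool (Q \<subseteq> P))"
      using P by (simp add: mult.assoc)
    also have "\<dots> \<le> (\<integral>\<^sup>+P. E P * (ennreal (measure M Q powr \<eta>) * G Q * of_bool (Q \<subseteq> P)) \<partial>count_space records)"
      using P(1) by (rule nn_integral_ge_point)
    finally show ?thesis .
  next
    case False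
    then have "mass M v Q = 0" using mass_nonneg[of M v Q] by linarith
    then show ?thesis by (simp add: R_def)
  qed
  have inner: "(\<integral>\<^sup>+Q. ennreal (measure M Q powr \<eta>) * G Q * of_bool (Q \<subseteq> P) \<partial>count_space D)
      \<le> ennreal (1 / (1 - exp (- \<eta> * ln b)) * measure M P powr \<eta>) * G P" if P: "P \<in> D" for P
  proof -
    let ?D = "{Q\<in>D. Q \<subseteq> P}"
    have "(\<integral>\<^sup>+Q. ennreal (measure M Q powr \<eta>) * G Q * of_bool (Q \<subseteq> P) \<partial>count_space D)
       = (\<integral>\<^sup>+Q. ennreal (measure M Q powr \<eta>) * G Q * of_bool (Q \<subseteq> P) \<partial>count_space ?D)"
      by (intro nn_integral_count_space_eq) auto
    also have "\<dots> = (\<integral>\<^sup>+Q. (\<integral>\<^sup>+x\<in>Q. ennreal (measure M Q powr \<eta>) * (g x * indicator P x) \<partial>M) \<partial>count_space ?D)"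
    proof (intro nn_integral_cong)
      fix Q assume "Q \<in> space (count_space ?D)"
      then have Q: "Q \<in> D" "Q \<subseteq> P" by auto
      then have [measurable]: "Q \<in> sets M" using sets_D by auto
      have "ennreal (measure M Q powr \<eta>) * G Q
         = (\<integral>\<^sup>+x. ennreal (measure M Q powr \<eta>) * (g x * indicator Q x) \<partial>M)"
        unfolding G_def by (rule nn_integral_cmult[symmetric]) measurable
      also have "\<dots> = (\<integral>\<^sup>+x\<in>Q. ennreal (measure M Q powr \<eta>) * (g x * indicator P x) \<partial>M)"
        using Q by (intro nn_integral_cong) (auto split: split_indicator)
      finally show "ennreal (measure M Q powr \<eta>) * G Q * of_bool (Q \<subseteq> P)
         = (\<integral>\<^sup>+x\<in>Q. ennreal (measure M Q powr \<eta>) * (g x * indicator P x) \<partial>M)"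
        using Q by simp
    qed
    also have "\<dots> = (\<integral>\<^sup>+x. (\<integral>\<^sup>+Q. ennreal (measure M Q powr \<eta>) * (g x * indicator P x)
        \<partial>count_space {Q\<in>?D. x \<in> Q}) \<partial>M)"
      using countable_D sets_D P
      by (intro nn_integral_count_space_swap) (auto intro: countable_subset)
    also have "\<dots> \<le> (\<integral>\<^sup>+x. ennreal (1 / (1 - exp (- \<eta> * ln b)) * measure M P powr \<eta>) * (g x * indicator P x) \<partial>M)"
    proof (intro nn_integral_mono)
      fix x
      have "(\<integral>\<^sup>+Q. ennreal (measure M Q powr \<eta>) * (g x * indicator P x) \<partial>count_space {Q\<in>?D. x \<in> Q})
        = (\<integral>\<^sup>+Q. ennreal (measure M Q powr \<eta>) \<partial>count_space {Q\<in>?D. x \<in> Q}) * (g x * indicator P x)"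
        by (rule nn_integral_multc) simp
      also have "\<dots> \<le> ennreal (1 / (1 - exp (- \<eta> * ln b)) * measure M P powr \<eta>) * (g x * indicator P x)"
        by (intro mult_right_mono descendant_sum P \<eta>) auto
      finally show "(\<integral>\<^sup>+Q. ennreal (measure M Q powr \<eta>) * (g x * indicator P x) \<partial>count_space {Q\<in>?D. x \<in> Q})
        \<le> ennreal (1 / (1 - exp (- \<eta> * ln b)) * measure M P powr \<eta>) * (g x * indicator P x)" .
    qed
    also have "\<dots> = ennreal (1 / (1 - exp (- \<eta> * ln b)) * measure M P powr \<eta>) * G P"
      unfolding G_def using sets_D[OF P] by (intro nn_integral_cmult) simp
    finally show ?thesis .
  qed
  have "(\<integral>\<^sup>+Q. R Q * G Q \<partial>count_space D)
     \<le> (\<integral>\<^sup>+Q. (\<integral>\<^sup>+P. E P * (ennreal (measure M Q powr \<eta>) * G Q * of_bool (Q \<subseteq> P)) \<partial>count_space records) \<partial>count_space D)"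
    by (intro nn_integral_mono up) simp
  also have "\<dots> = (\<integral>\<^sup>+P. (\<integral>\<^sup>+Q. E P * (ennreal (measure M Q powr \<eta>) * G Q * of_bool (Q \<subseteq> P)) \<partial>count_space D) \<partial>count_space records)"
    by (intro nn_integral_count_space_nn_integral countable_records) simp
  also have "\<dots> = (\<integral>\<^sup>+P. E P * (\<integral>\<^sup>+Q. ennreal (measure M Q powr \<eta>) * G Q * of_bool (Q \<subseteq> P) \<partial>count_space D) \<partial>count_space records)"
    by (intro nn_integral_cong nn_integral_cmult) simp
  also have "\<dots> \<le> (\<integral>\<^sup>+P. E P * (ennreal (1 / (1 - exp (- \<eta> * ln b)) * measure M P powr \<eta>) * G P) \<partial>count_space records)"
    by (intro nn_integral_mono mult_left_mono inner) (auto simp: records_D)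
  also have "\<dots> = (\<integral>\<^sup>+P. ennreal (exp 1 / (1 - exp (- \<eta> * ln b))) * (R P * G P) \<partial>count_space records)"
  proof (intro nn_integral_cong)
    fix P assume "P \<in> space (count_space records)"
    have pos: "0 \<le> 1 / (1 - exp (- \<eta> * ln b))" using \<eta> b_gt_1 by simp
    have "E P * ennreal (1 / (1 - exp (- \<eta> * ln b)) * measure M P powr \<eta>)
        = ennreal (exp 1 * (measure M P powr (\<beta> - 1) * mass M v P) * (1 / (1 - exp (- \<eta> * ln b)) * measure M P powr \<eta>))"
      unfolding E_def using pos by (intro ennreal_mult[symmetric]) auto
    also have "exp 1 * (measure M P powr (\<beta> - 1) * mass M v P) * (1 / (1 - exp (- \<eta> * ln b)) * measure M P powr \<eta>)
       = exp 1 / (1 - exp (- \<eta> * ln b)) * (measure M P powr (\<beta> + \<eta> - 1) * mass M v P)"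
    proof -
      have "measure M P powr (\<beta> + \<eta> - 1) = measure M P powr (\<beta> - 1) * measure M P powr \<eta>"
        by (simp add: powr_add[symmetric] algebra_simps)
      then show ?thesis by simp
    qed
    also have "ennreal \<dots> = ennreal (exp 1 / (1 - exp (- \<eta> * ln b))) * R P"
      unfolding R_def using pos \<eta> b_gt_1 by (intro ennreal_mult) auto
    finally show "E P * (ennreal (1 / (1 - exp (- \<eta> * ln b)) * measure M P powr \<eta>) * G P)
        = ennreal (exp 1 / (1 - exp (- \<eta> * ln b))) * (R P * G P)"
      by (simp add: mult.assoc[symmetric])
  qed
  also have "\<dots> = ennreal (exp 1 / (1 - exp (- \<eta> * ln b))) * (\<integral>\<^sup>+P. R P * G P \<partial>count_space records)"
    by (intro nn_integral_cmult) simp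
  finally show ?thesis by (simp add: R_def G_def)
qed

lemma records_chain:
  assumes "Q \<in> records" "P \<in> records" "x \<in> Q" "x \<in> P" "lev Q \<le> lev P"
  shows "P \<subseteq> Q"
  using records_D[OF assms(1)] records_D[OF assms(2)] assms(3,4)
proof (cases rule: nested_cases)
  case 1
  then have "lev P < lev Q" using assms by (auto simp: records_def)
  then show ?thesis using assms by simp
qed auto

lemma inj_on_lev: "G \<subseteq> records \<Longrightarrow> inj_on lev {Q\<in>G. x \<in> Q}"
  by (rule inj_onI) (simp, metis order_refl records_chain subsetD subset_antisym)

text \<open>The average is the record quantity times \<open>measure M Q powr - \<beta>\<close>.
  Passing to the smaller cube P does not decrease the second factor, and the first grows with the
  level difference. The \<open>- 1\<close> is the loss from rounding.\<close>

lemma records_average_growth: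
  assumes Q: "Q \<in> records" "x \<in> Q" and P: "P \<in> records" "x \<in> P" and lev: "lev Q \<le> lev P"
  shows "exp (real_of_int (lev P - lev Q) - 1) * (mass M v Q / measure M Q) \<le> mass M v P / measure M P"
proof -
  have mQ: "0 < measure M Q" "0 < measure M P" and le: "measure M P \<le> measure M Q"
    using measure_D_pos Q P records_D measure_mono_D records_chain[OF Q(1) P(1) Q(2) P(2) lev] by auto
  have e: "mass M v R / measure M R = measure M R powr (\<beta> - 1) * mass M v R * measure M R powr - \<beta>"
    if "0 < measure M R" for R
    using that by (simp add: powr_diff powr_minus field_simps)
  have "exp (real_of_int (lev P - lev Q) - 1) * (measure M Q powr (\<beta> - 1) * mass M v Q)
     \<le> exp (real_of_int (lev P - lev Q) - 1) * exp (real_of_int (lev Q) + 1)"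
    using lev_bounds(2)[of Q] Q records_D records_pos by (intro mult_left_mono) auto
  also have "\<dots> = exp (real_of_int (lev P))" by (simp add: mult_exp_exp)
  also have "\<dots> \<le> measure M P powr (\<beta> - 1) * mass M v P"
    using lev_bounds(1)[of P] P records_D records_pos by auto
  finally have "exp (real_of_int (lev P - lev Q) - 1) * (measure M Q powr (\<beta> - 1) * mass M v Q) * measure M Q powr - \<beta>
     \<le> measure M P powr (\<beta> - 1) * mass M v P * measure M P powr - \<beta>"
  proof (rule mult_mono)
    show "measure M Q powr - \<beta> \<le> measure M P powr - \<beta>"
      using mQ le \<beta> by (intro powr_mono2') auto
  qed auto
  then show ?thesis using e mQ by (simp add: mult.assoc)
qed

text \<open>After exchanging sum and integral, x is counted once for each cube of G through x whose
  average lies between \<open>v x / B\<close> and \<open>4 * v x\<close>. Averages grow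
  exponentially with the level, so a window of ratio \<open>4 * B\<close> admits about
  \<open>ln (4 * B)\<close> cubes.\<close>

lemma sum_mass_le:
  assumes G: "G \<subseteq> records" and B: "1 \<le> B"
    and large: "\<And>Q. Q \<in> G \<Longrightarrow> ennreal (mass M v Q) \<le> 4 *
      (\<integral>\<^sup>+x\<in>Q. ennreal (v x) * of_bool (mass M v Q / measure M Q \<le> 4 * v x \<and> v x \<le> B * (mass M v Q / measure M Q)) \<partial>M)"
  shows "(\<integral>\<^sup>+Q. ennreal (mass M v Q) \<partial>count_space G) \<le> ennreal (4 * (2 + ln (4 * B)) * V)"
proof -
  let ?m = "\<lambda>Q. mass M v Q / measure M Q"
  let ?ok = "\<lambda>Q x. ?m Q \<le> 4 * v x \<and> v x \<le> B * ?m Q"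
  have cG: "countable G" using G countable_records countable_subset by blast
  have "(\<integral>\<^sup>+Q. ennreal (mass M v Q) \<partial>count_space G)
     \<le> (\<integral>\<^sup>+Q. 4 * (\<integral>\<^sup>+x\<in>Q. ennreal (v x) * of_bool (?ok Q x) \<partial>M) \<partial>count_space G)"
    by (intro nn_integral_mono large) simp
  also have "\<dots> = 4 * (\<integral>\<^sup>+Q. (\<integral>\<^sup>+x\<in>Q. ennreal (v x) * of_bool (?ok Q x) \<partial>M) \<partial>count_space G)"
    by (intro nn_integral_cmult) simp
  also have "(\<integral>\<^sup>+Q. (\<integral>\<^sup>+x\<in>Q. ennreal (v x) * of_bool (?ok Q x) \<partial>M) \<partial>count_space G)
     = (\<integral>\<^sup>+x. (\<integral>\<^sup>+Q. ennreal (v x) * of_bool (?ok Q x) \<partial>count_space {Q\<in>G. x \<in> Q}) \<partial>M)"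
    using G sets_D records_D by (intro nn_integral_count_space_swap cG) auto
  also have "\<dots> \<le> (\<integral>\<^sup>+x. ennreal (2 + ln (4 * B)) * ennreal (v x) \<partial>M)"
  proof (intro nn_integral_mono)
    fix x
    let ?T = "{Q\<in>{Q\<in>G. ?ok Q x}. x \<in> Q}"
    have "(\<integral>\<^sup>+Q. ennreal (v x) * of_bool (?ok Q x) \<partial>count_space {Q\<in>G. x \<in> Q})
       = (\<integral>\<^sup>+Q. ennreal (v x) * of_bool (?ok Q x) \<partial>count_space ?T)"
      by (intro nn_integral_count_space_eq) auto
    also have "\<dots> = (\<integral>\<^sup>+Q. ennreal (v x) * 1 \<partial>count_space ?T)"
      by (intro nn_integral_cong) auto
    also have "\<dots> = ennreal (v x) * (\<integral>\<^sup>+Q. 1 \<partial>count_space ?T)"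
      by (intro nn_integral_cmult) simp
    \<comment> \<open>The first \<open>1\<close> is the rounding loss of
      \<open>records_average_growth\<close>; the second counts both ends of the range of
      levels.\<close>
    also have "\<dots> \<le> ennreal (v x) * ennreal ((1 + ln (4 * B)) + 1)"
    proof (intro mult_left_mono card_level_le)
      show "countable ?T" using cG by (rule countable_subset[rotated]) auto
      show "inj_on lev ?T" using G by (intro inj_on_lev) auto
      show "0 \<le> 1 + ln (4 * B)" using B by simp
      fix Q P assume Q: "Q \<in> ?T" and P: "P \<in> ?T" and lev: "lev Q \<le> lev P"
      have Qr: "Q \<in> records" "P \<in> records" "x \<in> Q" "x \<in> P" using Q P G by auto
      have mQ: "0 < ?m Q" using Qr records_pos measure_D_pos records_D by simp
      have "exp (real_of_int (lev P - lev Q) - 1) * ?m Q \<le> ?m P"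
        using records_average_growth Qr lev by blast
      also have "\<dots> \<le> 4 * v x" using P by simp
      also have "\<dots> \<le> 4 * (B * ?m Q)" using Q by simp
      finally have "exp (real_of_int (lev P - lev Q) - 1) * ?m Q \<le> (4 * B) * ?m Q"
        by (simp only: mult.assoc)
      then have "exp (real_of_int (lev P - lev Q) - 1) \<le> 4 * B"
        using mQ by (rule mult_right_le_imp_le)
      then have "real_of_int (lev P - lev Q) - 1 \<le> ln (4 * B)"
        using B by (subst ln_ge_iff) auto
      then show "real_of_int (lev P - lev Q) \<le> 1 + ln (4 * B)" by simp
    qed simp
    also have "\<dots> = ennreal (2 + ln (4 * B)) * ennreal (v x)"
      by (simp add: mult.commute)
    finally show "(\<integral>\<^sup>+Q. ennreal (v x) * of_bool (?ok Q x) \<partial>count_space {Q\<in>G. x \<in> Q})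
        \<le> ennreal (2 + ln (4 * B)) * ennreal (v x)" .
  qed
  also have "\<dots> = ennreal (2 + ln (4 * B)) * ennreal V"
    by (simp add: nn_integral_cmult v_total)
  also have "4 * (ennreal (2 + ln (4 * B)) * ennreal V) = ennreal (4 * (2 + ln (4 * B)) * V)"
  proof -
    have "4 * (ennreal L * ennreal V) = ennreal (4 * L * V)" if "0 \<le> L" for L
    proof -
      have "ennreal (4 * (L * V)) = ennreal 4 * ennreal (L * V)"
        using that V_pos by (intro ennreal_mult) auto
      then show ?thesis using that V_pos by (simp add: ennreal_mult mult.assoc)
    qed
    moreover have "0 \<le> 2 + ln (4 * B)" using B by simp
    ultimately show ?thesis by blast
  qed
  finally show ?thesis by (simp add: mult_left_mono)
qed

end

section \<open>Sorting the record cubes\<close>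

text \<open>The factor \<open>4 * (2 + ln (4 * B))\<close> of \<open>sum_mass_le\<close>, for the B
  of \<open>mass_window\<close>, with \<open>2 powr (r / \<theta>)\<close> split off. The summand
  \<theta> pays for \<open>r * ln 2 \<le> \<theta> * 2 powr (r / \<theta>)\<close>, and
  \<open>4 powr (1 / \<theta>)\<close> for the shift in r + 2.\<close>

definition carleson_const :: "real \<Rightarrow> real \<Rightarrow> real" where
  "carleson_const q \<theta> = 4 * (2 + ln 4 + ln 2 + \<theta> + q * 4 powr (1 / \<theta>))"

text \<open>Two cubes of one group differ in \<open>tightness\<close> by at most a factor 2 and in
  \<open>ratio powr (1 / q)\<close> by at most \<open>2 powr (1 / q)\<close>; rounded levels cost
  \<open>exp (1 / q)\<close>. The outer exponent converts a bound for
  \<open>\<sigma>(Q) powr (1 - 1 / p)\<close> into one for \<open>thr\<close>.\<close>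

definition decay_const :: "real \<Rightarrow> real \<Rightarrow> real" where
  "decay_const p q = (2 * (2 powr (1 / q) * exp (1 / q))) powr (- 1 / (p - 1))"

text \<open>The two summands are the constants of the geometric series above and below the height
  \<open>f x\<close>, with exponents q - p and p - 1 and rate \<open>1 / (q * (p - 1))\<close>; the
  first blows up as q tends to p. The factor \<open>2 powr q\<close> belongs to
  \<open>wavg_power_le\<close>.\<close>

definition embedding_const :: "real \<Rightarrow> real \<Rightarrow> real" where
  "embedding_const p q = 2 powr q *
     (decay_const p q powr - (q - p) / (1 - exp (- (q - p) * (1 / (q * (p - 1)))))
    + decay_const p q powr - (p - 1) / (1 - exp (- (p - 1) * (1 / (q * (p - 1))))))"

lemma decay_const_pos: "0 < decay_const p q"
  by (simp add: decay_const_def)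

lemma carleson_const_pos: "1 < q \<Longrightarrow> 0 < \<theta> \<Longrightarrow> 0 < carleson_const q \<theta>"
  by (simp add: carleson_const_def add_pos_nonneg)

lemma embedding_const_pos: "1 < p \<Longrightarrow> p < q \<Longrightarrow> 0 < embedding_const p q"
  unfolding embedding_const_def using decay_const_pos[of p q]
  by (intro mult_pos_pos add_pos_pos divide_pos_pos) (auto intro!: divide_neg_pos)

text \<open>Here s is \<sigma>, a is \<alpha>/n and v is a part of u. \<open>w Q\<close> stands for
  \<open>l powr q\<close> with l admissible in the Luxemburg norm of \<open>u powr (1 / q)\<close>:
  \<open>bump\<close> is the condition that the average of \<Phi> is at most 1, multiplied by
  \<open>w Q\<close>. It is asked only on cubes of positive s-mass, because elsewhere the two-weight
  product may be finite as infinity times 0.\<close>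

locale bump_grid = mass_grid +
  fixes s :: "'a \<Rightarrow> real" and w :: "'a set \<Rightarrow> real" and p q a \<theta> K :: real
  assumes s_meas [measurable]: "s \<in> borel_measurable M"
    and s_nonneg: "0 \<le> s x"
    and s_finite: "Q \<in> D \<Longrightarrow> (\<integral>\<^sup>+x\<in>Q. ennreal (s x) \<partial>M) < \<infinity>"
    and p_gt_1: "1 < p" and p_less_q: "p < q" and \<beta>_less_a: "\<beta> < a"
    and \<beta>_large: "0 \<le> 1 - 1 / q - a + \<beta> / q"
    and \<theta>: "q - 1 < \<theta>" and K_pos: "0 < K"
    and w_pos: "Q \<in> D \<Longrightarrow> 0 < mass M s Q \<Longrightarrow> 0 < w Q"
    and bump: "Q \<in> D \<Longrightarrow> 0 < mass M s Q \<Longrightarrow>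
       (\<integral>\<^sup>+x\<in>Q. ennreal (v x * ln (exp 1 + (v x / w Q) powr (1 / q)) powr \<theta>) \<partial>M) \<le> ennreal (w Q * measure M Q)"
    and test: "Q \<in> D \<Longrightarrow> 0 < mass M s Q \<Longrightarrow>
       measure M Q powr (a + 1 / q - 1 / p) * w Q powr (1 / q) * (mass M s Q / measure M Q) powr (1 - 1 / p) \<le> K"
begin

lemma q_gt_1: "1 < q" using p_gt_1 p_less_q by simp

lemma \<theta>_pos: "0 < \<theta>" using q_gt_1 \<theta> by simp

definition good :: "'a set set" where
  "good = {Q\<in>records. 0 < mass M s Q}"

definition ratio :: "'a set \<Rightarrow> real" where
  "ratio Q = w Q * measure M Q / mass M v Q"

definition tightness :: "'a set \<Rightarrow> real" where
  "tightness Q = measure M Q powr (a + 1 / q - 1 / p) * w Q powr (1 / q)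
     * (mass M s Q / measure M Q) powr (1 - 1 / p) / K"

text \<open>On good cubes \<open>tightness\<close> is at most 1 and \<open>ratio\<close> at least 1,
  so both logarithms have the right sign and \<open>nat\<close> loses nothing.\<close>

definition grp :: "'a set \<Rightarrow> nat \<times> nat" where
  "grp Q = (nat \<lfloor>- log 2 (tightness Q)\<rfloor>, nat \<lfloor>log 2 (ratio Q)\<rfloor>)"

definition group :: "nat \<Rightarrow> nat \<Rightarrow> 'a set set" where
  "group i r = {Q\<in>good. grp Q = (i, r)}"

lemma goodD:
  assumes "Q \<in> good"
  shows "Q \<in> D" "Q \<in> records" "0 < mass M v Q" "0 < mass M s Q" "0 < measure M Q" "0 < w Q"
  using assms records_D records_pos measure_D_pos w_pos by (auto simp: good_def)

lemma groupD: "Q \<in> group i r \<Longrightarrow> Q \<in> good"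
  by (simp add: group_def)

lemma countable_good: "countable good"
  using countable_records by (rule countable_subset[rotated]) (auto simp: good_def)

lemma countable_group: "countable (group i r)"
  using countable_good by (rule countable_subset[rotated]) (auto simp: group_def)

lemma ennreal_mass_s: "Q \<in> D \<Longrightarrow> ennreal (mass M s Q) = (\<integral>\<^sup>+x\<in>Q. ennreal (s x) \<partial>M)"
  by (intro ennreal_mass s_finite)

text \<open>The logarithmic factor is at least \<open>ln (exp 1) = 1\<close>, so the integral in
  \<open>bump\<close> dominates the v-mass itself.\<close>

lemma ratio_ge_1:
  assumes "Q \<in> good"
  shows "1 \<le> ratio Q"
proof -
  note Q = goodD[OF assms]
  have "ennreal (mass M v Q) \<le> (\<integral>\<^sup>+x\<in>Q. ennreal (v x * ln (exp 1 + (v x / w Q) powr (1 / q)) powr \<theta>) \<partial>M)"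
    unfolding ennreal_mass_v
  proof (intro nn_integral_mono mult_right_mono ennreal_leI)
    fix x
    have "ln (exp 1) \<le> ln (exp 1 + (v x / w Q) powr (1 / q))"
      by (subst ln_le_cancel_iff) (auto intro: add_pos_nonneg)
    then have "1 \<le> ln (exp 1 + (v x / w Q) powr (1 / q)) powr \<theta>"
      using \<theta>_pos by (intro ge_one_powr_ge_zero) auto
    then show "v x \<le> v x * ln (exp 1 + (v x / w Q) powr (1 / q)) powr \<theta>"
      using v_nonneg[of x] by (simp add: mult_le_cancel_left1)
  qed auto
  also have "\<dots> \<le> ennreal (w Q * measure M Q)" using bump Q by blast
  finally show ?thesis using Q by (simp add: ratio_def)
qed

lemma tightness_bounds:
  assumes "Q \<in> good"
  shows "0 < tightness Q" "tightness Q \<le> 1"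
  using goodD[OF assms] test[of Q] K_pos by (auto simp: tightness_def)

lemma group_bounds:
  assumes "Q \<in> group i r"
  shows "2 powr real r \<le> ratio Q" "ratio Q < 2 powr (real r + 1)"
    and "2 powr - (real i + 1) < tightness Q" "tightness Q \<le> 2 powr - real i"
proof -
  have Q: "Q \<in> good" "nat \<lfloor>- log 2 (tightness Q)\<rfloor> = i" "nat \<lfloor>log 2 (ratio Q)\<rfloor> = r"
    using assms by (auto simp: group_def grp_def)
  note R = ratio_ge_1[OF Q(1)] and T = tightness_bounds[OF Q(1)]
  have "0 \<le> log 2 (ratio Q)" using R by simp
  then have "real r \<le> log 2 (ratio Q)" "log 2 (ratio Q) < real r + 1"
    unfolding Q(3)[symmetric] by linarith+
  then show "2 powr real r \<le> ratio Q" "ratio Q < 2 powr (real r + 1)"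
    using R by (simp_all add: le_log_iff log_less_iff)
  have "0 \<le> - log 2 (tightness Q)" using T by simp
  then have "real i \<le> - log 2 (tightness Q)" "- log 2 (tightness Q) < real i + 1"
    unfolding Q(2)[symmetric] by linarith+
  then have "log 2 (tightness Q) \<le> - real i" "- (real i + 1) < log 2 (tightness Q)"
    by linarith+
  then show "2 powr - (real i + 1) < tightness Q" "tightness Q \<le> 2 powr - real i"
    using T by (simp_all only: log_le_iff less_log_iff one_less_numeral_iff semiring_norm)
qed

text \<open>
  Where \<open>v\<close> exceeds \<open>B\<close> times its average, the logarithmic factor of the bump is at least
  \<open>2 powr (r + 2)\<close>, so such points carry at most half of the mass.
\<close>
lemma mass_window:
  assumes "Q \<in> group i r"
  defines "B \<equiv> exp ((real r + 1) * ln 2 + q * 2 powr ((real r + 2) / \<theta>))"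
  shows "ennreal (mass M v Q) \<le> 4 *
      (\<integral>\<^sup>+x\<in>Q. ennreal (v x) * of_bool (mass M v Q / measure M Q \<le> 4 * v x \<and> v x \<le> B * (mass M v Q / measure M Q)) \<partial>M)"
proof -
  note Q = goodD[OF groupD[OF assms(1)]] and R = group_bounds[OF assms(1)]
  have [measurable]: "Q \<in> sets M" using Q sets_D by auto
  define m where "m = mass M v Q / measure M Q"
  have m: "0 < m" using Q by (simp add: m_def)
  define L where "L x = v x * ln (exp 1 + (v x / w Q) powr (1 / q)) powr \<theta>" for x
  have L0: "0 \<le> L x" for x using v_nonneg by (simp add: L_def)
  have [measurable]: "L \<in> borel_measurable M" unfolding L_def by measurable
  define J where "J = (\<integral>\<^sup>+x\<in>Q. ennreal (v x) * of_bool (m \<le> 4 * v x \<and> v x \<le> B * m) \<partial>M)"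
  \<comment> \<open>B is made for this: \<open>B * m < v x\<close> forces
    \<open>v x / w Q \<ge> exp (q * 2 powr ((r + 2) / \<theta>))\<close>, and the logarithm of the
    q-th root of the right-hand side has \<theta>-th power \<open>2 powr (r + 2)\<close>.\<close>
  have large: "v x \<le> 2 powr - (real r + 2) * L x" if x: "B * m < v x" for x
  proof -
    have "w Q < 2 powr (real r + 1) * m"
      using R(2) Q by (simp add: ratio_def m_def field_simps)
    then have "exp (q * 2 powr ((real r + 2) / \<theta>)) * w Q
        \<le> exp (q * 2 powr ((real r + 2) / \<theta>)) * (2 powr (real r + 1) * m)"
      by simp
    also have "\<dots> = B * m"
      by (simp add: B_def exp_add powr_def)
    finally have "exp (q * 2 powr ((real r + 2) / \<theta>)) \<le> v x / w Q"
      using x Q by (simp add: field_simps)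
    then have "exp (q * 2 powr ((real r + 2) / \<theta>)) powr (1 / q) \<le> (v x / w Q) powr (1 / q)"
      using q_gt_1 by (intro powr_mono2) auto
    then have "exp (2 powr ((real r + 2) / \<theta>)) \<le> exp 1 + (v x / w Q) powr (1 / q)"
      using q_gt_1 by (simp add: powr_def add_increasing)
    then have "2 powr ((real r + 2) / \<theta>) \<le> ln (exp 1 + (v x / w Q) powr (1 / q))"
      by (subst ln_ge_iff) (auto intro: add_pos_nonneg)
    then have "(2 powr ((real r + 2) / \<theta>)) powr \<theta> \<le> ln (exp 1 + (v x / w Q) powr (1 / q)) powr \<theta>"
      using \<theta>_pos by (intro powr_mono2) auto
    then have "2 powr (real r + 2) \<le> ln (exp 1 + (v x / w Q) powr (1 / q)) powr \<theta>"
      using \<theta>_pos by (simp add: powr_powr)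
    then have "v x * 2 powr (real r + 2) \<le> L x"
      unfolding L_def using v_nonneg[of x] by (rule mult_left_mono)
    then show ?thesis by (simp only: powr_minus) (simp add: field_simps)
  qed
  \<comment> \<open>Points with \<open>4 * v x < m\<close> carry at most a quarter of the mass.
    Those above \<open>B * m\<close> carry at most \<open>2 powr - (r + 2)\<close> times
    \<open>w Q * measure M Q\<close>, which is at most half of it as
    \<open>ratio Q < 2 powr (r + 1)\<close>. The window keeps the remaining quarter.\<close>
  have point: "ennreal (v x) * indicator Q x \<le> ennreal (m / 4) * indicator Q x
      + (ennreal (2 powr - (real r + 2)) * (ennreal (L x) * indicator Q x)
      + ennreal (v x) * of_bool (m \<le> 4 * v x \<and> v x \<le> B * m) * indicator Q x)" for x
  proof (cases "x \<in> Q")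
    case True
    consider "4 * v x < m" | "B * m < v x" | "m \<le> 4 * v x \<and> v x \<le> B * m" by linarith
    then show ?thesis
    proof cases
      case 1
      then have "ennreal (v x) \<le> ennreal (m / 4)" by (intro ennreal_leI) simp
      then show ?thesis using True by (simp add: add_increasing2)
    next
      case 2
      then have "ennreal (v x) \<le> ennreal (2 powr - (real r + 2)) * ennreal (L x)"
        using large[OF 2] L0[of x] by (simp add: ennreal_mult[symmetric] ennreal_leI)
      then show ?thesis using True by (simp add: add_increasing add_increasing2)
    next
      case 3
      then show ?thesis using True by (simp add: add_increasing)
    qed
  qed simp
  have "ennreal (mass M v Q) \<le> (\<integral>\<^sup>+x. ennreal (m / 4) * indicator Q x
      + (ennreal (2 powr - (real r + 2)) * (ennreal (L x) * indicator Q x)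
      + ennreal (v x) * of_bool (m \<le> 4 * v x \<and> v x \<le> B * m) * indicator Q x) \<partial>M)"
    unfolding ennreal_mass_v by (intro nn_integral_mono point)
  also have "\<dots> = ennreal (m / 4) * emeasure M Q
     + (ennreal (2 powr - (real r + 2)) * (\<integral>\<^sup>+x\<in>Q. ennreal (L x) \<partial>M) + J)"
    unfolding J_def by (simp add: nn_integral_add nn_integral_cmult)
  also have "\<dots> \<le> ennreal (m / 4) * emeasure M Q
     + (ennreal (2 powr - (real r + 2)) * ennreal (w Q * measure M Q) + J)"
    using bump[OF Q(1,4)] by (intro add_mono mult_left_mono) (auto simp: L_def)
  also have "ennreal (m / 4) * emeasure M Q = ennreal (mass M v Q / 4)"
    using Q m by (simp add: emeasure_D_eq ennreal_mult[symmetric] m_def)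
  also have "ennreal (2 powr - (real r + 2)) * ennreal (w Q * measure M Q)
     = ennreal (2 powr - (real r + 2) * (w Q * measure M Q))"
    using Q by (simp add: ennreal_mult)
  also have "ennreal (2 powr - (real r + 2) * (w Q * measure M Q)) \<le> ennreal (mass M v Q / 2)"
  proof (rule ennreal_leI)
    have "w Q * measure M Q \<le> 2 powr (real r + 1) * mass M v Q"
      using R(2) Q by (simp add: ratio_def field_simps)
    then have "2 powr - (real r + 2) * (w Q * measure M Q)
        \<le> 2 powr - (real r + 2) * (2 powr (real r + 1) * mass M v Q)"
      by (rule mult_left_mono) simp
    also have "\<dots> = mass M v Q / 2"
      by (simp add: mult.assoc[symmetric] powr_add[symmetric] powr_minus)
    finally show "2 powr - (real r + 2) * (w Q * measure M Q) \<le> mass M v Q / 2" .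
  qed
  finally have *: "ennreal (mass M v Q) \<le> ennreal (mass M v Q / 4) + (ennreal (mass M v Q / 2) + J)"
    by (simp add: add_mono)
  have "ennreal (mass M v Q) \<le> 4 * J"
  proof (cases J)
    case (real j)
    then show ?thesis using *
      by (simp add: ennreal_plus[symmetric] ennreal_mult[symmetric] flip: ennreal_numeral del: ennreal_plus)
  next
    case top
    then show ?thesis by (simp add: ennreal_mult_top)
  qed
  then show ?thesis by (simp add: J_def m_def)
qed

text \<open>\<open>ln B\<close> is of order \<open>2 powr (r / \<theta>)\<close>, its term linear in
  r being absorbed through \<open>1 + y \<le> exp y\<close>.\<close>

lemma group_mass_le:
  "(\<integral>\<^sup>+Q. ennreal (mass M v Q) \<partial>count_space (group i r)) \<le> ennreal (carleson_const q \<theta> * 2 powr (real r / \<theta>) * V)"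
proof -
  let ?l = "(real r + 1) * ln 2 + q * 2 powr ((real r + 2) / \<theta>)"
  have l: "0 \<le> ?l" using q_gt_1 by simp
  have "(\<integral>\<^sup>+Q. ennreal (mass M v Q) \<partial>count_space (group i r)) \<le> ennreal (4 * (2 + ln (4 * exp ?l)) * V)"
    using mass_window[of _ i r] l
    by (intro sum_mass_le) (auto simp: group_def good_def)
  also have "\<dots> \<le> ennreal (carleson_const q \<theta> * 2 powr (real r / \<theta>) * V)"
  proof (intro ennreal_leI mult_right_mono)
    let ?e = "2 powr (real r / \<theta>)"
    have e1: "1 \<le> ?e" using \<theta>_pos by (intro ge_one_powr_ge_zero) auto
    have "1 + real r / \<theta> * ln 2 \<le> ?e"
      unfolding powr_def using exp_ge_add_one_self by simp
    then have "real r * ln 2 \<le> \<theta> * (?e - 1)" using \<theta>_pos by (simp add: field_simps)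
    then have "real r * ln 2 \<le> \<theta> * ?e" using \<theta>_pos by (simp add: right_diff_distrib)
    moreover have "2 powr ((real r + 2) / \<theta>) = 4 powr (1 / \<theta>) * ?e"
    proof -
      have "(4::real) powr (1 / \<theta>) = (2 powr 2) powr (1 / \<theta>)" by simp
      also have "\<dots> = 2 powr (2 / \<theta>)" by (simp only: powr_powr) simp
      finally show ?thesis by (simp add: powr_add[symmetric] add_divide_distrib add.commute)
    qed
    moreover have "2 + ln 4 + ln 2 \<le> (2 + ln 4 + ln 2) * ?e"
      using mult_left_mono[OF e1, of "2 + ln 4 + ln 2"] by simp
    moreover have "ln (4 * exp ?l) = ln 4 + ?l" by (simp add: ln_mult)
    ultimately show "4 * (2 + ln (4 * exp ?l)) \<le> carleson_const q \<theta> * ?e"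
      by (simp add: carleson_const_def algebra_simps)
  qed (use V_pos in simp)
  finally show ?thesis .
qed

text \<open>The constant whose norm in L^p(s) over Q is 1, hence the natural height at which to cut
  f on Q.\<close>

definition thr :: "'a set \<Rightarrow> real" where
  "thr Q = mass M s Q powr (- 1 / p)"

lemma thr_pos: "Q \<in> good \<Longrightarrow> 0 < thr Q"
  using goodD(4)[of Q] by (simp add: thr_def)

text \<open>The definition of \<open>tightness\<close> solved for the s-mass, with
  \<open>w Q\<close> expressed by \<open>ratio Q\<close> and the record quantity. In a group
  \<open>tightness\<close> and \<open>ratio\<close> are constant up to a factor 2; descending
  through records, the power of \<open>measure M Q\<close> does not grow by
  \<open>\<beta>_large\<close>, and the last factor shrinks.\<close>

lemma mass_s_eq:
  assumes "Q \<in> good"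
  shows "mass M s Q powr (1 - 1 / p) = K * tightness Q * measure M Q powr (1 - 1 / q - a + \<beta> / q)
     * ratio Q powr (- 1 / q) * (measure M Q powr (\<beta> - 1) * mass M v Q) powr (- 1 / q)"
proof -
  note Q = goodD[OF assms]
  let ?m = "measure M Q"
  have "K * tightness Q = ?m powr (a + 1 / q - 1 / p) * w Q powr (1 / q) * (mass M s Q / ?m) powr (1 - 1 / p)"
    using K_pos by (simp add: tightness_def)
  moreover have "ratio Q powr (- 1 / q) * (?m powr (\<beta> - 1) * mass M v Q) powr (- 1 / q)
     = w Q powr (- 1 / q) * ?m powr (- \<beta> / q)"
  proof -
    have "ratio Q * (?m powr (\<beta> - 1) * mass M v Q) = w Q * ?m powr \<beta>"
      using Q by (simp add: ratio_def powr_diff)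
    then have "ratio Q powr (- 1 / q) * (?m powr (\<beta> - 1) * mass M v Q) powr (- 1 / q) = (w Q * ?m powr \<beta>) powr (- 1 / q)"
      using Q ratio_ge_1[OF assms] by (simp add: powr_mult[symmetric])
    then show ?thesis using Q by (simp add: powr_mult powr_powr)
  qed
  ultimately have "K * tightness Q * ?m powr (1 - 1 / q - a + \<beta> / q)
     * (ratio Q powr (- 1 / q) * (?m powr (\<beta> - 1) * mass M v Q) powr (- 1 / q))
    = (w Q powr (1 / q) * w Q powr (- 1 / q)) * mass M s Q powr (1 - 1 / p) *
      (?m powr (a + 1 / q - 1 / p) * ?m powr (1 - 1 / q - a + \<beta> / q) * ?m powr (- \<beta> / q) / ?m powr (1 - 1 / p))"
    using Q by (simp add: powr_divide)
  also have "?m powr (a + 1 / q - 1 / p) * ?m powr (1 - 1 / q - a + \<beta> / q) * ?m powr (- \<beta> / q) / ?m powr (1 - 1 / p)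
     = ?m powr 0"
    by (simp only: powr_add[symmetric] powr_diff[symmetric]) (simp add: algebra_simps)
  also have "w Q powr (1 / q) * w Q powr (- 1 / q) = w Q powr 0"
    by (simp only: powr_add[symmetric]) simp
  finally show ?thesis using Q by (simp add: mult.assoc)
qed

text \<open>Comparing \<open>mass_s_eq\<close> for the two cubes, the s-mass to the power 1 - 1/p
  decays like \<open>exp (- (lev P - lev Q) / q)\<close>. The power \<open>- 1 / (p - 1)\<close>
  reverses the inequality, turns masses into \<open>thr\<close> and yields the rate
  \<open>1 / (q * (p - 1))\<close>.\<close>

lemma thr_growth:
  assumes Q: "Q \<in> group i r" "x \<in> Q" and P: "P \<in> group i r" "x \<in> P" and lev: "lev Q \<le> lev P"
  shows "decay_const p q * exp (1 / (q * (p - 1)) * real_of_int (lev P - lev Q)) * thr Q \<le> thr P"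
proof -
  note gQ = goodD[OF groupD[OF Q(1)]] and gP = goodD[OF groupD[OF P(1)]]
  note bQ = group_bounds[OF Q(1)] and bP = group_bounds[OF P(1)]
  have q: "0 < q" "1 < p" using q_gt_1 p_gt_1 by auto
  let ?e0 = "1 - 1 / q - a + \<beta> / q" and ?X = "\<lambda>Q. measure M Q powr (\<beta> - 1) * mass M v Q"
  define h where "h = 1 - 1 / p"
  have sub: "measure M P \<le> measure M Q"
    using records_chain gQ gP Q P lev by (intro measure_mono_D) auto
  have neg: "y powr (- 1 / q) \<le> z powr (- 1 / q)" if "0 < z" "z \<le> y" for y z :: real
    using that q by (intro powr_mono2') auto
  have "mass M s P powr h \<le> K * 2 powr - real i * measure M Q powr ?e0
     * (2 powr real r) powr (- 1 / q) * exp (real_of_int (lev P)) powr (- 1 / q)"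
    unfolding h_def mass_s_eq[OF groupD[OF P(1)]]
    using bP bQ sub K_pos \<beta>_large gP lev_bounds[OF gP(1,3)] tightness_bounds[OF groupD[OF P(1)]]
    by (intro mult_mono neg powr_mono2) (auto intro: less_imp_le)
  also have "\<dots> = (2 * (2 powr (1 / q) * exp (1 / q))) * exp (- (real_of_int (lev P - lev Q) / q)) *
      (K * 2 powr - (real i + 1) * measure M Q powr ?e0
     * (2 powr (real r + 1)) powr (- 1 / q) * exp (real_of_int (lev Q) + 1) powr (- 1 / q))"
  proof -
    have "exp (real_of_int (lev P)) powr (- 1 / q)
       = exp (1 / q) * exp (- (real_of_int (lev P - lev Q) / q)) * exp (real_of_int (lev Q) + 1) powr (- 1 / q)"
      using q by (simp add: powr_def mult_exp_exp diff_divide_distrib add_divide_distrib)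
    moreover have "(2 powr real r) powr (- 1 / q) = 2 powr (1 / q) * (2 powr (real r + 1)) powr (- 1 / q)"
      using q by (simp only: powr_powr powr_add[symmetric]) (simp add: add_divide_distrib)
    moreover have "2 powr - real i = 2 * 2 powr - (real i + 1)"
      by (simp add: powr_diff powr_minus)
    ultimately show ?thesis by simp
  qed
  also have "\<dots> \<le> (2 * (2 powr (1 / q) * exp (1 / q))) * exp (- (real_of_int (lev P - lev Q) / q)) * mass M s Q powr h"
    unfolding h_def mass_s_eq[OF groupD[OF Q(1)]]
    using bP bQ K_pos \<beta>_large gQ lev_bounds[OF gQ(1,3)] ratio_ge_1[OF groupD[OF Q(1)]] q
      tightness_bounds[OF groupD[OF Q(1)]]
    by (intro mult_mono neg powr_mono2 mult_nonneg_nonneg) (auto intro: less_imp_le)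
  finally have "((2 * (2 powr (1 / q) * exp (1 / q))) * exp (- (real_of_int (lev P - lev Q) / q)) * mass M s Q powr h) powr (- 1 / (p - 1))
      \<le> (mass M s P powr h) powr (- 1 / (p - 1))"
    using gP q by (intro powr_mono2') auto
  also have "\<dots> = thr P"
    using q by (simp add: powr_powr thr_def h_def field_simps)
  also have "((2 * (2 powr (1 / q) * exp (1 / q))) * exp (- (real_of_int (lev P - lev Q) / q)) * mass M s Q powr h) powr (- 1 / (p - 1))
     = decay_const p q * exp (- (real_of_int (lev P - lev Q) / q)) powr (- 1 / (p - 1)) * (mass M s Q powr h) powr (- 1 / (p - 1))"
    unfolding decay_const_def by (simp add: powr_mult)
  also have "exp (- (real_of_int (lev P - lev Q) / q)) powr (- 1 / (p - 1)) = exp (1 / (q * (p - 1)) * real_of_int (lev P - lev Q))"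
    using q by (simp add: powr_def field_simps)
  also have "(mass M s Q powr h) powr (- 1 / (p - 1)) = thr Q"
    using q by (simp add: powr_powr thr_def h_def field_simps)
  finally show ?thesis .
qed

end

section \<open>The dyadic estimate\<close>

text \<open>If g is at most t / 2, the first term on the right suffices; otherwise t is at most
  \<open>2 * min g 1\<close>. It serves with t = \<open>wavg f Q\<close> and g =
  \<open>f x / thr Q\<close>, where the term \<open>t powr q / 2\<close> can be absorbed on the
  left.\<close>

lemma power_split_ineq:
  fixes t g q :: real
  assumes "0 \<le> t" "t \<le> 2" "0 \<le> g" "1 < q"
  shows "t powr (q - 1) * g \<le> t powr q / 2 + 2 powr (q - 1) * (if g \<le> 1 then g powr q else g)"
proof (cases "g \<le> t / 2")
  case True
  then have "t powr (q - 1) * g \<le> t powr (q - 1) * (t / 2)"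
    by (intro mult_left_mono) auto
  also have "\<dots> = t powr q / 2"
    using assms by (cases "t = 0") (auto simp: powr_diff)
  finally show ?thesis using assms by (simp add: add_increasing2)
next
  case False
  then have g: "0 < g" using assms by auto
  have "t powr (q - 1) * g \<le> (2 * min g 1) powr (q - 1) * g"
    using False assms by (intro mult_right_mono powr_mono2) (auto simp: min_def)
  also have "\<dots> = 2 powr (q - 1) * (if g \<le> 1 then g powr q else g)"
    using g by (auto simp: powr_mult min_def powr_diff)
  finally show ?thesis by (simp add: add_increasing)
qed

text \<open>The factors come from the passage to records, from Hoelder's inequality within a group
  (exponents 1 - 1/q and 1/q), and from the geometric series over i and r.\<close>

definition dyadic_const :: "real \<Rightarrow> real \<Rightarrow> real \<Rightarrow> real \<Rightarrow> real \<Rightarrow> real \<Rightarrow> real \<Rightarrow> real" where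
  "dyadic_const b a \<beta> p q \<theta> K = exp 1 / (1 - exp (- (a - \<beta>) * ln b)) *
     (K * carleson_const q \<theta> powr (1 - 1 / q) * embedding_const p q powr (1 / q)
      * (2 / (1 - 2 powr - (1 / q - (1 - 1 / q) / \<theta>))))"

section \<open>Averages of a normalised function over the groups\<close>

context bump_grid
begin

text \<open>The average of f over Q with respect to s, divided by \<open>thr Q\<close>.\<close>

definition wavg :: "('a \<Rightarrow> real) \<Rightarrow> 'a set \<Rightarrow> real" where
  "wavg f Q = mass M (\<lambda>x. f x * s x) Q * mass M s Q powr (1 / p - 1)"

text \<open>With g = \<open>f x / thr Q\<close> this is \<open>g powr q\<close> for g at most 1 and
  g otherwise, as in \<open>power_split_ineq\<close>, divided by the s-mass of Q. Since 1 < p < q,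
  both pieces sum along a chain to a multiple of \<open>f x powr p\<close>.\<close>

definition trunc :: "('a \<Rightarrow> real) \<Rightarrow> 'a set \<Rightarrow> 'a \<Rightarrow> real" where
  "trunc f Q x = (if f x \<le> thr Q then f x powr q * thr Q powr (p - q) else f x * thr Q powr (p - 1))"

context
  fixes f :: "'a \<Rightarrow> real"
  assumes f_meas [measurable]: "f \<in> borel_measurable M"
    and f_nonneg: "0 \<le> f x"
    and f_norm: "(\<integral>\<^sup>+x. ennreal (f x powr p * s x) \<partial>M) \<le> 1"
begin

lemma f_norm_on: "(\<integral>\<^sup>+x\<in>Q. ennreal (f x powr p * s x) \<partial>M) \<le> 1"
  by (rule order_trans[OF _ f_norm]) (intro nn_integral_mono, auto split: split_indicator)

text \<open>The elementary \<open>g \<le> 1 + g powr p\<close> stands in for Hoelder's inequality.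
  For z = 1 it makes the integral of f s over Q finite; for z = \<open>thr Q\<close>, where
  \<open>z powr - p\<close> is the s-mass itself, it gives the bound 2 for
  \<open>wavg\<close>.\<close>

lemma scaled_integral_le:
  assumes "Q \<in> D" "0 < z"
  shows "(\<integral>\<^sup>+x\<in>Q. ennreal (f x / z * s x) \<partial>M) \<le> ennreal (mass M s Q + z powr - p)"
proof -
  have [measurable]: "Q \<in> sets M" using assms sets_D by auto
  have le: "g \<le> 1 + g powr p" if "0 \<le> g" for g :: real
  proof (cases "g \<le> 1")
    case False
    then have "g powr 1 \<le> g powr p" using p_gt_1 by (intro powr_mono) auto
    then show ?thesis using that by simp
  qed (simp add: add_increasing2)
  have "(\<integral>\<^sup>+x\<in>Q. ennreal (f x / z * s x) \<partial>M)
     \<le> (\<integral>\<^sup>+x. ennreal (s x) * indicator Q x + ennreal (z powr - p) * (ennreal (f x powr p * s x) * indicator Q x) \<partial>M)"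
  proof (intro nn_integral_mono)
    fix x
    have "f x / z * s x \<le> (1 + (f x / z) powr p) * s x"
      using le[of "f x / z"] f_nonneg[of x] s_nonneg[of x] assms by (intro mult_right_mono) auto
    also have "\<dots> = s x + z powr - p * (f x powr p * s x)"
      using assms f_nonneg[of x] by (simp add: powr_divide powr_minus field_simps)
    finally show "ennreal (f x / z * s x) * indicator Q x
       \<le> ennreal (s x) * indicator Q x + ennreal (z powr - p) * (ennreal (f x powr p * s x) * indicator Q x)"
      using s_nonneg[of x] f_nonneg[of x]
      by (auto simp: ennreal_plus[symmetric] ennreal_mult[symmetric] ennreal_leI simp del: ennreal_plus split: split_indicator)
  qed
  also have "\<dots> = ennreal (mass M s Q) + ennreal (z powr - p) * (\<integral>\<^sup>+x\<in>Q. ennreal (f x powr p * s x) \<partial>M)"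
    using assms by (simp add: nn_integral_add nn_integral_cmult ennreal_mass_s)
  also have "\<dots> \<le> ennreal (mass M s Q) + ennreal (z powr - p) * 1"
    by (intro add_left_mono mult_left_mono f_norm_on) auto
  finally show ?thesis by (simp add: ennreal_plus)
qed

lemma ennreal_mass_fs: "Q \<in> D \<Longrightarrow> ennreal (mass M (\<lambda>x. f x * s x) Q) = (\<integral>\<^sup>+x\<in>Q. ennreal (f x * s x) \<partial>M)"
  using scaled_integral_le[of Q 1] by (intro ennreal_mass) (auto intro: le_less_trans)

lemma scaled_integral_eq:
  assumes "Q \<in> good"
  shows "(\<integral>\<^sup>+x\<in>Q. ennreal (f x / thr Q * s x) \<partial>M) = ennreal (wavg f Q * mass M s Q)"
proof -
  note Q = goodD[OF assms]
  have [measurable]: "Q \<in> sets M" using Q sets_D by auto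
  have "(\<integral>\<^sup>+x\<in>Q. ennreal (f x / thr Q * s x) \<partial>M)
     = (\<integral>\<^sup>+x. ennreal (1 / thr Q) * (ennreal (f x * s x) * indicator Q x) \<partial>M)"
    using thr_pos[OF assms] f_nonneg s_nonneg
    by (intro nn_integral_cong) (auto simp: ennreal_mult[symmetric] split: split_indicator)
  also have "\<dots> = ennreal (1 / thr Q) * ennreal (mass M (\<lambda>x. f x * s x) Q)"
    using Q by (simp add: nn_integral_cmult ennreal_mass_fs)
  also have "\<dots> = ennreal (mass M (\<lambda>x. f x * s x) Q / thr Q)"
    using thr_pos[OF assms] by (simp add: ennreal_mult[symmetric])
  also have "mass M (\<lambda>x. f x * s x) Q / thr Q = wavg f Q * mass M s Q"
    using Q by (simp add: wavg_def thr_def powr_diff powr_minus field_simps)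
  finally show ?thesis .
qed

lemma thr_powr: "Q \<in> good \<Longrightarrow> thr Q powr - p = mass M s Q"
  using goodD(4)[of Q] p_gt_1 by (simp add: thr_def powr_powr)

lemma wavg_nonneg: "0 \<le> wavg f Q"
  by (simp add: wavg_def)

lemma wavg_le_2:
  assumes "Q \<in> good"
  shows "wavg f Q \<le> 2"
proof -
  note Q = goodD[OF assms]
  have "ennreal (wavg f Q * mass M s Q) \<le> ennreal (mass M s Q + thr Q powr - p)"
    unfolding scaled_integral_eq[OF assms, symmetric] using Q thr_pos[OF assms] by (intro scaled_integral_le)
  then have "wavg f Q * mass M s Q \<le> 2 * mass M s Q"
    using thr_powr[OF assms] by (subst (asm) ennreal_le_iff) auto
  then show ?thesis using Q by simp
qed

text \<open>Multiply \<open>scaled_integral_eq\<close> by \<open>wavg f Q powr (q - 1)\<close> and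
  apply \<open>power_split_ineq\<close> under the integral. The half is absorbed on the left, and
  the s-mass of Q cancels.\<close>

lemma wavg_power_le:
  assumes "Q \<in> good"
  shows "ennreal (wavg f Q powr q) \<le> ennreal (2 powr q) * (\<integral>\<^sup>+x\<in>Q. ennreal (trunc f Q x * s x) \<partial>M)"
proof -
  note Q = goodD[OF assms] and tp = thr_pos[OF assms]
  have [measurable]: "Q \<in> sets M" using Q sets_D by auto
  have [measurable]: "trunc f Q \<in> borel_measurable M" unfolding trunc_def by measurable
  let ?t = "wavg f Q" and ?s = "mass M s Q"
  define J where "J = (\<integral>\<^sup>+x\<in>Q. ennreal (trunc f Q x * s x) \<partial>M)"
  have tr0: "0 \<le> trunc f Q x" for x using f_nonneg[of x] by (simp add: trunc_def)
  have point: "ennreal (?t powr (q - 1)) * (ennreal (f x / thr Q * s x) * indicator Q x)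
     \<le> ennreal (?t powr q / 2) * (ennreal (s x) * indicator Q x)
      + ennreal (2 powr (q - 1) * ?s) * (ennreal (trunc f Q x * s x) * indicator Q x)" for x
  proof -
    let ?g = "f x / thr Q"
    have "?t powr (q - 1) * ?g \<le> ?t powr q / 2 + 2 powr (q - 1) * (if ?g \<le> 1 then ?g powr q else ?g)"
      using wavg_nonneg wavg_le_2[OF assms] f_nonneg[of x] tp q_gt_1 by (intro power_split_ineq) auto
    also have "(if ?g \<le> 1 then ?g powr q else ?g) = ?s * trunc f Q x"
      unfolding trunc_def thr_powr[OF assms, symmetric] using tp f_nonneg[of x]
      by (auto simp: powr_divide powr_diff powr_minus field_simps)
    finally have "?t powr (q - 1) * ?g * s x \<le> (?t powr q / 2 + 2 powr (q - 1) * (?s * trunc f Q x)) * s x"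
      using s_nonneg by (rule mult_right_mono)
    also have "\<dots> = ?t powr q / 2 * s x + 2 powr (q - 1) * ?s * (trunc f Q x * s x)"
      by (simp add: algebra_simps)
    finally show ?thesis
      using s_nonneg[of x] f_nonneg[of x] tr0[of x] tp
      by (auto simp: ennreal_plus[symmetric] ennreal_mult[symmetric] mult.assoc ennreal_leI
          simp del: ennreal_plus split: split_indicator)
  qed
  have "ennreal (?t powr (q - 1)) * ennreal (?t * ?s)
     = (\<integral>\<^sup>+x. ennreal (?t powr (q - 1)) * (ennreal (f x / thr Q * s x) * indicator Q x) \<partial>M)"
    unfolding scaled_integral_eq[OF assms, symmetric] by (intro nn_integral_cmult[symmetric]) measurable
  also have "\<dots> \<le> (\<integral>\<^sup>+x. ennreal (?t powr q / 2) * (ennreal (s x) * indicator Q x)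
      + ennreal (2 powr (q - 1) * ?s) * (ennreal (trunc f Q x * s x) * indicator Q x) \<partial>M)"
    by (intro nn_integral_mono point)
  also have "\<dots> = ennreal (?t powr q / 2) * ennreal ?s + ennreal (2 powr (q - 1) * ?s) * J"
    using Q by (simp add: nn_integral_add nn_integral_cmult ennreal_mass_s J_def)
  finally have *: "ennreal (?t powr (q - 1)) * ennreal (?t * ?s)
     \<le> ennreal (?t powr q / 2) * ennreal ?s + ennreal (2 powr (q - 1) * ?s) * J" .
  have tq: "?t powr (q - 1) * ?t = ?t powr q"
    using wavg_nonneg[of Q] by (cases "?t = 0") (auto simp: powr_diff)
  have "ennreal (?t powr q) \<le> ennreal (2 powr q) * J"
  proof (cases J)
    case (real j)
    then have "?t powr (q - 1) * (?t * ?s) \<le> ?t powr q / 2 * ?s + 2 powr (q - 1) * ?s * j"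
      using * wavg_nonneg[of Q] Q
      by (simp add: ennreal_plus[symmetric] ennreal_mult[symmetric] del: ennreal_plus)
    then have "?t powr q * ?s \<le> (?t powr q / 2 + 2 powr (q - 1) * j) * ?s"
      by (simp add: tq[symmetric] algebra_simps)
    then have "?t powr q \<le> ?t powr q / 2 + 2 powr (q - 1) * j"
      using Q(4) by (rule mult_right_le_imp_le)
    then have "?t powr q \<le> 2 powr q * j" by (simp add: powr_diff)
    then show ?thesis using real by (simp add: ennreal_mult[symmetric] ennreal_leI)
  next
    case top
    then show ?thesis by (simp add: ennreal_mult_top)
  qed
  then show ?thesis by (simp add: J_def)
qed

text \<open>The cubes of a group through x form a chain on which \<open>thr\<close> grows
  geometrically. Those with \<open>thr\<close> above \<open>f x\<close> give a series in
  \<open>thr powr - (q - p)\<close>, those below a series in \<open>thr powr (p - 1)\<close>; as 1 <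
  p < q, each is controlled by its terms with \<open>thr\<close> near \<open>f x\<close>.\<close>

lemma trunc_sum_le:
  "(\<integral>\<^sup>+Q. ennreal (trunc f Q x) \<partial>count_space {Q\<in>group i r. x \<in> Q})
     \<le> ennreal (embedding_const p q / 2 powr q * f x powr p)"
proof (cases "f x = 0")
  case True
  then have "ennreal (trunc f Q x) = 0" for Q by (simp add: trunc_def)
  then show ?thesis by simp
next
  case False
  then have fx: "0 < f x" using f_nonneg[of x] by simp
  let ?T = "{Q\<in>group i r. x \<in> Q}"
  define d where "d = decay_const p q"
  define \<kappa> where "\<kappa> = 1 / (q * (p - 1))"
  define A where "A = d powr - (q - p) / (1 - exp (- (q - p) * \<kappa>))"
  define B where "B = d powr - (p - 1) / (1 - exp (- (p - 1) * \<kappa>))"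
  have pos: "0 < d" "0 < \<kappa>" using decay_const_pos q_gt_1 p_gt_1 by (auto simp: d_def \<kappa>_def)
  have AB: "0 \<le> A" "0 \<le> B" unfolding A_def B_def using pos p_gt_1 p_less_q
    by (auto intro!: divide_nonneg_pos mult_neg_pos)
  have "group i r \<subseteq> records" by (auto simp: group_def good_def)
  then have T: "inj_on lev ?T" by (rule inj_on_lev)
  have T': "countable ?T" using countable_group[of i r] by (rule countable_subset[rotated]) auto
  have gr: "d * exp (\<kappa> * real_of_int (lev P - lev Q)) * thr Q \<le> thr P"
    if "Q \<in> ?T" "P \<in> ?T" "lev Q \<le> lev P" for Q P
    using thr_growth[of Q i r x P] that by (simp add: d_def \<kappa>_def)
  have "(\<integral>\<^sup>+Q. ennreal (trunc f Q x) \<partial>count_space ?T)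
    \<le> (\<integral>\<^sup>+Q. ennreal (f x powr q) * ennreal (if f x \<le> thr Q then thr Q powr - (q - p) else 0)
        + ennreal (f x) * ennreal (if thr Q \<le> f x then thr Q powr (p - 1) else 0) \<partial>count_space ?T)"
    using fx by (intro nn_integral_mono) (auto simp: trunc_def ennreal_mult[symmetric])
  also have "\<dots> = ennreal (f x powr q) * (\<integral>\<^sup>+Q. ennreal (if f x \<le> thr Q then thr Q powr - (q - p) else 0) \<partial>count_space ?T)
        + ennreal (f x) * (\<integral>\<^sup>+Q. ennreal (if thr Q \<le> f x then thr Q powr (p - 1) else 0) \<partial>count_space ?T)"
    by (simp add: nn_integral_add nn_integral_cmult)
  also have "\<dots> \<le> ennreal (f x powr q) * ennreal (A * f x powr - (q - p)) + ennreal (f x) * ennreal (B * f x powr (p - 1))"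
    unfolding A_def B_def using T T' gr pos fx p_gt_1 p_less_q thr_pos[OF groupD]
    by (intro add_mono mult_left_mono geometric_level_sum_above[where l=lev] geometric_level_sum_below[where l=lev]) auto
  also have "\<dots> = ennreal (f x powr q * (A * f x powr - (q - p)) + f x * (B * f x powr (p - 1)))"
    using fx AB by (simp add: ennreal_mult[symmetric] ennreal_plus[symmetric] del: ennreal_plus)
  also have "f x powr q * (A * f x powr - (q - p)) + f x * (B * f x powr (p - 1)) = (A + B) * f x powr p"
    using fx by (simp add: powr_diff powr_minus field_simps)
  also have "A + B = embedding_const p q / 2 powr q"
    by (simp add: embedding_const_def A_def B_def d_def \<kappa>_def)
  finally show ?thesis .
qed

text \<open>A Carleson embedding of L^p(s) into l^q: after \<open>wavg_power_le\<close>, exchanging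
  sum and integral leaves the pointwise chain sum of \<open>trunc_sum_le\<close>.\<close>

lemma embedding:
  "(\<integral>\<^sup>+Q. ennreal (wavg f Q powr q) \<partial>count_space (group i r)) \<le> ennreal (embedding_const p q)"
proof -
  let ?E = "embedding_const p q / 2 powr q"
  have E: "0 \<le> ?E" using embedding_const_pos[OF p_gt_1 p_less_q] by simp
  have tr0: "0 \<le> trunc f Q x" for Q x using f_nonneg[of x] by (simp add: trunc_def)
  have [measurable]: "trunc f Q \<in> borel_measurable M" for Q unfolding trunc_def by measurable
  have "(\<integral>\<^sup>+Q. ennreal (wavg f Q powr q) \<partial>count_space (group i r))
     \<le> (\<integral>\<^sup>+Q. ennreal (2 powr q) * (\<integral>\<^sup>+x\<in>Q. ennreal (trunc f Q x * s x) \<partial>M) \<partial>count_space (group i r))"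
    by (intro nn_integral_mono wavg_power_le) (simp add: groupD)
  also have "\<dots> = ennreal (2 powr q) * (\<integral>\<^sup>+Q. (\<integral>\<^sup>+x\<in>Q. ennreal (trunc f Q x * s x) \<partial>M) \<partial>count_space (group i r))"
    by (intro nn_integral_cmult) simp
  also have "(\<integral>\<^sup>+Q. (\<integral>\<^sup>+x\<in>Q. ennreal (trunc f Q x * s x) \<partial>M) \<partial>count_space (group i r))
     = (\<integral>\<^sup>+x. (\<integral>\<^sup>+Q. ennreal (trunc f Q x * s x) \<partial>count_space {Q\<in>group i r. x \<in> Q}) \<partial>M)"
    using sets_D goodD(1)[OF groupD] by (intro nn_integral_count_space_swap countable_group) auto
  also have "\<dots> \<le> (\<integral>\<^sup>+x. ennreal ?E * ennreal (f x powr p * s x) \<partial>M)"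
  proof (intro nn_integral_mono)
    fix x
    have "(\<integral>\<^sup>+Q. ennreal (trunc f Q x * s x) \<partial>count_space {Q\<in>group i r. x \<in> Q})
       = (\<integral>\<^sup>+Q. ennreal (trunc f Q x) \<partial>count_space {Q\<in>group i r. x \<in> Q}) * ennreal (s x)"
      using tr0 s_nonneg by (simp add: ennreal_mult nn_integral_multc)
    also have "\<dots> \<le> ennreal (?E * f x powr p) * ennreal (s x)"
      by (intro mult_right_mono trunc_sum_le) simp
    also have "\<dots> = ennreal ?E * ennreal (f x powr p * s x)"
      using E s_nonneg[of x] by (simp only: ennreal_mult[symmetric] mult_nonneg_nonneg powr_ge_zero mult.assoc)
    finally show "(\<integral>\<^sup>+Q. ennreal (trunc f Q x * s x) \<partial>count_space {Q\<in>group i r. x \<in> Q})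
       \<le> ennreal ?E * ennreal (f x powr p * s x)" .
  qed
  also have "\<dots> = ennreal ?E * (\<integral>\<^sup>+x. ennreal (f x powr p * s x) \<partial>M)"
    by (intro nn_integral_cmult) simp
  also have "\<dots> \<le> ennreal ?E * 1"
    by (intro mult_left_mono f_norm) simp
  also have "ennreal (2 powr q) * (ennreal ?E * 1) = ennreal (embedding_const p q)"
    using E by (simp add: ennreal_mult[symmetric])
  finally show ?thesis by (simp add: mult_left_mono)
qed

text \<open>The powers of \<open>w Q\<close>, the masses and the measure cancel exactly: the
  left-hand side equals \<open>K * tightness Q * ratio Q powr (- 1 / q)\<close> times the product to
  which Hoelder's inequality is applied. The group indices then bound \<open>tightness\<close> and
  \<open>ratio\<close>.\<close>

lemma term_le:
  assumes "Q \<in> group i r"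
  shows "measure M Q powr (a - 1) * mass M v Q * mass M (\<lambda>x. f x * s x) Q
     \<le> K * 2 powr - real i * 2 powr (- real r / q) * (mass M v Q powr (1 - 1 / q) * wavg f Q)"
proof -
  note Q = goodD[OF groupD[OF assms]] and B = group_bounds[OF assms]
  let ?m = "measure M Q" and ?v = "mass M v Q" and ?s = "mass M s Q" and ?F = "mass M (\<lambda>x. f x * s x) Q"
  have "K * tightness Q * ratio Q powr (- 1 / q) * (?v powr (1 - 1 / q) * wavg f Q)
     = (w Q powr (1 / q) * w Q powr (- 1 / q)) * (?s powr (1 - 1 / p) * ?s powr (1 / p - 1))
      * (?v powr (1 / q) * ?v powr (1 - 1 / q))
      * (?m powr (a + 1 / q - 1 / p) * ?m powr (- 1 / q) / ?m powr (1 - 1 / p)) * ?F"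
  proof -
    have "ratio Q powr (- 1 / q) = w Q powr (- 1 / q) * ?m powr (- 1 / q) * ?v powr (1 / q)"
      using Q by (simp add: ratio_def powr_mult powr_divide powr_minus field_simps)
    moreover have "K * tightness Q = ?m powr (a + 1 / q - 1 / p) * w Q powr (1 / q) * (?s powr (1 - 1 / p) / ?m powr (1 - 1 / p))"
      using K_pos Q by (simp add: tightness_def powr_divide)
    ultimately show ?thesis by (simp add: wavg_def)
  qed
  also have "w Q powr (1 / q) * w Q powr (- 1 / q) = 1"
    using Q by (simp add: powr_add[symmetric])
  also have "?s powr (1 - 1 / p) * ?s powr (1 / p - 1) = 1"
    using Q by (simp add: powr_add[symmetric])
  also have "?v powr (1 / q) * ?v powr (1 - 1 / q) = ?v"
    using Q by (simp add: powr_add[symmetric])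
  also have "?m powr (a + 1 / q - 1 / p) * ?m powr (- 1 / q) / ?m powr (1 - 1 / p) = ?m powr (a - 1)"
    by (simp add: powr_add[symmetric] powr_diff[symmetric])
  finally have "?m powr (a - 1) * ?v * ?F = K * tightness Q * ratio Q powr (- 1 / q) * (?v powr (1 - 1 / q) * wavg f Q)"
    by simp
  also have "\<dots> \<le> K * 2 powr - real i * 2 powr (- real r / q) * (?v powr (1 - 1 / q) * wavg f Q)"
  proof (intro mult_right_mono mult_mono)
    have "ratio Q powr (- 1 / q) \<le> (2 powr real r) powr (- 1 / q)"
      using B q_gt_1 by (intro powr_mono2') auto
    then show "ratio Q powr (- 1 / q) \<le> 2 powr (- real r / q)" by (simp add: powr_powr)
  qed (use B K_pos wavg_nonneg tightness_bounds[OF groupD[OF assms]] in auto)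
  finally show ?thesis .
qed

text \<open>Hoelder with exponent \<open>q / (q - 1)\<close> for the v-masses
  (\<open>group_mass_le\<close>) and q for \<open>wavg\<close> (\<open>embedding\<close>). The
  growth \<open>2 powr (r / \<theta>)\<close> enters with power 1 - 1/q and meets the gain
  \<open>2 powr (- r / q)\<close>.\<close>

lemma group_sum_le:
  "(\<integral>\<^sup>+Q. ennreal (measure M Q powr (a - 1) * mass M v Q * mass M (\<lambda>x. f x * s x) Q) \<partial>count_space (group i r))
     \<le> ennreal (K * carleson_const q \<theta> powr (1 - 1 / q) * embedding_const p q powr (1 / q) * V powr (1 - 1 / q)
        * ((1 / 2) ^ i * (2 powr - (1 / q - (1 - 1 / q) / \<theta>)) ^ r))"
proof -
  let ?C = "carleson_const q \<theta>" and ?E = "embedding_const p q"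
  let ?k = "K * 2 powr - real i * 2 powr (- real r / q)"
  have C: "0 < ?C" "0 < ?E"
    using carleson_const_pos q_gt_1 \<theta>_pos embedding_const_pos p_gt_1 p_less_q by auto
  have e: "1 / (q / (q - 1)) = 1 - 1 / q" using q_gt_1 by (simp add: field_simps)
  have "(\<integral>\<^sup>+Q. ennreal (measure M Q powr (a - 1) * mass M v Q * mass M (\<lambda>x. f x * s x) Q) \<partial>count_space (group i r))
     \<le> (\<integral>\<^sup>+Q. ennreal ?k * ennreal (mass M v Q powr (1 - 1 / q) * wavg f Q) \<partial>count_space (group i r))"
  proof (intro nn_integral_mono)
    fix Q assume "Q \<in> space (count_space (group i r))"
    then have "ennreal (measure M Q powr (a - 1) * mass M v Q * mass M (\<lambda>x. f x * s x) Q)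
        \<le> ennreal (?k * (mass M v Q powr (1 - 1 / q) * wavg f Q))"
      by (intro ennreal_leI term_le) simp
    also have "\<dots> = ennreal ?k * ennreal (mass M v Q powr (1 - 1 / q) * wavg f Q)"
      using K_pos wavg_nonneg by (intro ennreal_mult) auto
    finally show "ennreal (measure M Q powr (a - 1) * mass M v Q * mass M (\<lambda>x. f x * s x) Q)
        \<le> ennreal ?k * ennreal (mass M v Q powr (1 - 1 / q) * wavg f Q)" .
  qed
  also have "\<dots> = ennreal ?k * (\<integral>\<^sup>+Q. ennreal (mass M v Q powr (1 - 1 / q) * wavg f Q) \<partial>count_space (group i r))"
    by (rule nn_integral_cmult) simp
  also have "\<dots> \<le> ennreal ?k * ennreal ((?C * 2 powr (real r / \<theta>) * V) powr (1 / (q / (q - 1))) * ?E powr (1 / q))"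
  proof (intro mult_left_mono nn_integral_count_space_Hoelder)
    show "1 < q / (q - 1)" "1 < q" "1 / (q / (q - 1)) + 1 / q = 1"
      using q_gt_1 by (auto simp: field_simps)
    have "(mass M v Q powr (1 - 1 / q)) powr (q / (q - 1)) = mass M v Q" for Q
    proof -
      have "(1 - 1 / q) * (q / (q - 1)) = 1" using q_gt_1 by (simp add: field_simps)
      then show ?thesis by (simp add: powr_powr del: times_divide_eq_right times_divide_eq_left)
    qed
    then show "(\<integral>\<^sup>+Q. ennreal ((mass M v Q powr (1 - 1 / q)) powr (q / (q - 1))) \<partial>count_space (group i r))
        \<le> ennreal (?C * 2 powr (real r / \<theta>) * V)"
      using group_mass_le by simp
    show "(\<integral>\<^sup>+Q. ennreal (wavg f Q powr q) \<partial>count_space (group i r)) \<le> ennreal ?E"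
      by (rule embedding)
  qed (use C V_pos wavg_nonneg in auto)
  also have "\<dots> = ennreal (?k * ((?C * 2 powr (real r / \<theta>) * V) powr (1 - 1 / q) * ?E powr (1 / q)))"
    unfolding e using K_pos by (intro ennreal_mult[symmetric]) auto
  also have "?k * ((?C * 2 powr (real r / \<theta>) * V) powr (1 - 1 / q) * ?E powr (1 / q))
     = K * ?C powr (1 - 1 / q) * ?E powr (1 / q) * V powr (1 - 1 / q)
      * (2 powr - real i * (2 powr (- real r / q) * (2 powr (real r / \<theta>)) powr (1 - 1 / q)))"
    using C V_pos by (simp add: powr_mult)
  also have "2 powr (- real r / q) * (2 powr (real r / \<theta>)) powr (1 - 1 / q) = (2 powr - (1 / q - (1 - 1 / q) / \<theta>)) ^ r"
    by (simp add: powr_powr powr_add[symmetric] flip: powr_realpow) (simp add: algebra_simps)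
  also have "2 powr - real i = (1 / 2) ^ i"
    by (simp add: powr_minus powr_realpow power_one_over inverse_eq_divide)
  finally show ?thesis by simp
qed

lemma good_sum_le:
  "(\<integral>\<^sup>+Q. ennreal (measure M Q powr (a - 1) * mass M v Q * mass M (\<lambda>x. f x * s x) Q) \<partial>count_space good)
     \<le> ennreal (K * carleson_const q \<theta> powr (1 - 1 / q) * embedding_const p q powr (1 / q) * V powr (1 - 1 / q)
        * (2 / (1 - 2 powr - (1 / q - (1 - 1 / q) / \<theta>))))"
proof -
  let ?T = "\<lambda>Q. ennreal (measure M Q powr (a - 1) * mass M v Q * mass M (\<lambda>x. f x * s x) Q)"
  define X where "X = K * carleson_const q \<theta> powr (1 - 1 / q) * embedding_const p q powr (1 / q) * V powr (1 - 1 / q)"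
  define z where "z = 2 powr - (1 / q - (1 - 1 / q) / \<theta>)"
  have X: "0 \<le> X" using K_pos by (simp add: X_def)
  \<comment> \<open>Equivalent to \<theta> > q - 1; it makes the series over r converge.\<close>
  have "(1 - 1 / q) / \<theta> < 1 / q"
    using \<theta> \<theta>_pos q_gt_1 mult_strict_left_mono[of q "1 + \<theta>" q] by (simp add: field_simps)
  then have "z < 2 powr 0" unfolding z_def by (intro powr_less_mono) auto
  then have z: "0 < z" "z < 1" by (auto simp: z_def)
  \<comment> \<open>Each cube has exactly one pair of indices. Written as a double sum of
    indicators, the summand splits into groups once the sums are exchanged.\<close>
  have "?T Q = (\<integral>\<^sup>+i. \<integral>\<^sup>+r. ?T Q * of_bool (grp Q = (i, r)) \<partial>count_space UNIV \<partial>count_space UNIV)" for Q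
  proof -
    have "(\<integral>\<^sup>+r. ?T Q * of_bool (grp Q = (i, r)) \<partial>count_space UNIV) = ?T Q * of_bool (fst (grp Q) = i)" for i
      by (subst nn_integral_count_space'[where A="{snd (grp Q)}"]) (auto simp: prod_eq_iff)
    then show ?thesis
      by (simp, subst nn_integral_count_space'[where A="{fst (grp Q)}"]) auto
  qed
  then have "(\<integral>\<^sup>+Q. ?T Q \<partial>count_space good)
     = (\<integral>\<^sup>+Q. \<integral>\<^sup>+i. \<integral>\<^sup>+r. ?T Q * of_bool (grp Q = (i, r)) \<partial>count_space UNIV \<partial>count_space UNIV \<partial>count_space good)"
    by simp
  also have "\<dots> = (\<integral>\<^sup>+i. \<integral>\<^sup>+Q. \<integral>\<^sup>+r. ?T Q * of_bool (grp Q = (i, r)) \<partial>count_space UNIV \<partial>count_space good \<partial>count_space UNIV)"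
    by (rule nn_integral_count_space_nn_integral) auto
  also have "\<dots> = (\<integral>\<^sup>+i. \<integral>\<^sup>+r. \<integral>\<^sup>+Q. ?T Q * of_bool (grp Q = (i, r)) \<partial>count_space good \<partial>count_space UNIV \<partial>count_space UNIV)"
    by (intro nn_integral_cong nn_integral_count_space_nn_integral) auto
  also have "\<dots> = (\<integral>\<^sup>+i. \<integral>\<^sup>+r. \<integral>\<^sup>+Q. ?T Q \<partial>count_space (group i r) \<partial>count_space UNIV \<partial>count_space UNIV)"
  proof (intro nn_integral_cong)
    fix i r
    have "(\<integral>\<^sup>+Q. ?T Q * of_bool (grp Q = (i, r)) \<partial>count_space good)
       = (\<integral>\<^sup>+Q. ?T Q * of_bool (grp Q = (i, r)) \<partial>count_space (group i r))"
      by (intro nn_integral_count_space_eq) (auto simp: group_def)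
    also have "\<dots> = (\<integral>\<^sup>+Q. ?T Q \<partial>count_space (group i r))"
      by (intro nn_integral_cong) (auto simp: group_def)
    finally show "(\<integral>\<^sup>+Q. ?T Q * of_bool (grp Q = (i, r)) \<partial>count_space good)
       = (\<integral>\<^sup>+Q. ?T Q \<partial>count_space (group i r))" .
  qed
  also have "\<dots> \<le> (\<integral>\<^sup>+i. \<integral>\<^sup>+r. ennreal (X * ((1 / 2) ^ i * z ^ r)) \<partial>count_space UNIV \<partial>count_space UNIV)"
    unfolding X_def z_def by (intro nn_integral_mono group_sum_le)
  also have "\<dots> = (\<integral>\<^sup>+i. ennreal (X * (1 / 2) ^ i) * ennreal (1 / (1 - z)) \<partial>count_space UNIV)"
  proof (intro nn_integral_cong)
    fix i :: nat
    have "(\<integral>\<^sup>+r. ennreal (X * ((1 / 2) ^ i * z ^ r)) \<partial>count_space UNIV)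
       = (\<integral>\<^sup>+r. ennreal (X * (1 / 2) ^ i) * ennreal (z ^ r) \<partial>count_space UNIV)"
      using X z by (intro nn_integral_cong) (simp add: ennreal_mult[symmetric] mult.assoc)
    also have "\<dots> = ennreal (X * (1 / 2) ^ i) * (\<Sum>r. ennreal (z ^ r))"
      by (simp add: nn_integral_cmult nn_integral_count_space_nat)
    also have "(\<Sum>r. ennreal (z ^ r)) = ennreal (1 / (1 - z))"
      using z by (intro suminf_ennreal_eq geometric_sums) auto
    finally show "(\<integral>\<^sup>+r. ennreal (X * ((1 / 2) ^ i * z ^ r)) \<partial>count_space UNIV)
       = ennreal (X * (1 / 2) ^ i) * ennreal (1 / (1 - z))" .
  qed
  also have "\<dots> = (\<integral>\<^sup>+i. ennreal (X / (1 - z)) * ennreal ((1 / 2) ^ i) \<partial>count_space UNIV)"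
    using X z by (intro nn_integral_cong) (simp add: ennreal_mult[symmetric] mult.commute)
  also have "\<dots> = ennreal (X / (1 - z)) * (\<Sum>i. ennreal ((1 / 2) ^ i))"
    by (simp add: nn_integral_cmult nn_integral_count_space_nat)
  also have "(\<Sum>i. ennreal ((1 / 2) ^ i)) = ennreal (1 / (1 - 1 / 2))"
    by (intro suminf_ennreal_eq geometric_sums) auto
  also have "ennreal (X / (1 - z)) * ennreal (1 / (1 - 1 / 2)) = ennreal (X * (2 / (1 - z)))"
    using X z by (simp only: ennreal_mult[symmetric] divide_nonneg_nonneg) (simp add: ennreal_mult[symmetric] mult.commute)
  finally show ?thesis unfolding X_def z_def .
qed

lemma dyadic_bound:
  "(\<integral>\<^sup>+Q. ennreal (measure M Q powr (a - 1) * mass M v Q) * (\<integral>\<^sup>+x\<in>Q. ennreal (f x * s x) \<partial>M) \<partial>count_space D)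
     \<le> ennreal (dyadic_const b a \<beta> p q \<theta> K * V powr (1 - 1 / q))"
proof -
  let ?R = "\<lambda>Q. ennreal (measure M Q powr (a - 1) * mass M v Q) * (\<integral>\<^sup>+x\<in>Q. ennreal (f x * s x) \<partial>M)"
  let ?c = "exp 1 / (1 - exp (- (a - \<beta>) * ln b))"
  have "0 \<le> ?c" using \<beta>_less_a b_gt_1 by (intro divide_nonneg_pos) (auto intro: mult_neg_pos)
  have R: "?R Q = ennreal (measure M Q powr (a - 1) * mass M v Q * mass M (\<lambda>x. f x * s x) Q)" if "Q \<in> D" for Q
    using that by (simp add: ennreal_mass_fs[symmetric] ennreal_mult)
  \<comment> \<open>Records of s-mass 0 carry no information on \<open>w Q\<close>, but f s vanishes
    almost everywhere on them, so they drop out of the sum.\<close>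
  have zero: "mass M (\<lambda>x. f x * s x) Q = 0" if "Q \<in> D" "mass M s Q = 0" for Q
  proof -
    have [measurable]: "Q \<in> sets M" using that sets_D by auto
    have "(\<integral>\<^sup>+x\<in>Q. ennreal (s x) \<partial>M) = 0" using that by (simp add: ennreal_mass_s[symmetric])
    then have "AE x in M. ennreal (s x) * indicator Q x = 0" by (subst (asm) nn_integral_0_iff_AE) auto
    then have "AE x in M. ennreal (f x * s x) * indicator Q x = 0"
    proof eventually_elim
      case (elim x)
      then show ?case using s_nonneg[of x] by (auto split: split_indicator_asm simp: ennreal_eq_0_iff)
    qed
    then have "(\<integral>\<^sup>+x\<in>Q. ennreal (f x * s x) \<partial>M) = 0" by (subst nn_integral_0_iff_AE) auto
    then show ?thesis by (simp add: mass_def)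
  qed
  have "(\<integral>\<^sup>+Q. ?R Q \<partial>count_space D) \<le> ennreal ?c * (\<integral>\<^sup>+Q. ?R Q \<partial>count_space records)"
    using sum_le_records[of "a - \<beta>" "\<lambda>x. ennreal (f x * s x)"] \<beta>_less_a by simp
  also have "(\<integral>\<^sup>+Q. ?R Q \<partial>count_space records) = (\<integral>\<^sup>+Q. ?R Q \<partial>count_space good)"
  proof (rule nn_integral_count_space_eq)
    fix Q assume "Q \<in> records - good"
    then have "Q \<in> D" "mass M s Q = 0"
      using records_D mass_nonneg[of M s Q] by (auto simp: good_def less_le)
    then show "?R Q = 0" using R zero by simp
  qed (auto simp: good_def)
  also have "\<dots> = (\<integral>\<^sup>+Q. ennreal (measure M Q powr (a - 1) * mass M v Q * mass M (\<lambda>x. f x * s x) Q) \<partial>count_space good)"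
    by (intro nn_integral_cong R) (simp add: goodD)
  also have "ennreal ?c * \<dots> \<le> ennreal ?c * ennreal (K * carleson_const q \<theta> powr (1 - 1 / q)
        * embedding_const p q powr (1 / q) * V powr (1 - 1 / q) * (2 / (1 - 2 powr - (1 / q - (1 - 1 / q) / \<theta>))))"
    by (intro mult_left_mono good_sum_le) simp
  also have "\<dots> = ennreal (dyadic_const b a \<beta> p q \<theta> K * V powr (1 - 1 / q))"
    unfolding ennreal_mult'[OF \<open>0 \<le> ?c\<close>, symmetric] dyadic_const_def by (simp only: mult_ac)
  finally show ?thesis .
qed

end

end

section \<open>Grids in Euclidean space\<close>

text \<open>The threefold dilate of the dyadic cube of side \<open>2 powr k\<close> with index m +
  1. It is half-open, so that distinct cubes of one scale and one residue class are
  disjoint.\<close>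

definition tcube :: "int \<Rightarrow> ('n \<Rightarrow> int) \<Rightarrow> (real ^ 'n) set" where
  "tcube k m = {x. \<forall>i. 2 powr real_of_int k * real_of_int (m i) \<le> x $ i
      \<and> x $ i < 2 powr real_of_int k * real_of_int (m i + 3)}"

definition admissible :: "('n \<Rightarrow> int) \<Rightarrow> int \<Rightarrow> ('n \<Rightarrow> int) \<Rightarrow> bool" where
  "admissible c k m \<longleftrightarrow> (\<forall>i. 3 dvd (m i - (if even k then c i else - c i)))"

lemma borel_measurable_nn_integral_count_space:
  fixes f :: "'i \<Rightarrow> 'a \<Rightarrow> ennreal"
  assumes I: "countable I" and meas: "\<And>i. i \<in> I \<Longrightarrow> f i \<in> borel_measurable M"
  shows "(\<lambda>x. \<integral>\<^sup>+i. f i x \<partial>count_space I) \<in> borel_measurable M"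
proof (cases "finite I")
  case True
  then show ?thesis using meas by (simp add: nn_integral_count_space_finite)
next
  case False
  note bij = bij_betw_from_nat_into[OF I False]
  have "(\<integral>\<^sup>+i. f i x \<partial>count_space I) = (\<Sum>n. f (from_nat_into I n) x)" for x
    by (simp add: nn_integral_bij_count_space[symmetric, OF bij, of "\<lambda>i. f i x"] nn_integral_count_space_nat)
  moreover have "f (from_nat_into I n) \<in> borel_measurable M" for n
    using bij by (intro meas) (auto simp: bij_betw_def)
  ultimately show ?thesis by simp
qed

text \<open>
  The triples of dyadic cubes split into \<open>3 ^ n\<close> nested families, one for each residue vector \<open>c\<close>.
  The sign alternates with the scale because \<open>2 \<equiv> -1\<close> modulo \<open>3\<close>.
\<close>
definition grid :: "('n \<Rightarrow> int) \<Rightarrow> (real ^ 'n) set set" where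
  "grid c = {tcube k m | k m. admissible c k m}"

definition shifts :: "('n \<Rightarrow> int) set" where
  "shifts = {c. \<forall>i. c i \<in> {0, 1, 2}}"

text \<open>A grid retains only sets, so the generation is read off the volume
  \<open>(3 * 2 powr k) ^ n\<close>; the floor merely turns a real that is already integral into an
  \<open>int\<close>.\<close>

definition scale :: "(real ^ 'n) set \<Rightarrow> int" where
  "scale Q = \<lfloor>log 2 (measure lebesgue Q) / real CARD('n) - log 2 3\<rfloor>"

lemma finite_shifts: "finite (shifts :: ('n::finite \<Rightarrow> int) set)"
proof -
  have "shifts = ((UNIV :: 'n set) \<rightarrow>\<^sub>E {0, 1, 2 :: int})"
    by (auto simp: shifts_def PiE_def Pi_def extensional_def)
  moreover have "finite ((UNIV :: 'n set) \<rightarrow>\<^sub>E {0, 1, 2 :: int})"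
    by (intro finite_PiE) auto
  ultimately show ?thesis by simp
qed

lemma countable_grid: "countable (grid c :: (real ^ 'n) set set)"
proof -
  have "grid c \<subseteq> (\<lambda>(k, m). tcube k m) ` (UNIV :: (int \<times> ('n \<Rightarrow> int)) set)"
    by (auto simp: grid_def)
  then show ?thesis by (rule countable_subset) simp
qed

lemma tcube_sets [measurable]: "tcube k m \<in> sets lebesgue"
proof -
  have "tcube k m = (\<Inter>i\<in>UNIV. {x. 2 powr real_of_int k * real_of_int (m i) \<le> x $ i
      \<and> x $ i < 2 powr real_of_int k * real_of_int (m i + 3)})"
    by (auto simp: tcube_def)
  also have "\<dots> \<in> sets borel" by (intro sets.finite_INT) auto
  finally show ?thesis by auto
qed

definition corner :: "int \<Rightarrow> ('n \<Rightarrow> int) \<Rightarrow> real ^ 'n" where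
  "corner k m = (\<chi> i. 2 powr real_of_int k * real_of_int (m i))"

lemma tcube_subset: "tcube k m \<subseteq> cbox (corner k m) (\<chi> i. corner k m $ i + 3 * 2 powr real_of_int k)"
  by (auto simp: tcube_def corner_def mem_box_cart algebra_simps less_imp_le)

lemma closed_tcube_cubes: "cbox (corner k m) (\<chi> i. corner k m $ i + 3 * 2 powr real_of_int k) \<in> cubes"
  by (force simp: cubes_def)

lemma emeasure_cube:
  fixes a :: "real ^ 'n"
  assumes "0 < l"
  shows "emeasure lebesgue (cbox a (\<chi> i. a $ i + l)) = ennreal (l ^ CARD('n))"
    and "emeasure lebesgue (box a (\<chi> i. a $ i + l)) = ennreal (l ^ CARD('n))"
proof -
  let ?b = "\<chi> i. a $ i + l"
  have le: "a \<bullet> e \<le> ?b \<bullet> e" if "e \<in> Basis" for e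
    using that assms by (auto simp: Basis_vec_def inner_axis)
  have "cbox a ?b \<noteq> {}" using assms by (auto simp: cbox_interval interval_ne_empty_cart(1) less_eq_vec_def)
  then have "measure lebesgue (cbox a ?b) = l ^ CARD('n)"
    by (simp add: content_cbox_cart)
  then show 1: "emeasure lebesgue (cbox a ?b) = ennreal (l ^ CARD('n))"
    by (simp add: emeasure_eq_measure2 emeasure_lborel_cbox_finite)
  have "emeasure lborel (box a ?b) = emeasure lborel (cbox a ?b)"
    using le by (simp add: emeasure_lborel_box emeasure_lborel_cbox)
  then show "emeasure lebesgue (box a ?b) = ennreal (l ^ CARD('n))"
    using 1 by simp
qed

lemma emeasure_tcube:
  "emeasure lebesgue (tcube k m :: (real ^ 'n) set) = ennreal ((3 * 2 powr real_of_int k) ^ CARD('n))"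
proof (rule antisym)
  have "box (corner k m) (\<chi> i. corner k m $ i + 3 * 2 powr real_of_int k) \<subseteq> tcube k m"
    by (auto simp: tcube_def corner_def mem_box_cart algebra_simps less_imp_le)
  from emeasure_mono[OF this tcube_sets]
  show "ennreal ((3 * 2 powr real_of_int k) ^ CARD('n)) \<le> emeasure lebesgue (tcube k m)"
    by (subst (asm) emeasure_cube(2)) auto
  show "emeasure lebesgue (tcube k m) \<le> ennreal ((3 * 2 powr real_of_int k) ^ CARD('n))"
    by (rule order_trans[OF emeasure_mono[OF tcube_subset]]) (simp, subst emeasure_cube(1), auto)
qed

lemma measure_tcube: "measure lebesgue (tcube k m :: (real ^ 'n) set) = (3 * 2 powr real_of_int k) ^ CARD('n)"
  by (simp add: measure_def emeasure_tcube)

lemma scale_tcube: "scale (tcube k m :: (real ^ 'n) set) = k"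
proof -
  have "log 2 ((3 * 2 powr real_of_int k) ^ CARD('n)) / real CARD('n) - log 2 3 = real_of_int k"
    by (simp add: log_nat_power log_mult field_simps)
  then show ?thesis by (simp add: scale_def measure_tcube)
qed

lemma tcube_parent:
  assumes "admissible c k m"
  shows "\<exists>m'. admissible c (k + 1) m' \<and> tcube k m \<subseteq> tcube (k + 1) m'"
proof -
  \<comment> \<open>Inclusion requires \<open>2 * m' i\<close> between m i - 3 and m i, and exactly
    one of these two ends is even. Modulo 3 both agree with m i, so m' i is congruent to - m i,
    which matches the alternating sign in \<open>admissible\<close>.\<close>
  define m' where "m' i = (if even (m i) then m i div 2 else (m i - 3) div 2)" for i
  have two: "2 * m' i = m i \<or> 2 * m' i = m i - 3" for i
    by (auto simp: m'_def)
  have "3 dvd (m' i - (if even (k + 1) then c i else - c i))" for i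
    using assms[unfolded admissible_def, rule_format, of i] two[of i]
    by (cases "even k") (simp_all, presburger+)
  then have adm: "admissible c (k + 1) m'" by (auto simp: admissible_def)
  have "tcube k m \<subseteq> tcube (k + 1) m'"
  proof
    fix x assume x: "x \<in> tcube k m"
    have "2 powr real_of_int (k + 1) * real_of_int (m' i) \<le> x $ i
      \<and> x $ i < 2 powr real_of_int (k + 1) * real_of_int (m' i + 3)" for i
    proof -
      let ?s = "2 powr real_of_int k"
      have e: "2 powr real_of_int (k + 1) * real_of_int j = ?s * real_of_int (2 * j)" for j
        by (simp add: powr_add)
      have "?s * real_of_int (2 * m' i) \<le> ?s * real_of_int (m i)"
        using two[of i] by (intro mult_left_mono) auto
      moreover have "?s * real_of_int (m i + 3) \<le> ?s * real_of_int (2 * (m' i + 3))"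
        using two[of i] by (intro mult_left_mono) auto
      moreover have "?s * real_of_int (m i) \<le> x $ i" "x $ i < ?s * real_of_int (m i + 3)"
        using x by (auto simp: tcube_def)
      ultimately show ?thesis unfolding e by linarith
    qed
    then show "x \<in> tcube (k + 1) m'" by (auto simp: tcube_def)
  qed
  with adm show ?thesis by blast
qed

lemma tcube_ancestor:
  assumes "admissible c k m"
  shows "\<exists>m'. admissible c (k + int d) m' \<and> tcube k m \<subseteq> tcube (k + int d) m'"
proof (induction d)
  case 0
  then show ?case using assms by auto
next
  case (Suc d)
  then obtain m' where m': "admissible c (k + int d) m'" "tcube k m \<subseteq> tcube (k + int d) m'" by blast
  obtain m'' where "admissible c (k + int d + 1) m''" "tcube (k + int d) m' \<subseteq> tcube (k + int d + 1) m''"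
    using tcube_parent[OF m'(1)] by blast
  then show ?case using m'(2) by (intro exI[of _ m'']) (auto simp: algebra_simps)
qed

text \<open>Two half-open intervals of length 3 that meet have left ends less than 3 apart; ends
  congruent modulo 3 then coincide.\<close>

lemma tcube_eq:
  assumes "admissible c k m" "admissible c k m'" "x \<in> tcube k m" "x \<in> tcube k m'"
  shows "m = m'"
proof
  fix i
  let ?s = "2 powr real_of_int k"
  have "?s * real_of_int (m i) \<le> x $ i" "x $ i < ?s * real_of_int (m i + 3)"
    "?s * real_of_int (m' i) \<le> x $ i" "x $ i < ?s * real_of_int (m' i + 3)"
    using assms(3,4) by (auto simp: tcube_def)
  then have "?s * real_of_int (m i) < ?s * real_of_int (m' i + 3)" "?s * real_of_int (m' i) < ?s * real_of_int (m i + 3)"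
    by linarith+
  then have "real_of_int (m i) < real_of_int (m' i + 3)" "real_of_int (m' i) < real_of_int (m i + 3)"
    by (simp_all only: mult_less_cancel_left_pos powr_gt_zero zero_less_numeral
        mult_less_cancel_left_disj) auto
  then have "m i < m' i + 3" "m' i < m i + 3" by linarith+
  moreover have "3 dvd (m i - m' i)"
    using dvd_diff[OF assms(1)[unfolded admissible_def, rule_format, of i] assms(2)[unfolded admissible_def, rule_format, of i]]
    by simp
  ultimately show "m i = m' i" by presburger
qed

lemma nested_grid: "nested_grid lebesgue (grid c :: (real ^ 'n) set set) scale (2 ^ CARD('n)) (3 ^ CARD('n))"
proof
  show "countable (grid c :: (real ^ 'n) set set)" by (rule countable_grid)
  show "1 < (2 :: real) ^ CARD('n)" by simp
  fix Q :: "(real ^ 'n) set" assume Q: "Q \<in> grid c"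
  then show "Q \<in> sets lebesgue" by (auto simp: grid_def)
  obtain k m where Qk: "Q = tcube k m" "admissible c k m" using Q by (auto simp: grid_def)
  show "emeasure lebesgue Q = ennreal (3 ^ CARD('n) * (2 ^ CARD('n)) powr real_of_int (scale Q))"
    by (simp add: Qk scale_tcube emeasure_tcube power_mult_distrib powr_realpow[symmetric] powr_powr mult.commute)
  fix P :: "(real ^ 'n) set" assume P: "P \<in> grid c" "Q \<inter> P \<noteq> {}" "scale Q \<le> scale P"
  obtain l m' where Pl: "P = tcube l m'" "admissible c l m'" using P by (auto simp: grid_def)
  obtain x where x: "x \<in> Q" "x \<in> P" using P by blast
  have "k \<le> l" using P Qk Pl by (simp add: scale_tcube)
  \<comment> \<open>The ancestor of Q at the scale of P meets P and is therefore P.\<close>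
  then obtain m'' where "admissible c l m''" "Q \<subseteq> tcube l m''"
    using tcube_ancestor[OF Qk(2), of "nat (l - k)"] Qk by auto
  then show "Q \<subseteq> P" using tcube_eq[of c l m'' m' x] Pl x by auto
qed simp

text \<open>Take k with \<open>2 powr (k - 1) < norm (x - y) \<le> 2 powr k\<close> and the triple
  of the dyadic cube containing x: y is at most one side length away in each coordinate. The 6
  arises because the side \<open>3 * 2 powr k\<close> is less than
  \<open>6 * norm (x - y)\<close>.\<close>

lemma kernel_le_cube:
  fixes x y :: "real ^ 'n"
  assumes "\<alpha> < real CARD('n)" "x \<noteq> y"
  shows "\<exists>c\<in>shifts. \<exists>Q\<in>grid c. x \<in> Q \<and> y \<in> Q \<and>
    riesz_kernel \<alpha> x y \<le> 6 powr (real CARD('n) - \<alpha>) * measure lebesgue Q powr (\<alpha> / real CARD('n) - 1)"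
proof -
  let ?n = "real CARD('n)"
  define k where "k = \<lceil>log 2 (norm (x - y))\<rceil>"
  have nz: "0 < norm (x - y)" using assms by simp
  have up: "norm (x - y) \<le> 2 powr real_of_int k"
    unfolding k_def using nz by (intro log_le_iff[THEN iffD1] le_of_int_ceiling) auto
  have lo: "2 powr (real_of_int k - 1) < norm (x - y)"
    using nz of_int_ceiling_le_add_one[of "log 2 (norm (x - y))"] ceiling_correct[of "log 2 (norm (x - y))"]
    by (simp add: k_def less_log_iff)
  \<comment> \<open>The \<open>- 1\<close> puts x into the middle third. The residue vector c is
    then read off m, with the sign prescribed for scale k.\<close>
  define m where "m i = \<lfloor>x $ i / 2 powr real_of_int k\<rfloor> - 1" for i
  define c where "c i = (if even k then m i else - m i) mod 3" for i
  have c: "c \<in> shifts" by (auto simp: shifts_def c_def)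
  have adm: "admissible c k m" by (auto simp: admissible_def c_def) presburger+
  have xy: "x \<in> tcube k m" "y \<in> tcube k m"
  proof -
    let ?s = "2 powr real_of_int k"
    have s: "0 < ?s" by simp
    have b: "?s * real_of_int (m i + 1) \<le> x $ i" "x $ i < ?s * real_of_int (m i + 2)" for i
    proof -
      have "real_of_int (m i + 1) \<le> x $ i / ?s" "x $ i / ?s < real_of_int (m i + 2)"
        by (simp_all add: m_def) linarith
      then show "?s * real_of_int (m i + 1) \<le> x $ i" "x $ i < ?s * real_of_int (m i + 2)"
        using s by (simp_all add: pos_le_divide_eq pos_divide_less_eq mult.commute)
    qed
    have d: "\<bar>x $ i - y $ i\<bar> \<le> ?s" for i
      using component_le_norm_cart[of "x - y" i] up by simp
    have "?s * real_of_int (m i) \<le> x $ i \<and> x $ i < ?s * real_of_int (m i + 3) \<and>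
       ?s * real_of_int (m i) \<le> y $ i \<and> y $ i < ?s * real_of_int (m i + 3)" for i
      using b[of i] d[of i] s by (auto simp: algebra_simps)
    then show "x \<in> tcube k m" "y \<in> tcube k m" by (auto simp: tcube_def)
  qed
  have "riesz_kernel \<alpha> x y = norm (x - y) powr - (?n - \<alpha>)"
    unfolding riesz_kernel_def by (simp only: powr_minus inverse_eq_divide)
  also have "\<dots> \<le> (2 powr (real_of_int k - 1)) powr - (?n - \<alpha>)"
    using lo assms by (intro powr_mono2') auto
  also have "\<dots> = 6 powr (?n - \<alpha>) * (3 * 2 powr real_of_int k) powr - (?n - \<alpha>)"
  proof -
    have "(2 :: real) powr (real_of_int k - 1) = (1 / 6) * (3 * 2 powr real_of_int k)" by (simp add: powr_diff)
    moreover have "(1 / 6 :: real) powr - (?n - \<alpha>) = 6 powr (?n - \<alpha>)"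
      by (simp only: powr_minus powr_divide) simp
    ultimately show ?thesis by (simp only: powr_mult)
  qed
  also have "(3 * 2 powr real_of_int k) powr - (?n - \<alpha>)
     = measure lebesgue (tcube k m :: (real ^ 'n) set) powr (\<alpha> / ?n - 1)"
  proof -
    have "measure lebesgue (tcube k m :: (real ^ 'n) set) = (3 * 2 powr real_of_int k) powr ?n"
      by (subst measure_tcube, subst powr_realpow) auto
    then show ?thesis by (simp only: powr_powr) (simp add: algebra_simps)
  qed
  finally show ?thesis
    using c adm xy by (intro bexI[of _ c] bexI[of _ "tcube k m"]) (auto simp: grid_def)
qed

section \<open>Domination of the Riesz potential by dyadic sums\<close>

definition dyadic_riesz :: "real \<Rightarrow> (real ^ 'n \<Rightarrow> real) \<Rightarrow> real ^ 'n \<Rightarrow> ennreal" where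
  "dyadic_riesz \<alpha> g x = (\<Sum>c\<in>shifts. \<integral>\<^sup>+Q. ennreal (measure lebesgue Q powr (\<alpha> / real CARD('n) - 1))
      * (\<integral>\<^sup>+y\<in>Q. ennreal (g y) \<partial>lebesgue) * indicator Q x \<partial>count_space (grid c))"

lemma grid_sets: "Q \<in> grid c \<Longrightarrow> Q \<in> sets lebesgue"
  by (auto simp: grid_def)

lemma riesz_le_dyadic:
  fixes x :: "real ^ 'n"
  assumes \<alpha>: "\<alpha> < real CARD('n)" and [measurable]: "g \<in> borel_measurable lebesgue" and g: "\<And>y. 0 \<le> g y"
  shows "(\<integral>\<^sup>+y. ennreal (g y * riesz_kernel \<alpha> x y) \<partial>lebesgue)
     \<le> ennreal (6 powr (real CARD('n) - \<alpha>)) * dyadic_riesz \<alpha> g x"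
proof -
  let ?C = "ennreal (6 powr (real CARD('n) - \<alpha>))"
  let ?w = "\<lambda>Q :: (real ^ 'n) set. ennreal (measure lebesgue Q powr (\<alpha> / real CARD('n) - 1)) * indicator Q x"
  have [measurable]: "Q \<in> sets lebesgue" if "Q \<in> grid c" for c and Q :: "(real ^ 'n) set"
    using that by (rule grid_sets)
  have point: "ennreal (g y * riesz_kernel \<alpha> x y)
     \<le> ?C * (\<Sum>c\<in>shifts. \<integral>\<^sup>+Q. ?w Q * (ennreal (g y) * indicator Q y) \<partial>count_space (grid c))" for y
  proof (cases "x = y")
    case True
    then show ?thesis by (simp add: riesz_kernel_def)
  next
    case False
    obtain c and Q :: "(real ^ 'n) set" where c: "c \<in> shifts" "Q \<in> grid c" "x \<in> Q" "y \<in> Q"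
      and le: "riesz_kernel \<alpha> x y \<le> 6 powr (real CARD('n) - \<alpha>) * measure lebesgue Q powr (\<alpha> / real CARD('n) - 1)"
      using kernel_le_cube[OF \<alpha> False] by blast
    have "ennreal (g y * riesz_kernel \<alpha> x y)
       \<le> ennreal (g y * (6 powr (real CARD('n) - \<alpha>) * measure lebesgue Q powr (\<alpha> / real CARD('n) - 1)))"
      using le g by (intro ennreal_leI mult_left_mono) auto
    also have "\<dots> = ?C * (?w Q * (ennreal (g y) * indicator Q y))"
      using c g by (simp add: ennreal_mult mult_ac)
    also have "\<dots> \<le> ?C * (\<integral>\<^sup>+Q. ?w Q * (ennreal (g y) * indicator Q y) \<partial>count_space (grid c))"
      using c by (intro mult_left_mono nn_integral_ge_point) auto
    also have "\<dots> \<le> ?C * (\<Sum>c\<in>shifts. \<integral>\<^sup>+Q. ?w Q * (ennreal (g y) * indicator Q y) \<partial>count_space (grid c))"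
      using c finite_shifts by (intro mult_left_mono member_le_sum) auto
    finally show ?thesis .
  qed
  have meas: "(\<lambda>y. \<integral>\<^sup>+Q. ?w Q * (ennreal (g y) * indicator Q y) \<partial>count_space (grid c)) \<in> borel_measurable lebesgue" for c
    by (intro borel_measurable_nn_integral_count_space countable_grid) auto
  have "(\<integral>\<^sup>+y. ennreal (g y * riesz_kernel \<alpha> x y) \<partial>lebesgue)
     \<le> (\<integral>\<^sup>+y. ?C * (\<Sum>c\<in>shifts. \<integral>\<^sup>+Q. ?w Q * (ennreal (g y) * indicator Q y) \<partial>count_space (grid c)) \<partial>lebesgue)"
    by (intro nn_integral_mono point)
  also have "\<dots> = ?C * (\<Sum>c\<in>shifts. \<integral>\<^sup>+y. \<integral>\<^sup>+Q. ?w Q * (ennreal (g y) * indicator Q y) \<partial>count_space (grid c) \<partial>lebesgue)"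
    using meas by (simp add: nn_integral_cmult nn_integral_sum)
  also have "(\<Sum>c\<in>shifts. \<integral>\<^sup>+y. \<integral>\<^sup>+Q. ?w Q * (ennreal (g y) * indicator Q y) \<partial>count_space (grid c) \<partial>lebesgue)
     = dyadic_riesz \<alpha> g x"
    unfolding dyadic_riesz_def
  proof (rule sum.cong[OF refl])
    fix c :: "'n \<Rightarrow> int"
    have "(\<integral>\<^sup>+y. \<integral>\<^sup>+Q. ?w Q * (ennreal (g y) * indicator Q y) \<partial>count_space (grid c) \<partial>lebesgue)
       = (\<integral>\<^sup>+Q. \<integral>\<^sup>+y. ?w Q * (ennreal (g y) * indicator Q y) \<partial>lebesgue \<partial>count_space (grid c))"
      by (intro nn_integral_count_space_nn_integral countable_grid) auto
    also have "\<dots> = (\<integral>\<^sup>+Q. ennreal (measure lebesgue Q powr (\<alpha> / real CARD('n) - 1))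
      * (\<integral>\<^sup>+y\<in>Q. ennreal (g y) \<partial>lebesgue) * indicator Q x \<partial>count_space (grid c))"
      by (intro nn_integral_cong, subst nn_integral_cmult) (simp_all add: mult_ac)
    finally show "(\<integral>\<^sup>+y. \<integral>\<^sup>+Q. ?w Q * (ennreal (g y) * indicator Q y) \<partial>count_space (grid c) \<partial>lebesgue) = \<dots>" .
  qed
  finally show ?thesis .
qed

section \<open>The weights\<close>

lemma grid_sum_measurable:
  "(\<lambda>x. \<integral>\<^sup>+Q. h Q * indicator Q x \<partial>count_space (grid c)) \<in> borel_measurable lebesgue"
proof (intro borel_measurable_nn_integral_count_space countable_grid)
  fix Q :: "(real ^ 'a) set" assume "Q \<in> grid c"
  then have [measurable]: "Q \<in> sets lebesgue" by (rule grid_sets)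
  show "(\<lambda>x. h Q * indicator Q x) \<in> borel_measurable lebesgue" by measurable
qed

text \<open>A weight is given as integrable on compact sets only; global measurability comes from
  exhausting the space by balls.\<close>

lemma weight_measurable:
  fixes w :: "real ^ 'n \<Rightarrow> real"
  assumes "weight w"
  shows "w \<in> borel_measurable lebesgue"
proof (rule borel_measurable_LIMSEQ_metric)
  fix n :: nat
  show "(\<lambda>x. indicator (cball 0 (real n)) x *\<^sub>R w x) \<in> borel_measurable lebesgue"
    using assms by (auto simp: weight_def set_integrable_def dest!: spec[of _ "cball 0 (real n)"])
next
  fix x :: "real ^ 'n"
  obtain N :: nat where N: "norm x \<le> real N" using real_arch_simple by blast
  have "\<forall>\<^sub>F n in sequentially. indicator (cball 0 (real n)) x *\<^sub>R w x = w x"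
    using eventually_ge_at_top[of N] by eventually_elim (use N in auto)
  then show "(\<lambda>n. indicator (cball 0 (real n)) x *\<^sub>R w x) \<longlonglongrightarrow> w x"
    by (rule tendsto_eventually)
qed

lemma weight_nonneg: "weight w \<Longrightarrow> 0 \<le> w x"
  by (simp add: weight_def)

lemma weight_finite:
  fixes w :: "real ^ 'n \<Rightarrow> real"
  assumes "weight w" "bounded S"
  shows "(\<integral>\<^sup>+x\<in>S. ennreal (w x) \<partial>lebesgue) < \<infinity>"
proof -
  obtain r where r: "S \<subseteq> cball 0 r" using assms(2)
    by (auto simp: bounded_iff subset_iff)
  have "integrable lebesgue (\<lambda>x. indicator (cball 0 r) x *\<^sub>R w x)"
    using assms(1) by (auto simp: weight_def set_integrable_def)
  then have fin: "(\<integral>\<^sup>+x. ennreal (norm (indicator (cball 0 r) x *\<^sub>R w x)) \<partial>lebesgue) < \<infinity>"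
    by (simp add: integrable_iff_bounded)
  have "(\<integral>\<^sup>+x\<in>S. ennreal (w x) \<partial>lebesgue) \<le> (\<integral>\<^sup>+x. ennreal (norm (indicator (cball 0 r) x *\<^sub>R w x)) \<partial>lebesgue)"
    using r by (intro nn_integral_mono) (auto split: split_indicator intro: ennreal_leI)
  with fin show ?thesis by (rule le_less_trans[rotated])
qed

lemma bounded_tcube: "bounded (tcube k m)"
  using bounded_subset[OF bounded_cbox tcube_subset] .

text \<open>With r the local norm of the \<sigma> factor, the hypothesis puts the Luxemburg norm
  strictly below \<open>(S + 1) / (m powr \<gamma> * r)\<close>, so some admissible l lies below
  that number, and w is \<open>l powr q\<close>. The extra 1 buys the strict inequality, since the
  infimum need not be attained.\<close>

lemma bump_at_cube:
  fixes u \<sigma> :: "real ^ 'n \<Rightarrow> real"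
  assumes u: "weight u" and \<sigma>: "weight \<sigma>" and p: "1 < p" and q: "1 < q" and S: "0 \<le> S"
    and Q: "Q \<in> sets lebesgue" "emeasure lebesgue Q = ennreal m" "0 < m" "bounded Q"
    and pos: "0 < mass lebesgue \<sigma> Q"
    and bound: "ennreal (measure lebesgue Q powr \<gamma>) * luxemburg_norm (log_bump q \<delta>) Q (\<lambda>x. u x powr (1 / q))
            * local_norm (conj_exp p) Q (\<lambda>x. \<sigma> x powr (1 / conj_exp p)) \<le> ennreal S"
  obtains w where "0 < w"
    "(\<integral>\<^sup>+x\<in>Q. ennreal (u x * ln (exp 1 + (u x / w) powr (1 / q)) powr (q - 1 + \<delta>)) \<partial>lebesgue) \<le> ennreal (w * m)"
    "m powr \<gamma> * w powr (1 / q) * (mass lebesgue \<sigma> Q / m) powr (1 - 1 / p) \<le> S + 1"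
proof -
  note [measurable] = Q(1) weight_measurable[OF u] weight_measurable[OF \<sigma>]
  have mQ: "measure lebesgue Q = m" using Q by (simp add: measure_def)
  define r where "r = (mass lebesgue \<sigma> Q / m) powr (1 - 1 / p)"
  have r: "0 < r" using pos Q by (simp add: r_def)
  have cp: "1 / conj_exp p = 1 - 1 / p" "0 < conj_exp p"
    using p by (auto simp: conj_exp_def field_simps)
  have "local_norm (conj_exp p) Q (\<lambda>x. \<sigma> x powr (1 / conj_exp p)) = ennreal r"
  proof -
    have "average Q (\<lambda>x. \<bar>\<sigma> x powr (1 / conj_exp p)\<bar> powr conj_exp p) = average Q \<sigma>"
    proof -
      have "\<bar>\<sigma> x powr (1 / conj_exp p)\<bar> powr conj_exp p = \<sigma> x" for x
        using weight_nonneg[OF \<sigma>, of x] cp(2) by (simp add: powr_powr)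
      then show ?thesis by simp
    qed
    also have "\<dots> = ennreal (mass lebesgue \<sigma> Q / m)"
      unfolding average_def ennreal_mass[OF weight_finite[OF \<sigma> Q(4)], symmetric] Q(2)
      using Q by (simp add: divide_ennreal)
    finally show ?thesis
      unfolding local_norm_def enn_powr_def cp(1) r_def using Q by simp
  qed
  then have b: "ennreal (m powr \<gamma>) * luxemburg_norm (log_bump q \<delta>) Q (\<lambda>x. u x powr (1 / q)) * ennreal r \<le> ennreal S"
    using bound mQ by simp
  have "luxemburg_norm (log_bump q \<delta>) Q (\<lambda>x. u x powr (1 / q)) < ennreal ((S + 1) / (m powr \<gamma> * r))"
  proof (rule ccontr)
    assume "\<not> ?thesis"
    then have "ennreal (m powr \<gamma>) * ennreal ((S + 1) / (m powr \<gamma> * r)) * ennreal r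
       \<le> ennreal (m powr \<gamma>) * luxemburg_norm (log_bump q \<delta>) Q (\<lambda>x. u x powr (1 / q)) * ennreal r"
      by (intro mult_right_mono mult_left_mono) auto
    also note b
    also have "ennreal (m powr \<gamma>) * ennreal ((S + 1) / (m powr \<gamma> * r)) * ennreal r
        = ennreal (m powr \<gamma> * ((S + 1) / (m powr \<gamma> * r)) * r)"
      using r Q S by (simp add: ennreal_mult[symmetric])
    also have "m powr \<gamma> * ((S + 1) / (m powr \<gamma> * r)) * r = S + 1"
      using r Q by simp
    finally show False using S by (simp add: ennreal_le_iff)
  qed
  then obtain l where l: "0 < l" "average Q (\<lambda>x. log_bump q \<delta> (\<bar>u x powr (1 / q)\<bar> / l)) \<le> 1"
    "ennreal l < ennreal ((S + 1) / (m powr \<gamma> * r))"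
    unfolding luxemburg_norm_def Inf_less_iff by blast
  define w where "w = l powr q"
  have w: "0 < w" "w powr (1 / q) = l" using l q by (auto simp: w_def powr_powr)
  have lb: "log_bump q \<delta> (\<bar>u x powr (1 / q)\<bar> / l) = u x * ln (exp 1 + (u x / w) powr (1 / q)) powr (q - 1 + \<delta>) / w" for x
  proof -
    have e: "\<bar>u x powr (1 / q)\<bar> / l = (u x / w) powr (1 / q)"
      using weight_nonneg[OF u, of x] w by (simp add: powr_divide)
    have "((u x / w) powr (1 / q)) powr q = u x / w"
      using weight_nonneg[OF u, of x] w q by (simp add: powr_powr)
    then show ?thesis unfolding e log_bump_def by simp
  qed
  define X where "X = (\<integral>\<^sup>+x\<in>Q. ennreal (log_bump q \<delta> (\<bar>u x powr (1 / q)\<bar> / l)) \<partial>lebesgue)"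
  have "X / ennreal m \<le> 1" using l(2) by (simp add: average_def X_def Q)
  then have X: "X \<le> ennreal m"
    using Q by (cases X) (auto simp: divide_ennreal ennreal_top_divide top_unique simp flip: ennreal_1)
  have "(\<integral>\<^sup>+x\<in>Q. ennreal (u x * ln (exp 1 + (u x / w) powr (1 / q)) powr (q - 1 + \<delta>)) \<partial>lebesgue)
     = (\<integral>\<^sup>+x. ennreal w * (ennreal (log_bump q \<delta> (\<bar>u x powr (1 / q)\<bar> / l)) * indicator Q x) \<partial>lebesgue)"
    unfolding lb using w weight_nonneg[OF u]
    by (intro nn_integral_cong) (auto simp: ennreal_mult[symmetric] split: split_indicator)
  also have "\<dots> = ennreal w * X"
    unfolding X_def lb by (intro nn_integral_cmult) measurable
  also have "\<dots> \<le> ennreal w * ennreal m" by (intro mult_left_mono X) simp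
  also have "\<dots> = ennreal (w * m)" using w Q by (simp add: ennreal_mult)
  finally have 1: "(\<integral>\<^sup>+x\<in>Q. ennreal (u x * ln (exp 1 + (u x / w) powr (1 / q)) powr (q - 1 + \<delta>)) \<partial>lebesgue) \<le> ennreal (w * m)" .
  have "l < (S + 1) / (m powr \<gamma> * r)" using l(1,3) by (simp add: ennreal_less_iff)
  then have "m powr \<gamma> * l * r \<le> S + 1" using r Q by (simp add: field_simps)
  then show ?thesis using that[OF w(1) 1] by (simp add: w r_def)
qed

text \<open>The constant precedes f and E: it is built from the exponents, the dimension and the
  two-weight supremum, while E enters through v = u restricted to E and V = u(E). Boundedness of E
  keeps V finite.\<close>

lemma dyadic_riesz_restricted:
  fixes u \<sigma> :: "real ^ 'n \<Rightarrow> real"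
  assumes \<alpha>: "0 < \<alpha>" "\<alpha> < real CARD('n)" and pq: "1 < p" "p < q" and \<delta>: "0 < \<delta>"
    and u: "weight u" and \<sigma>: "weight \<sigma>"
    and sup: "(SUP Q\<in>(cubes :: (real ^ 'n) set set).
            ennreal (measure lebesgue Q powr (\<alpha> / real CARD('n) + 1 / q - 1 / p))
            * luxemburg_norm (log_bump q \<delta>) Q (\<lambda>x. u x powr (1 / q))
            * local_norm (conj_exp p) Q (\<lambda>x. \<sigma> x powr (1 / conj_exp p))) < \<infinity>"
  shows "\<exists>C\<ge>0. \<forall>f E. f \<in> borel_measurable lebesgue \<longrightarrow> (\<forall>y. 0 \<le> f y) \<longrightarrow>
      (\<integral>\<^sup>+y. ennreal (f y powr p * \<sigma> y) \<partial>lebesgue) \<le> 1 \<longrightarrow> E \<in> sets lebesgue \<longrightarrow> bounded E \<longrightarrow>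
      (\<integral>\<^sup>+x\<in>E. dyadic_riesz \<alpha> (\<lambda>y. f y * \<sigma> y) x * ennreal (u x) \<partial>lebesgue)
        \<le> ennreal (C * mass lebesgue u E powr (1 - 1 / q))"
proof -
  let ?n = "real CARD('n)"
  define a where "a = \<alpha> / ?n"
  define \<theta> where "\<theta> = q - 1 + \<delta>"
  have a: "0 < a" "a < 1" using \<alpha> by (auto simp: a_def)
  have q: "1 < q" using pq by simp
  note [measurable] = weight_measurable[OF u] weight_measurable[OF \<sigma>]
  obtain S where S: "0 \<le> S" and le: "\<And>Q. Q \<in> (cubes :: (real ^ 'n) set set) \<Longrightarrow>
      ennreal (measure lebesgue Q powr (a + 1 / q - 1 / p))
            * luxemburg_norm (log_bump q \<delta>) Q (\<lambda>x. u x powr (1 / q))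
            * local_norm (conj_exp p) Q (\<lambda>x. \<sigma> x powr (1 / conj_exp p)) \<le> ennreal S"
  proof -
    let ?F = "\<lambda>Q. ennreal (measure lebesgue Q powr (a + 1 / q - 1 / p))
            * luxemburg_norm (log_bump q \<delta>) Q (\<lambda>x. u x powr (1 / q))
            * local_norm (conj_exp p) Q (\<lambda>x. \<sigma> x powr (1 / conj_exp p))"
    define s where "s = (SUP Q\<in>(cubes :: (real ^ 'n) set set). ?F Q)"
    have "s < \<infinity>" using sup by (simp add: s_def a_def)
    then have "s = ennreal (enn2real s)" by simp
    moreover have "?F Q \<le> s" if "Q \<in> cubes" for Q
      unfolding s_def using that by (rule SUP_upper)
    ultimately show ?thesis using that[of "enn2real s"] by simp
  qed
  define K where "K = S + 1"
  have K: "0 < K" using S by (simp add: K_def)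
  define ok where "ok Q w \<longleftrightarrow> 0 < w \<and>
     (\<integral>\<^sup>+x\<in>Q. ennreal (u x * ln (exp 1 + (u x / w) powr (1 / q)) powr \<theta>) \<partial>lebesgue) \<le> ennreal (w * measure lebesgue Q) \<and>
     measure lebesgue Q powr (a + 1 / q - 1 / p) * w powr (1 / q) * (mass lebesgue \<sigma> Q / measure lebesgue Q) powr (1 - 1 / p) \<le> K"
    for Q :: "(real ^ 'n) set" and w
  \<comment> \<open>The hypothesis speaks of closed cubes, the grid consists of half-open ones. The
    closed cube R contains Q and has the same volume, so both conditions pass from R to Q.\<close>
  have ok: "\<exists>w. ok Q w" if Q: "Q \<in> grid c" "0 < mass lebesgue \<sigma> Q" for c and Q :: "(real ^ 'n) set"
  proof -
    obtain k m where Qk: "Q = tcube k m" using Q by (auto simp: grid_def)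
    define R where "R = cbox (corner k m) (\<chi> i. corner k m $ i + 3 * 2 powr real_of_int k)"
    let ?m = "(3 * 2 powr real_of_int k) ^ CARD('n)"
    have QR: "Q \<subseteq> R" and R: "R \<in> cubes" unfolding Qk R_def by (rule tcube_subset, rule closed_tcube_cubes)
    have emR: "emeasure lebesgue R = ennreal ?m" "measure lebesgue Q = ?m" "measure lebesgue R = ?m"
      unfolding R_def Qk measure_def emeasure_tcube by (simp_all add: emeasure_cube del: emeasure_completion)
    have bR: "bounded R" by (simp add: R_def)
    have mono: "mass lebesgue \<sigma> Q \<le> mass lebesgue \<sigma> R"
    proof -
      have "ennreal (mass lebesgue \<sigma> Q) \<le> ennreal (mass lebesgue \<sigma> R)"
        unfolding ennreal_mass[OF weight_finite[OF \<sigma> bR]]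
          ennreal_mass[OF weight_finite[OF \<sigma> bounded_subset[OF bR QR]]]
        using QR by (intro nn_integral_mono) (auto split: split_indicator)
      then show ?thesis by simp
    qed
    obtain w where w: "0 < w"
      "(\<integral>\<^sup>+x\<in>R. ennreal (u x * ln (exp 1 + (u x / w) powr (1 / q)) powr (q - 1 + \<delta>)) \<partial>lebesgue) \<le> ennreal (w * ?m)"
      "?m powr (a + 1 / q - 1 / p) * w powr (1 / q) * (mass lebesgue \<sigma> R / ?m) powr (1 - 1 / p) \<le> S + 1"
      by (rule bump_at_cube[OF u \<sigma> pq(1) q S _ emR(1) _ bR _ le[OF R]]) (use Q mono in \<open>auto simp: R_def\<close>)
    have "(\<integral>\<^sup>+x\<in>Q. ennreal (u x * ln (exp 1 + (u x / w) powr (1 / q)) powr \<theta>) \<partial>lebesgue) \<le> ennreal (w * ?m)"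
      by (rule order_trans[OF _ w(2)])
        (use QR in \<open>auto simp: \<theta>_def intro!: nn_integral_mono split: split_indicator\<close>)
    moreover have "?m powr (a + 1 / q - 1 / p) * w powr (1 / q) * (mass lebesgue \<sigma> Q / ?m) powr (1 - 1 / p)
       \<le> ?m powr (a + 1 / q - 1 / p) * w powr (1 / q) * (mass lebesgue \<sigma> R / ?m) powr (1 - 1 / p)"
      using mono pq by (intro mult_left_mono powr_mono2 divide_right_mono) auto
    ultimately have "ok Q w" using w(1,3) unfolding ok_def K_def emR by (meson order_trans)
    then show ?thesis by blast
  qed
  define w where "w Q = (SOME w. ok Q w)" for Q
  have w: "ok Q (w Q)" if "Q \<in> grid c" "0 < mass lebesgue \<sigma> Q" for c Q
    unfolding w_def using ok[OF that] by (rule someI_ex)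
  \<comment> \<open>Positivity of \<epsilon> gives \<beta> < a; the bound by a keeps \<beta>
    nonnegative, and the other bound is exactly
    \<open>0 \<le> 1 - 1 / q - a + \<beta> / q\<close>.\<close>
  define \<epsilon> where "\<epsilon> = min a ((1 - a) * (q - 1))"
  define \<beta> where "\<beta> = a - \<epsilon>"
  have \<beta>: "0 \<le> \<beta>" "\<beta> < a" using a q by (auto simp: \<beta>_def \<epsilon>_def)
  have \<beta>2: "0 \<le> 1 - 1 / q - a + \<beta> / q"
  proof -
    have "\<epsilon> \<le> (1 - a) * (q - 1)" by (simp add: \<epsilon>_def)
    then have "0 \<le> ((1 - a) * (q - 1) - \<epsilon>) / q" using q by simp
    also have "\<dots> = 1 - 1 / q - a + \<beta> / q" using q by (simp add: \<beta>_def field_simps)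
    finally show ?thesis .
  qed
  \<comment> \<open>One summand for each grid; the absolute value makes C nonnegative at
    once.\<close>
  define C where "C = real (card (shifts :: ('n \<Rightarrow> int) set)) * \<bar>dyadic_const (2 ^ CARD('n)) a \<beta> p q \<theta> K\<bar>"
  have main: "(\<integral>\<^sup>+x\<in>E. dyadic_riesz \<alpha> (\<lambda>y. f y * \<sigma> y) x * ennreal (u x) \<partial>lebesgue)
        \<le> ennreal (C * mass lebesgue u E powr (1 - 1 / q))"
    if f: "f \<in> borel_measurable lebesgue" "\<And>y. 0 \<le> f y" "(\<integral>\<^sup>+y. ennreal (f y powr p * \<sigma> y) \<partial>lebesgue) \<le> 1"
      and E: "E \<in> sets lebesgue" "bounded E" for f E
  proof -
    note [measurable] = f(1) E(1)
    define V where "V = mass lebesgue u E"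
    have V: "ennreal V = (\<integral>\<^sup>+x\<in>E. ennreal (u x) \<partial>lebesgue)"
      unfolding V_def by (intro ennreal_mass weight_finite u E)
    show ?thesis
    \<comment> \<open>\<open>mass_grid\<close> requires positive total mass; for u(E) = 0 both sides
      vanish.\<close>
    proof (cases "V = 0")
      case True
      then have "AE x in lebesgue. ennreal (u x) * indicator E x = 0"
        using V by (subst (asm) eq_commute) (simp add: nn_integral_0_iff_AE)
      then have "AE x in lebesgue. dyadic_riesz \<alpha> (\<lambda>y. f y * \<sigma> y) x * ennreal (u x) * indicator E x = 0"
        by eventually_elim (auto split: split_indicator_asm)
      then have "(\<integral>\<^sup>+x\<in>E. dyadic_riesz \<alpha> (\<lambda>y. f y * \<sigma> y) x * ennreal (u x) \<partial>lebesgue) = (\<integral>\<^sup>+x. 0 \<partial>(lebesgue :: (real ^ 'n) measure))"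
        by (rule nn_integral_cong_AE)
      then show ?thesis by simp
    next
      case False
      then have Vpos: "0 < V" by (simp add: V_def less_le)
      define v where "v x = u x * indicator E x" for x
      have [measurable]: "v \<in> borel_measurable lebesgue" unfolding v_def by measurable
      have v0: "0 \<le> v x" and vu: "v x \<le> u x" for x
        using weight_nonneg[OF u, of x] by (auto simp: v_def split: split_indicator)
      have v_total: "(\<integral>\<^sup>+x. ennreal (v x) \<partial>lebesgue) = ennreal V"
        unfolding V v_def by (intro nn_integral_cong) (auto split: split_indicator)
      let ?B = "ennreal (\<bar>dyadic_const (2 ^ CARD('n)) a \<beta> p q \<theta> K\<bar> * V powr (1 - 1 / q))"
      let ?t = "\<lambda>Q. ennreal (measure lebesgue Q powr (a - 1)) * (\<integral>\<^sup>+y\<in>Q. ennreal (f y * \<sigma> y) \<partial>lebesgue)"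
      have gridle: "(\<integral>\<^sup>+x. (\<integral>\<^sup>+Q. ?t Q * indicator Q x \<partial>count_space (grid c)) * ennreal (v x) \<partial>lebesgue) \<le> ?B" for c
      proof -
        interpret G: nested_grid lebesgue "grid c :: (real ^ 'n) set set" scale "2 ^ CARD('n)" "3 ^ CARD('n)"
          by (rule nested_grid)
        \<comment> \<open>The integrand increases with the weight, so the bound for u passes to its
          restriction v.\<close>
        have bump: "(\<integral>\<^sup>+x\<in>Q. ennreal (v x * ln (exp 1 + (v x / w Q) powr (1 / q)) powr \<theta>) \<partial>lebesgue) \<le> ennreal (w Q * measure lebesgue Q)"
          if Q: "Q \<in> grid c" "0 < mass lebesgue \<sigma> Q" for Q
        proof -
          have wQ: "0 < w Q" using w[OF Q] by (simp add: ok_def)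
          have "v x * ln (exp 1 + (v x / w Q) powr (1 / q)) powr \<theta> \<le> u x * ln (exp 1 + (u x / w Q) powr (1 / q)) powr \<theta>" for x
          proof -
            have "(v x / w Q) powr (1 / q) \<le> (u x / w Q) powr (1 / q)"
              using v0 vu wQ q by (intro powr_mono2 divide_right_mono) auto
            moreover have "0 < exp 1 + z powr (1 / q)" for z :: real by (intro add_pos_nonneg) auto
            ultimately have "ln (exp 1 + (v x / w Q) powr (1 / q)) \<le> ln (exp 1 + (u x / w Q) powr (1 / q))"
              by (subst ln_le_cancel_iff) auto
            moreover have "0 \<le> ln (exp 1 + (v x / w Q) powr (1 / q))"
              by (intro ln_ge_zero) (auto intro: add_increasing2)
            ultimately show ?thesis
              using v0[of x] vu[of x] q \<delta> by (intro mult_mono powr_mono2) (auto simp: \<theta>_def)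
          qed
          then have "(\<integral>\<^sup>+x\<in>Q. ennreal (v x * ln (exp 1 + (v x / w Q) powr (1 / q)) powr \<theta>) \<partial>lebesgue)
             \<le> (\<integral>\<^sup>+x\<in>Q. ennreal (u x * ln (exp 1 + (u x / w Q) powr (1 / q)) powr \<theta>) \<partial>lebesgue)"
            by (intro nn_integral_mono mult_right_mono ennreal_leI) auto
          also have "\<dots> \<le> ennreal (w Q * measure lebesgue Q)" using w[OF Q] by (simp add: ok_def)
          finally show ?thesis .
        qed
        interpret B: bump_grid lebesgue "grid c :: (real ^ 'n) set set" scale "2 ^ CARD('n)" "3 ^ CARD('n)"
          v V \<beta> \<sigma> w p q a \<theta> K
        proof
          show "(\<integral>\<^sup>+x\<in>Q. ennreal (\<sigma> x) \<partial>lebesgue) < \<infinity>" if "Q \<in> grid c" for Q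
            using that by (intro weight_finite \<sigma>) (auto simp: grid_def bounded_tcube)
        qed (use v0 v_total Vpos \<beta> a weight_nonneg[OF \<sigma>] pq \<beta>2 \<delta> K bump w in \<open>auto simp: \<theta>_def ok_def\<close>)
        have [measurable]: "Q \<in> sets lebesgue" if "Q \<in> grid c" for Q :: "(real ^ 'n) set"
          using that by (rule grid_sets)
        have "(\<integral>\<^sup>+x. (\<integral>\<^sup>+Q. ?t Q * indicator Q x \<partial>count_space (grid c)) * ennreal (v x) \<partial>lebesgue)
           = (\<integral>\<^sup>+x. (\<integral>\<^sup>+Q. ?t Q * (ennreal (v x) * indicator Q x) \<partial>count_space (grid c)) \<partial>lebesgue)"
          by (intro nn_integral_cong, subst nn_integral_multc[symmetric])
            (auto simp: mult_ac intro!: nn_integral_cong)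
        also have "\<dots> = (\<integral>\<^sup>+Q. (\<integral>\<^sup>+x. ?t Q * (ennreal (v x) * indicator Q x) \<partial>lebesgue) \<partial>count_space (grid c))"
          by (intro nn_integral_count_space_nn_integral countable_grid) measurable
        also have "\<dots> = (\<integral>\<^sup>+Q. ennreal (measure lebesgue Q powr (a - 1) * mass lebesgue v Q)
            * (\<integral>\<^sup>+y\<in>Q. ennreal (f y * \<sigma> y) \<partial>lebesgue) \<partial>count_space (grid c))"
        proof (intro nn_integral_cong)
          fix Q :: "(real ^ 'n) set" assume "Q \<in> space (count_space (grid c))"
          then have [measurable]: "Q \<in> sets lebesgue" by simp
          have "(\<integral>\<^sup>+x. ?t Q * (ennreal (v x) * indicator Q x) \<partial>lebesgue) = ?t Q * ennreal (mass lebesgue v Q)"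
            unfolding B.ennreal_mass_v by (intro nn_integral_cmult) measurable
          then show "(\<integral>\<^sup>+x. ?t Q * (ennreal (v x) * indicator Q x) \<partial>lebesgue)
             = ennreal (measure lebesgue Q powr (a - 1) * mass lebesgue v Q) * (\<integral>\<^sup>+y\<in>Q. ennreal (f y * \<sigma> y) \<partial>lebesgue)"
            by (simp add: ennreal_mult mult_ac)
        qed
        also have "\<dots> \<le> ennreal (dyadic_const (2 ^ CARD('n)) a \<beta> p q \<theta> K * V powr (1 - 1 / q))"
          using f by (intro B.dyadic_bound) auto
        also have "\<dots> \<le> ?B" by (intro ennreal_leI mult_right_mono) auto
        finally show ?thesis .
      qed
      have meas: "(\<lambda>x. (\<integral>\<^sup>+Q. ?t Q * indicator Q x \<partial>count_space (grid c)) * ennreal (v x)) \<in> borel_measurable lebesgue" for c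
      proof -
        have [measurable]: "(\<lambda>x. \<integral>\<^sup>+Q. ?t Q * indicator Q x \<partial>count_space (grid c)) \<in> borel_measurable lebesgue"
          by (rule grid_sum_measurable)
        show ?thesis by measurable
      qed
      have "(\<integral>\<^sup>+x\<in>E. dyadic_riesz \<alpha> (\<lambda>y. f y * \<sigma> y) x * ennreal (u x) \<partial>lebesgue)
         = (\<integral>\<^sup>+x. (\<Sum>c\<in>shifts. (\<integral>\<^sup>+Q. ?t Q * indicator Q x \<partial>count_space (grid c)) * ennreal (v x)) \<partial>lebesgue)"
        unfolding dyadic_riesz_def a_def v_def
        by (intro nn_integral_cong) (auto simp: sum_distrib_right split: split_indicator)
      also have "\<dots> = (\<Sum>c\<in>shifts. \<integral>\<^sup>+x. (\<integral>\<^sup>+Q. ?t Q * indicator Q x \<partial>count_space (grid c)) * ennreal (v x) \<partial>lebesgue)"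
        by (intro nn_integral_sum meas)
      also have "\<dots> \<le> (\<Sum>c\<in>(shifts :: ('n \<Rightarrow> int) set). ?B)"
        by (intro sum_mono gridle)
      also have "\<dots> = ennreal (C * V powr (1 - 1 / q))"
        by (simp add: C_def ennreal_mult mult.assoc flip: ennreal_of_nat_eq_real_of_nat)
      finally show ?thesis by (simp add: V_def)
    qed
  qed
  have "0 \<le> C" by (simp add: C_def)
  then show ?thesis using main by blast
qed

section \<open>The weak-type bound\<close>

lemma dyadic_riesz_measurable [measurable]:
  fixes g :: "real ^ 'n \<Rightarrow> real"
  shows "dyadic_riesz \<alpha> g \<in> borel_measurable lebesgue"
proof -
  have "(\<lambda>x. \<integral>\<^sup>+Q. ennreal (measure lebesgue Q powr (\<alpha> / real CARD('n) - 1))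
      * (\<integral>\<^sup>+y\<in>Q. ennreal (g y) \<partial>lebesgue) * indicator Q x \<partial>count_space (grid c))
    \<in> borel_measurable (lebesgue :: (real ^ 'n) measure)" for c
    by (rule grid_sum_measurable)
  then show ?thesis unfolding dyadic_riesz_def by (intro borel_measurable_sum)
qed

lemma dyadic_riesz_cmult:
  fixes g :: "real ^ 'n \<Rightarrow> real"
  assumes [measurable]: "g \<in> borel_measurable lebesgue" and g: "\<And>y. 0 \<le> g y" and z: "0 \<le> z"
  shows "dyadic_riesz \<alpha> (\<lambda>y. z * g y) x = ennreal z * dyadic_riesz \<alpha> g x"
proof -
  have "(\<integral>\<^sup>+y\<in>Q. ennreal (z * g y) \<partial>lebesgue) = ennreal z * (\<integral>\<^sup>+y\<in>Q. ennreal (g y) \<partial>lebesgue)"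
    if "Q \<in> grid c" for c Q
  proof -
    have [measurable]: "Q \<in> sets lebesgue" using that by (rule grid_sets)
    show ?thesis using g z by (simp add: ennreal_mult mult.assoc nn_integral_cmult)
  qed
  then have "(\<integral>\<^sup>+Q. ennreal (measure lebesgue Q powr (\<alpha> / real CARD('n) - 1))
      * (\<integral>\<^sup>+y\<in>Q. ennreal (z * g y) \<partial>lebesgue) * indicator Q x \<partial>count_space (grid c))
     = (\<integral>\<^sup>+Q. ennreal z * (ennreal (measure lebesgue Q powr (\<alpha> / real CARD('n) - 1))
      * (\<integral>\<^sup>+y\<in>Q. ennreal (g y) \<partial>lebesgue) * indicator Q x) \<partial>count_space (grid c))" for c
    by (intro nn_integral_cong) (simp add: mult_ac)
  also have "\<dots> c = ennreal z * (\<integral>\<^sup>+Q. ennreal (measure lebesgue Q powr (\<alpha> / real CARD('n) - 1))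
      * (\<integral>\<^sup>+y\<in>Q. ennreal (g y) \<partial>lebesgue) * indicator Q x \<partial>count_space (grid c))" for c
    by (intro nn_integral_cmult) simp
  finally show ?thesis by (simp add: dyadic_riesz_def sum_distrib_left)
qed

text \<open>For functions f of norm 0, which cannot be normalised.\<close>

lemma dyadic_riesz_AE_0:
  fixes g :: "real ^ 'n \<Rightarrow> real"
  assumes "AE y in lebesgue. g y = 0"
  shows "dyadic_riesz \<alpha> g x = 0"
proof -
  have "(\<integral>\<^sup>+y\<in>Q. ennreal (g y) \<partial>lebesgue) = (\<integral>\<^sup>+y. 0 \<partial>(lebesgue :: (real ^ 'n) measure))" for Q
    by (rule nn_integral_cong_AE) (use assms in eventually_elim, simp)
  then show ?thesis by (simp add: dyadic_riesz_def)
qed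

lemma riesz_kernel_nonneg: "0 \<le> riesz_kernel \<alpha> x y"
  by (simp add: riesz_kernel_def)

lemma riesz_kernel_measurable [measurable]: "riesz_kernel \<alpha> x \<in> borel_measurable lebesgue"
proof -
  have "riesz_kernel \<alpha> x \<in> borel_measurable borel"
    unfolding riesz_kernel_def by measurable
  then show ?thesis by (simp add: measurable_completion)
qed

text \<open>Off the set of convergence the left-hand side is \<open>0\<close>.\<close>
lemma riesz_potential_le:
  "ennreal \<bar>riesz_potential \<alpha> h x\<bar> \<le> (\<integral>\<^sup>+y. ennreal (\<bar>h y\<bar> * riesz_kernel \<alpha> x y) \<partial>lebesgue)"
proof (cases "integrable lebesgue (\<lambda>y. h y * riesz_kernel \<alpha> x y)")
  case True
  from integral_norm_bound_ennreal[OF this] show ?thesis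
    by (simp add: riesz_potential_def abs_mult riesz_kernel_nonneg)
next
  case False
  then show ?thesis by (simp add: riesz_potential_def not_integrable_integral_eq)
qed

text \<open>For p = q the quotient of the conjugate exponents is 1, while
  \<open>1 - \<alpha> / n\<close> is less than 1.\<close>

lemma exponents_strict:
  fixes \<alpha> n p q :: real
  assumes "0 < \<alpha>" "\<alpha> < n" "1 < p" "p \<le> q" "conj_exp p / conj_exp q * (1 - \<alpha> / n) \<ge> 1"
  shows "p < q"
proof (rule ccontr)
  assume "\<not> p < q"
  then have "p = q" using assms by simp
  then have "1 \<le> 1 - \<alpha> / n" using assms by (simp add: conj_exp_def)
  then show False using assms by (simp add: field_simps)
qed

text \<open>The estimate over bounded sets is applied to superlevel sets E of the dyadic majorant D,
  cut to balls: \<open>t * u(E)\<close> is at most a constant times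
  \<open>u(E) powr (1 - 1 / q)\<close>, and u(E), being finite, can be divided out. Finiteness of
  the same integrals over balls makes D finite almost everywhere on the set u > 0, whence the
  convergence.\<close>

theorem theorem1p9:
  fixes \<alpha> p q \<delta> :: real
    and u \<sigma> :: "real ^ 'n \<Rightarrow> real"
  assumes "0 < \<alpha>" and "\<alpha> < real CARD('n)"
    and "1 < p" and "p \<le> q"
    and "conj_exp p / conj_exp q * (1 - \<alpha> / real CARD('n)) \<ge> 1"
    and "\<delta> > 0"
    and "weight u" and "weight \<sigma>"
    and "(SUP Q\<in>(cubes :: (real ^ 'n) set set).
            ennreal (measure lebesgue Q powr (\<alpha> / real CARD('n) + 1 / q - 1 / p))
            * luxemburg_norm (log_bump q \<delta>) Q (\<lambda>x. u x powr (1 / q))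
            * local_norm (conj_exp p) Q (\<lambda>x. \<sigma> x powr (1 / conj_exp p))) < \<infinity>"
  shows "\<exists>C::real. C \<ge> 0 \<and>
           (\<forall>f \<in> Lp_space p \<sigma>.
              (AE x in density lebesgue (\<lambda>x. ennreal (u x)).
                 riesz_converges \<alpha> (\<lambda>y. f y * \<sigma> y) x) \<and>
              weak_Lq_norm q u (riesz_potential \<alpha> (\<lambda>y. f y * \<sigma> y))
                \<le> ennreal C * Lp_norm p \<sigma> f)"
proof -
  have pq: "p < q" using exponents_strict assms by blast
  then have q: "1 < q" using assms by simp
  note u = \<open>weight u\<close> and \<sigma> = \<open>weight \<sigma>\<close>
  note [measurable] = weight_measurable[OF u] weight_measurable[OF \<sigma>]
  obtain C where C: "0 \<le> C" and dyadic: "\<forall>f E. f \<in> borel_measurable lebesgue \<longrightarrow> (\<forall>y. 0 \<le> f y) \<longrightarrow>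
      (\<integral>\<^sup>+y. ennreal (f y powr p * \<sigma> y) \<partial>lebesgue) \<le> 1 \<longrightarrow> E \<in> sets lebesgue \<longrightarrow> bounded E \<longrightarrow>
      (\<integral>\<^sup>+x\<in>E. dyadic_riesz \<alpha> (\<lambda>y. f y * \<sigma> y) x * ennreal (u x) \<partial>lebesgue)
        \<le> ennreal (C * mass lebesgue u E powr (1 - 1 / q))"
    using dyadic_riesz_restricted[OF assms(1-3) pq assms(6) u \<sigma> assms(9)] by blast
  have [measurable]: "ball (0 :: real ^ 'n) r \<in> sets lebesgue" for r by simp
  define C6 where "C6 = 6 powr (real CARD('n) - \<alpha>)"
  have C6: "0 < C6" by (simp add: C6_def)
  have "(AE x in density lebesgue (\<lambda>x. ennreal (u x)). riesz_converges \<alpha> (\<lambda>y. f y * \<sigma> y) x) \<and>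
      weak_Lq_norm q u (riesz_potential \<alpha> (\<lambda>y. f y * \<sigma> y)) \<le> ennreal (C6 * C) * Lp_norm p \<sigma> f"
    if f: "f \<in> Lp_space p \<sigma>" for f
  proof -
    have [measurable]: "f \<in> borel_measurable lebesgue" using f by (simp add: Lp_space_def)
    define I where "I = (\<integral>\<^sup>+x. ennreal (\<bar>f x\<bar> powr p * \<sigma> x) \<partial>lebesgue)"
    define N where "N = enn2real I powr (1 / p)"
    have I: "I < \<infinity>"
    proof (rule ccontr)
      assume "\<not> I < \<infinity>"
      then have "Lp_norm p \<sigma> f = \<infinity>" by (simp add: Lp_norm_def enn_powr_def I_def[symmetric] less_top[symmetric])
      then show False using f by (simp add: Lp_space_def)
    qed
    then have "Lp_norm p \<sigma> f = ennreal N"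
      by (simp add: Lp_norm_def enn_powr_def I_def[symmetric] N_def less_top)
    moreover have "N powr p = enn2real I" using assms(3) by (simp add: N_def powr_powr)
    then have "I = ennreal (N powr p)" using I by simp
    moreover have "0 \<le> N" by (simp add: N_def)
    ultimately have N: "Lp_norm p \<sigma> f = ennreal N" "I = ennreal (N powr p)" "0 \<le> N" by blast+
    define g where "g y = \<bar>f y\<bar> * \<sigma> y" for y
    have [measurable]: "g \<in> borel_measurable lebesgue" unfolding g_def by measurable
    have g: "0 \<le> g y" for y using weight_nonneg[OF \<sigma>] by (simp add: g_def)
    define D where "D = dyadic_riesz \<alpha> g"
    have [measurable]: "D \<in> borel_measurable lebesgue" by (simp add: D_def)
    have restricted: "(\<integral>\<^sup>+x\<in>E. D x * ennreal (u x) \<partial>lebesgue) \<le> ennreal (N * C * mass lebesgue u E powr (1 - 1 / q))"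
      if [measurable]: "E \<in> sets lebesgue" and E: "bounded E" for E
    \<comment> \<open>Normalising divides by N, so norm 0 is treated apart: there f \<sigma>
      vanishes almost everywhere.\<close>
    proof (cases "N = 0")
      case True
      then have "I = 0" using N by simp
      then have "AE x in lebesgue. ennreal (\<bar>f x\<bar> powr p * \<sigma> x) = 0"
        unfolding I_def by (subst (asm) nn_integral_0_iff_AE) auto
      then have "AE x in lebesgue. g x = 0"
      proof eventually_elim
        case (elim x)
        then have "\<bar>f x\<bar> powr p * \<sigma> x \<le> 0" by (simp add: ennreal_eq_0_iff)
        then have "\<bar>f x\<bar> powr p * \<sigma> x = 0"
          using weight_nonneg[OF \<sigma>, of x] by (intro antisym mult_nonneg_nonneg) auto
        then show ?case by (auto simp: g_def)
      qed
      then show ?thesis by (simp add: D_def dyadic_riesz_AE_0)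
    next
      case False
      then have Np: "0 < N" using N by simp
      have "(\<integral>\<^sup>+y. ennreal ((\<bar>f y\<bar> / N) powr p * \<sigma> y) \<partial>lebesgue)
         = (\<integral>\<^sup>+y. ennreal (N powr - p) * ennreal (\<bar>f y\<bar> powr p * \<sigma> y) \<partial>lebesgue)"
        using Np weight_nonneg[OF \<sigma>]
        by (intro nn_integral_cong) (simp add: ennreal_mult[symmetric] powr_divide powr_minus field_simps)
      also have "\<dots> = ennreal (N powr - p) * I"
        unfolding I_def by (intro nn_integral_cmult) measurable
      also have "\<dots> = 1" using Np N by (simp add: ennreal_mult[symmetric] powr_add[symmetric])
      finally have "(\<integral>\<^sup>+x\<in>E. dyadic_riesz \<alpha> (\<lambda>y. \<bar>f y\<bar> / N * \<sigma> y) x * ennreal (u x) \<partial>lebesgue)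
        \<le> ennreal (C * mass lebesgue u E powr (1 - 1 / q))"
        using Np E by (intro dyadic[rule_format]) auto
      then have "ennreal N * (\<integral>\<^sup>+x\<in>E. dyadic_riesz \<alpha> (\<lambda>y. \<bar>f y\<bar> / N * \<sigma> y) x * ennreal (u x) \<partial>lebesgue)
        \<le> ennreal N * ennreal (C * mass lebesgue u E powr (1 - 1 / q))"
        by (rule mult_left_mono) simp
      moreover have "ennreal N * (\<integral>\<^sup>+x\<in>E. dyadic_riesz \<alpha> (\<lambda>y. \<bar>f y\<bar> / N * \<sigma> y) x * ennreal (u x) \<partial>lebesgue)
         = (\<integral>\<^sup>+x\<in>E. D x * ennreal (u x) \<partial>lebesgue)"
      proof -
        have "D x = ennreal N * dyadic_riesz \<alpha> (\<lambda>y. \<bar>f y\<bar> / N * \<sigma> y) x" for x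
          using dyadic_riesz_cmult[of "\<lambda>y. \<bar>f y\<bar> / N * \<sigma> y" N \<alpha> x] Np weight_nonneg[OF \<sigma>]
          by (simp add: D_def g_def[abs_def])
        then show ?thesis by (simp add: nn_integral_cmult[symmetric] mult_ac)
      qed
      ultimately show ?thesis using Np C by (simp add: ennreal_mult mult.assoc)
    qed
    have bound: "(\<integral>\<^sup>+y. ennreal (\<bar>f y * \<sigma> y\<bar> * riesz_kernel \<alpha> x y) \<partial>lebesgue) \<le> ennreal C6 * D x" for x
      using riesz_le_dyadic[OF assms(2), of g x] g weight_nonneg[OF \<sigma>]
      by (simp add: C6_def D_def g_def abs_mult)
    have "AE x in density lebesgue (\<lambda>x. ennreal (u x)). riesz_converges \<alpha> (\<lambda>y. f y * \<sigma> y) x"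
    proof -
      have "AE x in lebesgue. \<forall>n::nat. D x * ennreal (u x) * indicator (ball 0 (real n)) x \<noteq> \<infinity>"
        unfolding AE_all_countable
      proof
        fix n :: nat
        have "(\<integral>\<^sup>+x\<in>ball 0 (real n). D x * ennreal (u x) \<partial>lebesgue) \<noteq> \<infinity>"
          using restricted[of "ball 0 (real n)"] by (auto simp: top_unique)
        then show "AE x in lebesgue. D x * ennreal (u x) * indicator (ball 0 (real n)) x \<noteq> \<infinity>"
          by (intro nn_integral_PInf_AE) measurable
      qed
      then have "AE x in lebesgue. 0 < ennreal (u x) \<longrightarrow> riesz_converges \<alpha> (\<lambda>y. f y * \<sigma> y) x"
      proof eventually_elim
        case (elim x)
        show ?case
        proof
          assume ux: "0 < ennreal (u x)"
          obtain n :: nat where "norm x < real n" using reals_Archimedean2 by blast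
          then have "D x * ennreal (u x) \<noteq> \<infinity>" using elim[rule_format, of n] by simp
          then have "D x < \<infinity>" using ux by (auto simp: ennreal_mult_eq_top_iff less_top)
          then have "ennreal C6 * D x < \<infinity>" by (simp add: ennreal_mult_less_top)
          then have "(\<integral>\<^sup>+y. ennreal (\<bar>f y * \<sigma> y\<bar> * riesz_kernel \<alpha> x y) \<partial>lebesgue) < \<infinity>"
            using bound[of x] by (rule le_less_trans[rotated])
          then show "riesz_converges \<alpha> (\<lambda>y. f y * \<sigma> y) x"
            unfolding riesz_converges_def
            by (intro integrableI_bounded) (auto simp: abs_mult riesz_kernel_nonneg)
        qed
      qed
      then show ?thesis by (subst AE_density) auto
    qed
    moreover have "weak_Lq_norm q u (riesz_potential \<alpha> (\<lambda>y. f y * \<sigma> y)) \<le> ennreal (C6 * C) * Lp_norm p \<sigma> f"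
      unfolding weak_Lq_norm_def
    proof (rule SUP_least)
      fix t :: real assume "t \<in> {0<..}"
      then have t: "0 < t" by simp
      define A where "A = {x. ennreal t < ennreal C6 * D x}"
      have [measurable]: "A \<in> sets lebesgue"
        using borel_measurable_less[of "\<lambda>x. ennreal t" lebesgue "\<lambda>x. ennreal C6 * D x"] by (simp add: A_def)
      \<comment> \<open>The largest V with
        \<open>t * V \<le> C6 * N * C * V powr (1 - 1 / q)\<close>.\<close>
      define B where "B = (C6 * N * C / t) powr q"
      have AR: "(\<integral>\<^sup>+x\<in>A \<inter> ball 0 (real n). ennreal (u x) \<partial>lebesgue) \<le> ennreal B" for n
      proof -
        let ?E = "A \<inter> ball 0 (real n)"
        have E: "bounded ?E" "?E \<in> sets lebesgue" by (auto intro: bounded_Int)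
        define V where "V = mass lebesgue u ?E"
        have "ennreal V = (\<integral>\<^sup>+x\<in>?E. ennreal (u x) \<partial>lebesgue)"
          unfolding V_def by (intro ennreal_mass weight_finite u E)
        moreover have "0 \<le> V" by (simp add: V_def)
        ultimately have V: "ennreal V = (\<integral>\<^sup>+x\<in>?E. ennreal (u x) \<partial>lebesgue)" "0 \<le> V" .
        have "ennreal t * ennreal V = (\<integral>\<^sup>+x. ennreal t * (ennreal (u x) * indicator ?E x) \<partial>lebesgue)"
          unfolding V using E by (intro nn_integral_cmult[symmetric]) measurable
        also have "\<dots> \<le> (\<integral>\<^sup>+x. ennreal C6 * (D x * ennreal (u x) * indicator ?E x) \<partial>lebesgue)"
        proof (intro nn_integral_mono)
          fix x
          show "ennreal t * (ennreal (u x) * indicator ?E x) \<le> ennreal C6 * (D x * ennreal (u x) * indicator ?E x)"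
          proof (cases "x \<in> ?E")
            case True
            then have "ennreal t * ennreal (u x) \<le> ennreal C6 * D x * ennreal (u x)"
              by (intro mult_right_mono) (auto simp: A_def)
            then show ?thesis using True by (simp add: mult.assoc)
          qed simp
        qed
        also have "\<dots> = ennreal C6 * (\<integral>\<^sup>+x\<in>?E. D x * ennreal (u x) \<partial>lebesgue)"
          using E by (intro nn_integral_cmult) measurable
        also have "\<dots> \<le> ennreal C6 * ennreal (N * C * V powr (1 - 1 / q))"
          unfolding V_def by (intro mult_left_mono restricted E) simp
        finally have "t * V \<le> C6 * (N * C * V powr (1 - 1 / q))"
          using t C6 N(3) C V(2) by (simp add: ennreal_mult[symmetric])
        then have h: "t * (V powr (1 / q) * V powr (1 - 1 / q)) \<le> C6 * N * C * V powr (1 - 1 / q)"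
          using V(2) by (simp add: powr_add[symmetric] mult.assoc)
        have "V \<le> B"
        proof (cases "V = 0")
          case False
          then have "0 < V powr (1 - 1 / q)" using V(2) by simp
          with h have "t * V powr (1 / q) \<le> C6 * N * C"
            by (simp only: mult.assoc[symmetric] mult_le_cancel_right_pos)
          then have "V powr (1 / q) \<le> C6 * N * C / t" using t by (simp add: field_simps)
          then have "(V powr (1 / q)) powr q \<le> B" unfolding B_def using q by (intro powr_mono2) auto
          then show ?thesis using q V(2) by (simp add: powr_powr)
        qed (simp add: B_def)
        then show ?thesis unfolding V(1)[symmetric] by (rule ennreal_leI)
      qed
      \<comment> \<open>A is measurable by construction; the comparison with the superlevel set of
        the potential rests on monotonicity of the nonnegative integral, which holds for arbitrary
        sets.\<close>
      have "wmeasure u {x. t < \<bar>riesz_potential \<alpha> (\<lambda>y. f y * \<sigma> y) x\<bar>} \<le> wmeasure u A"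
      proof -
        have "{x. t < \<bar>riesz_potential \<alpha> (\<lambda>y. f y * \<sigma> y) x\<bar>} \<subseteq> A"
        proof
          fix x assume "x \<in> {x. t < \<bar>riesz_potential \<alpha> (\<lambda>y. f y * \<sigma> y) x\<bar>}"
          then have "ennreal t < ennreal \<bar>riesz_potential \<alpha> (\<lambda>y. f y * \<sigma> y) x\<bar>"
            using t by (simp add: ennreal_less_iff)
          also have "\<dots> \<le> ennreal C6 * D x"
            using riesz_potential_le bound by (rule order_trans)
          finally show "x \<in> A" by (simp add: A_def)
        qed
        then show ?thesis unfolding wmeasure_def
          by (intro nn_integral_mono) (auto split: split_indicator)
      qed
      \<comment> \<open>B does not depend on the ball, so monotone convergence over growing balls
        carries the bound to all of A.\<close>
      also have "wmeasure u A = (\<integral>\<^sup>+x. (SUP n. ennreal (u x) * indicator (A \<inter> ball 0 (real n)) x) \<partial>lebesgue)"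
        unfolding wmeasure_def
      proof (intro nn_integral_cong antisym)
        fix x :: "real ^ 'n"
        obtain n :: nat where n: "norm x < real n" using reals_Archimedean2 by blast
        show "ennreal (u x) * indicator A x \<le> (SUP n. ennreal (u x) * indicator (A \<inter> ball 0 (real n)) x)"
          by (rule SUP_upper2[of n]) (use n in \<open>auto split: split_indicator\<close>)
        show "(SUP n. ennreal (u x) * indicator (A \<inter> ball 0 (real n)) x) \<le> ennreal (u x) * indicator A x"
          by (intro SUP_least) (auto split: split_indicator)
      qed
      also have "\<dots> = (SUP n. \<integral>\<^sup>+x. ennreal (u x) * indicator (A \<inter> ball 0 (real n)) x \<partial>lebesgue)"
        by (intro nn_integral_monotone_convergence_SUP)
          (auto simp: incseq_def le_fun_def split: split_indicator)
      also have "\<dots> \<le> ennreal B" by (intro SUP_least AR)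
      finally have W: "wmeasure u {x. t < \<bar>riesz_potential \<alpha> (\<lambda>y. f y * \<sigma> y) x\<bar>} \<le> ennreal B" .
      then obtain w where w: "wmeasure u {x. t < \<bar>riesz_potential \<alpha> (\<lambda>y. f y * \<sigma> y) x\<bar>} = ennreal w" "0 \<le> w"
        by (cases "wmeasure u {x. t < \<bar>riesz_potential \<alpha> (\<lambda>y. f y * \<sigma> y) x\<bar>}") (auto simp: top_unique)
      have "w \<le> B" using W w by (simp add: B_def)
      then have "w powr (1 / q) \<le> B powr (1 / q)" using w q by (intro powr_mono2) auto
      also have "\<dots> = C6 * N * C / t" using q C6 N C t by (simp add: B_def powr_powr)
      finally have "t * w powr (1 / q) \<le> C6 * C * N" using t by (simp add: field_simps)
      then show "ennreal t * enn_powr (wmeasure u {x. t < \<bar>riesz_potential \<alpha> (\<lambda>y. f y * \<sigma> y) x\<bar>}) (1 / q)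
          \<le> ennreal (C6 * C) * Lp_norm p \<sigma> f"
        using t w C6 C N by (simp add: enn_powr_def ennreal_mult[symmetric] ennreal_leI)
    qed
    ultimately show ?thesis ..
  qed
  then show ?thesis using C C6 by (intro exI[of _ "C6 * C"]) auto
qed

end
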